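(* Let $u>0$ and let $n$ be a positive integer. With $U'(a,z)=dU(a,z)/dz$, $$U'\left(\tfrac12u,\sqrt{2u}\,z\right)=-\frac12\left(\frac{2e}{u}\right)^{u/4}\{2u(1+z^2)\}^{1/4}\exp\left\{-u\bar\xi+\sum_{s=1}^{n-1}(-1)^s\frac{\tilde{\mathrm E}_s(\bar\beta)-\tilde{\mathrm E}_s(1)}{u^s}\right\}\{1+\tilde\eta_{n,2}(u,z)\},$$ $$U'\left(\tfrac12u,-\sqrt{2u}\,z\right)=-\frac12\left(\frac{2e}{u}\right)^{u/4}\{2u(1+z^2)\}^{1/4}\exp\left\{u\bar\xi+\sum_{s=1}^{n-1}\frac{\tilde{\mathrm E}_s(\bar\beta)-\tilde{\mathrm E}_s(-1)}{u^s}\right\}\{1+\tilde\eta_{n,1}(u,z)\},$$ where for $j=1,2$ $$|\tilde\eta_{n,j}(u,z)|\le u^{-n}\tilde\omega_{n,j}\exp\{u^{-1}\tilde\varpi_{n,j}+u^{-n}\tilde\omega_{n,j}\},$$ $$\tilde\omega_{n,j}=2\int_{(-1)^j}^{\bar\beta}\left|\tilde{\mathrm E}_n'(p)\,dp\right|+\sum_{s=1}^{n-1}\frac1{u^s}\int_{(-1)^j}^{\bar\beta}\left|\sum_{k=s}^{n-1}(1-p^2)^2\tilde{\mathrm E}_k'(p)\tilde{\mathrm E}_{s+n-k-1}'(p)\,dp\right|,\qquad \tilde\varpi_{n,j}=4\sum_{s=0}^{n-2}\frac1{u^s}\int_{(-1)^j}^{\bar\beta}\left|\tilde{\mathrm E}_{s+1}'(p)\,dp\right|.$$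 For $j=2$ (respectively $j=1$) the integrals are along the image in the $\bar\beta$ plane of any admissible path (see context) joining $z$ to $\Re(z)=+\infty$ (respectively $\Re(z)=-\infty$), and the result holds for every $z$ for which such a path exists; for $j=2$ this is every $z\in\mathbb C$ except points on the two level curves $\Re(\bar\xi)=\text{const}$ emanating from $z=\pm i$ in the left half plane (including $\pm i$), and for $j=1$ the exceptional set is the reflection of this in the imaginary axis.
   Context: $U(a,z)$ is the parabolic cylinder function: the solution of $y''-(\tfrac14z^2+a)y=0$ with $U(a,z)\sim z^{-a-1/2}e^{-z^2/4}$ as $z\to\infty$, $|\arg z|\le\frac34\pi-\delta$. $\bar\xi=\int_0^z(t^2+1)^{1/2}dt=\tfrac12z\sqrt{z^2+1}+\tfrac12\ln(z+\sqrt{z^2+1})$, real with the sign of $z$ for real $z$, and continuous in the plane cut along $z=\pm iy$, $1\le y<\infty$. $\bar\beta=z/\sqrt{z^2+1}$, positive for $z>0$, with the same cuts. (Bars are not complex conjugates.) If a path crosses a cut, $\bar\xi$, $\bar\beta$ and the fractional power of $1+z^2$ are continued continuously along it. $\tilde{\mathrm E}_1(\bar\beta)=\frac1{24}\bar\beta(7\bar\beta^2-6)$, $\tilde{\mathrm E}_2(\bar\beta)=\frac1{16}(1-\bar\beta^2)^2(2-7\bar\beta^2)$, and for $s\ge2$ $$\tilde{\mathrm E}_{s+1}(\bar\beta)=-\tfrac12(1-\bar\beta^2)^2\tilde{\mathrm E}_s'(\bar\beta)-\tfrac12\int_{\sigma(s)}^{\bar\beta}(1-p^2)^2\sum_{j=1}^{s-1}\tilde{\mathrm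 E}_j'(p)\tilde{\mathrm E}_{s-j}'(p)\,dp,$$ with $\sigma(s)=1$ for $s$ odd and $\sigma(s)=0$ for $s$ even. An admissible path is a path in the $z$ plane that avoids $z=\pm i$, consists of a finite chain of $R_2$ arcs (arcs with a parametrization whose second derivative is continuous and whose first derivative does not vanish), and along which $\Re(\bar\xi)$, varying continuously, is monotonic.
   Formalization: "Monotonic" is made directional: along the path from z, Re(ξ̄) is nondecreasing towards Re(z)=+∞ (j=2) and nonincreasing towards Re(z)=−∞ (j=1); with either direction allowed, the exceptional points would be reachable and the expansion would fail on part of the left (right) half plane. *)

theory Defs
  imports "HOL-Complex_Analysis.Complex_Analysis" "HOL-Library.Landau_Symbols"
begin

definition is_parabolic_cylinder_U :: "complex \<Rightarrow> (complex \<Rightarrow> complex) \<Rightarrow> bool" where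
  "is_parabolic_cylinder_U a f \<longleftrightarrow>
     f holomorphic_on UNIV \<and>
     (\<forall>z. deriv (deriv f) z - (z\<^sup>2 / 4 + a) * f z = 0) \<and>
     (\<forall>\<delta>>0. f \<sim>[inf at_infinity (principal {z. \<bar>Arg z\<bar> \<le> 3 / 4 * pi - \<delta>})]
        (\<lambda>z. z powr (- a - 1 / 2) * exp (- z\<^sup>2 / 4)))"

definition parabolic_cylinder_U :: "complex \<Rightarrow> complex \<Rightarrow> complex" where
  "parabolic_cylinder_U a = (THE f. is_parabolic_cylinder_U a f)"

text \<open>The principal branches of \<open>csqrt\<close> and \<open>Ln\<close> give exactly the cuts
  \<open>z = iy\<close> and \<open>z = -iy\<close>, \<open>1 \<le> y\<close>.\<close>

definition xi_bar :: "complex \<Rightarrow> complex" where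
  "xi_bar z = 1 / 2 * z * csqrt (z\<^sup>2 + 1) + 1 / 2 * Ln (z + csqrt (z\<^sup>2 + 1))"

text \<open>The value at index 0 is a dummy and is never used. The integrands are polynomials, so
  the straight segment stands for an arbitrary path of integration.\<close>

fun E_tilde :: "nat \<Rightarrow> complex \<Rightarrow> complex" where
  "E_tilde 0 = (\<lambda>\<beta>. 0)"
| "E_tilde (Suc 0) = (\<lambda>\<beta>. 1 / 24 * \<beta> * (7 * \<beta>\<^sup>2 - 6))"
| "E_tilde (Suc (Suc 0)) = (\<lambda>\<beta>. 1 / 16 * (1 - \<beta>\<^sup>2)\<^sup>2 * (2 - 7 * \<beta>\<^sup>2))"
| "E_tilde (Suc (Suc (Suc m))) = (let s = Suc (Suc m) in (\<lambda>\<beta>.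
     - 1 / 2 * (1 - \<beta>\<^sup>2)\<^sup>2 * deriv (E_tilde s) \<beta>
     - 1 / 2 * contour_integral (linepath (if odd s then 1 else 0) \<beta>)
         (\<lambda>p. (1 - p\<^sup>2)\<^sup>2 * (\<Sum>j = 1..s - 1. deriv (E_tilde j) p * deriv (E_tilde (s - j)) p))))"

definition R2_arc_on :: "(real \<Rightarrow> complex) \<Rightarrow> real set \<Rightarrow> bool" where
  "R2_arc_on \<gamma> I \<longleftrightarrow> (\<exists>\<gamma>' \<gamma>''.
     (\<forall>t\<in>I. (\<gamma> has_vector_derivative \<gamma>' t) (at t within I)) \<and>
     (\<forall>t\<in>I. (\<gamma>' has_vector_derivative \<gamma>'' t) (at t within I)) \<and>
     continuous_on I \<gamma>'' \<and> (\<forall>t\<in>I. \<gamma>' t \<noteq> 0))"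

text \<open>Paths run from \<open>z\<close> to infinity and are parametrized over \<open>{0..}\<close>.\<close>

definition R2_chain :: "(real \<Rightarrow> complex) \<Rightarrow> bool" where
  "R2_chain \<gamma> \<longleftrightarrow> (\<exists>(m::nat) \<tau>. \<tau> 0 = 0 \<and>
     (\<forall>i<m. \<tau> i < \<tau> (Suc i) \<and> R2_arc_on \<gamma> {\<tau> i..\<tau> (Suc i)}) \<and>
     R2_arc_on \<gamma> {\<tau> m..})"

text \<open>Continuous continuation along \<open>\<gamma>\<close>, from the principal values near the infinite end, of
  \<open>(1 + z\<^sup>2)\<^bsup>1/4\<^esup>\<close> (as \<open>q\<close>) and of \<open>\<xi>\<close>-bar (as \<open>X\<close>). With \<open>r = q\<^sup>2\<close> the continued square root,
  the exponential equation says that \<open>X\<close> is a value of \<open>(z r + log (z + r)) / 2\<close>.\<close>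

definition continued_along ::
    "(real \<Rightarrow> complex) \<Rightarrow> (real \<Rightarrow> complex) \<Rightarrow> (real \<Rightarrow> complex) \<Rightarrow> bool" where
  "continued_along \<gamma> q X \<longleftrightarrow>
     continuous_on {0..} q \<and> continuous_on {0..} X \<and>
     (\<forall>t\<ge>0. q t ^ 4 = 1 + (\<gamma> t)\<^sup>2 \<and>
            exp (2 * X t - \<gamma> t * (q t)\<^sup>2) = \<gamma> t + (q t)\<^sup>2) \<and>
     (\<forall>\<^sub>F t in at_top. q t = (1 + (\<gamma> t)\<^sup>2) powr (1 / 4) \<and> X t = xi_bar (\<gamma> t))"

text \<open>The image of the path in the \<open>\<beta>\<close>-bar plane, \<open>\<beta> = z / (z\<^sup>2 + 1)\<^bsup>1/2\<^esup>\<close> continued along it.\<close>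

definition beta_path :: "(real \<Rightarrow> complex) \<Rightarrow> (real \<Rightarrow> complex) \<Rightarrow> real \<Rightarrow> complex" where
  "beta_path \<gamma> q t = \<gamma> t / (q t)\<^sup>2"

text \<open>\<open>j = 2\<close>: the path joins \<open>\<gamma> 0\<close> to \<open>Re z = +\<infinity>\<close>; \<open>j = 1\<close>: to \<open>Re z = -\<infinity>\<close>. The real part of
  \<open>\<xi>\<close>-bar must be monotonic in the sense belonging to that end: nondecreasing from \<open>\<gamma> 0\<close> towards
  \<open>+\<infinity>\<close>, nonincreasing towards \<open>-\<infinity>\<close>. Otherwise curves such as \<open>t + i t\<^sup>2\<close>, on which
  \<open>Re z \<rightarrow> +\<infinity>\<close> but \<open>Re \<xi> \<rightarrow> -\<infinity>\<close>, would be admitted and the exceptional set would be wrong.\<close>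

definition admissible_path ::
    "nat \<Rightarrow> (real \<Rightarrow> complex) \<Rightarrow> (real \<Rightarrow> complex) \<Rightarrow> (real \<Rightarrow> complex) \<Rightarrow> bool" where
  "admissible_path j \<gamma> q X \<longleftrightarrow>
     R2_chain \<gamma> \<and> (\<forall>t\<ge>0. \<gamma> t \<noteq> \<i> \<and> \<gamma> t \<noteq> - \<i>) \<and>
     filterlim (\<lambda>t. (- 1) ^ j * Re (\<gamma> t)) at_top at_top \<and>
     continued_along \<gamma> q X \<and>
     mono_on {0..} (\<lambda>t. (- 1) ^ j * Re (X t))"

text \<open>\<open>\<integral> |F(p) dp|\<close> along the path \<open>\<beta>\<close>; it may be infinite.\<close>

definition abs_path_integral :: "(complex \<Rightarrow> complex) \<Rightarrow> (real \<Rightarrow> complex) \<Rightarrow> ennreal" where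
  "abs_path_integral F \<beta> =
     (\<integral>\<^sup>+ t\<in>{0..}. ennreal (cmod (F (\<beta> t) * vector_derivative \<beta> (at t))) \<partial>lborel)"

definition omega_tilde :: "nat \<Rightarrow> real \<Rightarrow> (real \<Rightarrow> complex) \<Rightarrow> ennreal" where
  "omega_tilde n u \<beta> =
     2 * abs_path_integral (deriv (E_tilde n)) \<beta> +
     (\<Sum>s = 1..n - 1. ennreal (1 / u ^ s) *
        abs_path_integral (\<lambda>p. \<Sum>k = s..n - 1. (1 - p\<^sup>2)\<^sup>2 * deriv (E_tilde k) p *
                                 deriv (E_tilde (s + n - k - 1)) p) \<beta>)"

text \<open>The sum runs over \<open>0 \<le> s \<le> n - 2\<close> in the integers, so it is empty for \<open>n = 1\<close>.\<close>

definition varpi_tilde :: "nat \<Rightarrow> real \<Rightarrow> (real \<Rightarrow> complex) \<Rightarrow> ennreal" where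
  "varpi_tilde n u \<beta> =
     4 * (\<Sum>s<n - 1. ennreal (1 / u ^ s) * abs_path_integral (deriv (E_tilde (s + 1))) \<beta>)"

text \<open>The bound is void when one of the integrals diverges.\<close>

definition within_error_bound :: "nat \<Rightarrow> real \<Rightarrow> (real \<Rightarrow> complex) \<Rightarrow> complex \<Rightarrow> bool" where
  "within_error_bound n u \<beta> e \<longleftrightarrow>
     (omega_tilde n u \<beta> < \<infinity> \<and> varpi_tilde n u \<beta> < \<infinity> \<longrightarrow>
      cmod e \<le> 1 / u ^ n * enn2real (omega_tilde n u \<beta>) *
        exp (1 / u * enn2real (varpi_tilde n u \<beta>) + 1 / u ^ n * enn2real (omega_tilde n u \<beta>)))"

text \<open>The level curve of \<open>Re \<xi>\<close> emanating from \<open>c\<close> (for \<open>c = i\<close> or \<open>c = -i\<close>) into the open left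
  half plane, including \<open>c\<close>.\<close>

definition left_level_curve :: "complex \<Rightarrow> complex set" where
  "left_level_curve c =
     connected_component_set ({z. Re z < 0 \<and> Re (xi_bar z) = Re (xi_bar c)} \<union> {c}) c"

definition exceptional_set :: "complex set" where
  "exceptional_set = left_level_curve \<i> \<union> left_level_curve (- \<i>)"

end

theory Submission imports Defs
begin

text \<open>The substitution \<open>z = sinh w\<close> uniformizes everything: the continued quantities become
  \<open>q\<^sup>2 = cosh w\<close>, \<open>\<beta> = tanh w\<close> and \<open>\<xi> = w / 2 + sinh (2 w) / 4\<close>. Monotonicity of \<open>Re \<xi>\<close> keeps a lifted
  admissible path inside a region on which \<open>sinh\<close> is injective, so \<open>q\<close> and \<open>X\<close> depend on the end point
  only; conversely horizontal and vertical segments and level curves of \<open>Re \<xi>\<close> reach every point of it.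

  As a function of \<open>\<xi>\<close>, \<open>V = U' / q\<close> satisfies \<open>V'' = (u\<^sup>2 + 2 F\<^sub>1) V\<close> with \<open>F\<^sub>s = (1 - \<beta>\<^sup>2)\<^sup>2 E\<^sub>s'\<close>, and the
  recurrence for \<open>E\<^sub>s\<close> says that the truncated expansion solves the Riccati equation of this
  equation up to \<open>O(u\<^bsup>1-n\<^esup>)\<close>. For the relative error \<open>\<eta>\<close> and \<open>\<zeta> = \<eta>' / (2 u)\<close>, integrating
  from the infinite end, where both vanish, gives a Volterra inequality for \<open>|\<eta> - \<zeta>| + |\<zeta>|\<close>; the factor
  \<open>exp (2 u \<xi>)\<close> in the equation for \<open>\<zeta>\<close> is harmless because \<open>Re \<xi>\<close> is monotonic. Gronwall's inequality
  then yields the bound. The expansion at \<open>- \<infinity>\<close> follows by \<open>z \<mapsto> - z\<close>.\<close>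

subsection \<open>The coefficients\<close>

text \<open>Since d beta / d xi = (1 - beta^2)^2, F_s is the derivative of E_s(beta) in xi, and the
  approximation has logarithmic derivative g - u with g = sum F_s (-1/u)^s. Let R be its Riccati
  residual and rho = R / u. The error obeys eta' = 2 u zeta and zeta' = 2 u zeta - J with J = rho (1
  + eta) / 2 + 2 g zeta. The obstacle is the large term 2 u zeta: estimated as it stands, it would
  put u times the length of the path into the exponent of the bound. In eta - zeta it cancels, since
  (eta - zeta)' = J, and in the equation for zeta an integrating factor removes it. Both moduli are
  then bounded by the integral of one majorant of |J|, and their sum by twice that: hence the 4 in
  \<open>varpi_tilde\<close>. The leading term -2 F_n (-1/u)^(n-1) of R gives the 2 in
  \<open>omega_tilde\<close>. That both unknowns vanish at infinity needs the asymptotics of U and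
  of U', for an arbitrary approach to Re z = infinity. As U is a definite description, its existence
  and uniqueness have to be proved as well.\<close>

definition F_tilde :: "nat \<Rightarrow> complex \<Rightarrow> complex" where
  "F_tilde s \<beta> = (1 - \<beta>\<^sup>2)\<^sup>2 * deriv (E_tilde s) \<beta>"

lemma has_field_derivative_contour_integral_linepath:
  assumes "G holomorphic_on UNIV"
  shows "((\<lambda>\<beta>. contour_integral (linepath a \<beta>) G) has_field_derivative G \<beta>) (at \<beta>)"
proof -
  obtain g where g: "\<And>x. (g has_field_derivative G x) (at x)"
    using holomorphic_convex_primitive'[OF convex_UNIV open_UNIV assms] by auto
  have "contour_integral (linepath a \<beta>) G = g \<beta> - g a" for \<beta>
    using contour_integral_primitive[of UNIV g G "linepath a \<beta>"] g
    by (auto intro: contour_integral_unique)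
  thus ?thesis using DERIV_diff[OF g DERIV_const] by simp
qed

text \<open>Serves twice: it shows that the explicit second coefficient is -F_1 / 2, so that the
  recurrence starts at s = 1, and it is half the perturbation of u^2 that the Liouville
  transformation produces.\<close>

lemma F_tilde_1: "F_tilde 1 \<beta> = (7 * \<beta>\<^sup>2 - 2) * (1 - \<beta>\<^sup>2)\<^sup>2 / 8"
proof -
  have "deriv (E_tilde (Suc 0)) \<beta> = (21 * \<beta>\<^sup>2 - 6) / 24"
    by (rule DERIV_imp_deriv)
       (auto intro!: derivative_eq_intros simp: E_tilde.simps(2)[abs_def] field_simps power2_eq_square)
  hence "F_tilde 1 \<beta> = (1 - \<beta>\<^sup>2)\<^sup>2 * ((21 * \<beta>\<^sup>2 - 6) / 24)" by (simp only: F_tilde_def One_nat_def)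
  also have "(21 * \<beta>\<^sup>2 - 6) / 24 = (7 * \<beta>\<^sup>2 - 2) / 8" by simp
  finally show ?thesis by simp
qed

text \<open>Both claims go in one induction, since the \<open>deriv\<close> in the recursive clause
  carries information only once the earlier coefficients are known to be entire. Differentiating
  removes the lower limit of integration.\<close>

lemma E_tilde_derivs:
  "E_tilde s holomorphic_on UNIV"
  "s \<ge> 1 \<Longrightarrow> deriv (E_tilde (Suc s)) \<beta> =
     - 1 / 2 * deriv (F_tilde s) \<beta> - 1 / 2 * (1 - \<beta>\<^sup>2)\<^sup>2 * (\<Sum>j = 1..s - 1. deriv (E_tilde j) \<beta> * deriv (E_tilde (s - j)) \<beta>)"
proof -
  have "E_tilde s holomorphic_on UNIV \<and> (s \<ge> 1 \<longrightarrow> (\<forall>\<beta>. deriv (E_tilde (Suc s)) \<beta> =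
     - 1 / 2 * deriv (F_tilde s) \<beta> - 1 / 2 * (1 - \<beta>\<^sup>2)\<^sup>2 * (\<Sum>j = 1..s - 1. deriv (E_tilde j) \<beta> * deriv (E_tilde (s - j)) \<beta>)))"
  proof (induction s rule: less_induct)
    case (less s)
    have IH1: "E_tilde j holomorphic_on UNIV" if "j < s" for j using less.IH that by blast
    have hol': "deriv (E_tilde j) holomorphic_on UNIV" if "j < s" for j
      by (intro holomorphic_deriv IH1 that open_UNIV)
    \<comment> \<open>Stated for arbitrary t: t = s - 1 gives holomorphy of E_s, and t = s gives the
      derivative of E_(s+1).\<close>
    have step: "E_tilde (Suc t) holomorphic_on UNIV \<and> deriv (E_tilde (Suc t)) \<beta> =
       - 1 / 2 * deriv (F_tilde t) \<beta> - 1 / 2 * (1 - \<beta>\<^sup>2)\<^sup>2 * (\<Sum>j = 1..t - 1. deriv (E_tilde j) \<beta> * deriv (E_tilde (t - j)) \<beta>)"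
      if t: "t \<ge> 2" and hol: "\<And>j. j \<le> t \<Longrightarrow> E_tilde j holomorphic_on UNIV" for t \<beta>
    proof -
      obtain m where m: "t = Suc (Suc m)" using t by (metis Suc_le_D numeral_2_eq_2 Suc_le_mono)
      define G where "G p = (1 - p\<^sup>2)\<^sup>2 * (\<Sum>j = 1..t - 1. deriv (E_tilde j) p * deriv (E_tilde (t - j)) p)" for p
      have hol': "deriv (E_tilde j) holomorphic_on UNIV" if "j \<le> t" for j
        by (intro holomorphic_deriv hol that open_UNIV)
      have "G holomorphic_on UNIV"
        unfolding G_def by (intro holomorphic_intros hol') auto
      note dG = has_field_derivative_contour_integral_linepath[OF this]
      have F: "F_tilde t holomorphic_on UNIV"
        unfolding F_tilde_def[abs_def] by (intro holomorphic_intros hol') auto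
      have E: "E_tilde (Suc t) = (\<lambda>\<beta>. - 1 / 2 * F_tilde t \<beta> - 1 / 2 * contour_integral (linepath (if odd t then 1 else 0) \<beta>) G)"
        by (rule ext) (simp add: m Let_def F_tilde_def G_def[abs_def])
      have "(E_tilde (Suc t) has_field_derivative (- 1 / 2 * deriv (F_tilde t) \<beta> - 1 / 2 * G \<beta>)) (at \<beta>)" for \<beta>
        unfolding E using holomorphic_derivI[OF F open_UNIV]
        by (intro DERIV_diff DERIV_cmult dG) auto
      thus ?thesis
        by (auto simp: holomorphic_on_open DERIV_imp_deriv G_def mult.assoc)
    qed
    have hol: "E_tilde s holomorphic_on UNIV"
    proof (cases "s \<ge> 3")
      case True
      then obtain t where t: "s = Suc t" "t \<ge> 2" by (cases s) auto
      show ?thesis using step[OF t(2)] IH1 t by auto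
    next
      case False
      hence "s = 0 \<or> s = Suc 0 \<or> s = Suc (Suc 0)" by auto
      thus ?thesis by (elim disjE) (auto intro!: holomorphic_intros)
    qed
    have "deriv (E_tilde (Suc s)) \<beta> =
       - 1 / 2 * deriv (F_tilde s) \<beta> - 1 / 2 * (1 - \<beta>\<^sup>2)\<^sup>2 * (\<Sum>j = 1..s - 1. deriv (E_tilde j) \<beta> * deriv (E_tilde (s - j)) \<beta>)" if s: "s \<ge> 1" for \<beta>
    proof (cases "s = 1")
      case True
      \<comment> \<open>The explicit second coefficient is -F_1 / 2, and the convolution sum is
        empty for s = 1.\<close>
      have "E_tilde (Suc s) = (\<lambda>\<beta>. - 1 / 2 * F_tilde s \<beta>)"
        by (rule ext) (simp add: True F_tilde_1[unfolded One_nat_def] field_simps)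
      moreover have "F_tilde s holomorphic_on UNIV"
        unfolding F_tilde_def[abs_def] by (intro holomorphic_intros holomorphic_deriv hol open_UNIV)
      hence "F_tilde s field_differentiable (at \<beta>)"
        by (simp add: holomorphic_on_def field_differentiable_def)
      hence "((\<lambda>\<beta>. - 1 / 2 * F_tilde s \<beta>) has_field_derivative - 1 / 2 * deriv (F_tilde s) \<beta>) (at \<beta>)"
        by (intro DERIV_cmult) (simp add: DERIV_deriv_iff_field_differentiable)
      ultimately have "deriv (E_tilde (Suc s)) \<beta> = - 1 / 2 * deriv (F_tilde s) \<beta>"
        by (simp only: DERIV_imp_deriv)
      thus ?thesis using True by simp
    next
      case False
      thus ?thesis using step[of s \<beta>] s IH1 hol by (metis Suc_1 le_neq_implies_less le_antisym not_less_eq_eq)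
    qed
    with hol show ?case by blast
  qed
  thus "E_tilde s holomorphic_on UNIV"
    "s \<ge> 1 \<Longrightarrow> deriv (E_tilde (Suc s)) \<beta> =
     - 1 / 2 * deriv (F_tilde s) \<beta> - 1 / 2 * (1 - \<beta>\<^sup>2)\<^sup>2 * (\<Sum>j = 1..s - 1. deriv (E_tilde j) \<beta> * deriv (E_tilde (s - j)) \<beta>)"
    by blast+
qed

lemma E_tilde_has_field_derivative:
  "(E_tilde s has_field_derivative deriv (E_tilde s) \<beta>) (at \<beta>)"
  by (rule holomorphic_derivI[OF E_tilde_derivs(1) open_UNIV]) auto

lemma F_tilde_holomorphic: "F_tilde s holomorphic_on UNIV"
  unfolding F_tilde_def[abs_def] by (intro holomorphic_intros holomorphic_deriv E_tilde_derivs(1) open_UNIV)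

text \<open>In the variable xi, where (1 - beta^2)^2 d/d beta is d/d xi, the recurrence becomes 2
  F_(s+1) + F_s' + sum F_j F_(s-j) = 0: a coefficient of the Riccati equation in powers of
  -1/u.\<close>

lemma F_tilde_Suc:
  assumes "s \<ge> 1"
  shows "F_tilde (Suc s) \<beta> = - ((1 - \<beta>\<^sup>2)\<^sup>2 * deriv (F_tilde s) \<beta>) / 2 - (\<Sum>j = 1..s - 1. F_tilde j \<beta> * F_tilde (s - j) \<beta>) / 2"
proof -
  have "F_tilde (Suc s) \<beta> = (1 - \<beta>\<^sup>2)\<^sup>2 * (- 1 / 2 * deriv (F_tilde s) \<beta> - 1 / 2 * (1 - \<beta>\<^sup>2)\<^sup>2 * (\<Sum>j = 1..s - 1. deriv (E_tilde j) \<beta> * deriv (E_tilde (s - j)) \<beta>))"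
    by (simp add: F_tilde_def[of "Suc s"] E_tilde_derivs(2)[OF assms])
  also have "\<dots> = - ((1 - \<beta>\<^sup>2)\<^sup>2 * deriv (F_tilde s) \<beta>) / 2 - (\<Sum>j = 1..s - 1. (1 - \<beta>\<^sup>2)\<^sup>2 * (1 - \<beta>\<^sup>2)\<^sup>2 * (deriv (E_tilde j) \<beta> * deriv (E_tilde (s - j)) \<beta>)) / 2"
    by (subst sum_distrib_left[symmetric]) (simp add: algebra_simps)
  finally show ?thesis by (simp add: F_tilde_def mult_ac)
qed

lemma deriv_minus_parity:
  fixes f :: "complex \<Rightarrow> complex"
  assumes "f holomorphic_on UNIV" "\<And>x. f (- x) = k * f x"
  shows "deriv f (- x) = - k * deriv f x"
proof -
  have d: "(f has_field_derivative deriv f x) (at x)" for x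
    by (rule holomorphic_derivI[OF assms(1) open_UNIV]) auto
  have "((\<lambda>x. f (- x)) has_field_derivative deriv f (- x) * (- 1)) (at x)"
    by (rule DERIV_chain2[OF d]) (auto intro!: derivative_eq_intros)
  moreover have "((\<lambda>x. f (- x)) has_field_derivative k * deriv f x) (at x)"
    unfolding assms(2) by (intro DERIV_cmult d)
  ultimately show ?thesis using DERIV_unique by force
qed

text \<open>The derivatives have the right parity by induction, so the parity defect is constant.
  For even s it vanishes at 0 trivially, for odd s because of the lower limit 0. This symmetry
  carries the expansion at + infinity to - infinity.\<close>

lemma E_tilde_minus: "E_tilde s (- \<beta>) = (- 1) ^ s * E_tilde s \<beta>"
proof (induction s arbitrary: \<beta> rule: less_induct)
  case (less s \<beta>)
  consider "s = 0" | "s = Suc 0" | "s = Suc (Suc 0)" | t where "s = Suc t" "t \<ge> 2"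
    by (metis One_nat_def Suc_1 Suc_leI gr_zeroI not_less_eq_eq not0_implies_Suc le_zero_eq not_less_eq le_antisym)
  thus ?case
  proof cases
    case 4
    note t = this
    have dE: "deriv (E_tilde j) (- x) = (- 1) ^ Suc j * deriv (E_tilde j) x" if "j \<le> t" for j x
      using deriv_minus_parity[OF E_tilde_derivs(1), of j "(- 1) ^ j"] less.IH[of j] that t by simp
    have F: "F_tilde t (- x) = (- 1) ^ Suc t * F_tilde t x" for x
      using dE[of t x] by (simp add: F_tilde_def)
    have dF: "deriv (F_tilde t) (- x) = (- 1) ^ t * deriv (F_tilde t) x" for x
      using deriv_minus_parity[OF F_tilde_holomorphic, of t "(- 1) ^ Suc t" x] F by simp
    have sum: "(\<Sum>j = 1..t - 1. deriv (E_tilde j) (- x) * deriv (E_tilde (t - j)) (- x))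
       = (- 1) ^ t * (\<Sum>j = 1..t - 1. deriv (E_tilde j) x * deriv (E_tilde (t - j)) x)" for x
      unfolding sum_distrib_left
    proof (rule sum.cong[OF refl], goal_cases)
      case (1 j)
      have "(- 1 :: complex) ^ Suc j * (- 1) ^ Suc (t - j) = (- 1) ^ (Suc j + Suc (t - j))"
        by (simp only: power_add)
      also have "Suc j + Suc (t - j) = t + 2" using 1 by auto
      finally have "(- 1 :: complex) ^ Suc j * (- 1) ^ Suc (t - j) = (- 1) ^ t" by simp
      moreover have "deriv (E_tilde j) (- x) * deriv (E_tilde (t - j)) (- x) =
        ((- 1) ^ Suc j * (- 1) ^ Suc (t - j)) * (deriv (E_tilde j) x * deriv (E_tilde (t - j)) x)"
        using dE[of "t - j" x] 1 by (subst dE) (auto simp: mult_ac)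
      ultimately show ?case by simp
    qed
    have ds: "deriv (E_tilde s) (- x) = (- 1) ^ t * deriv (E_tilde s) x" for x
    proof -
      have t1: "t \<ge> 1" using t by simp
      show ?thesis unfolding \<open>s = Suc t\<close> E_tilde_derivs(2)[OF t1] dF sum by (simp add: algebra_simps)
    qed
    define H where "H x = E_tilde s (- x) - (- 1) ^ s * E_tilde s x" for x
    have "(H has_field_derivative 0) (at x)" for x
    proof -
      have "(H has_field_derivative deriv (E_tilde s) (- x) * (- 1) - (- 1) ^ s * deriv (E_tilde s) x) (at x)"
        unfolding H_def[abs_def]
        by (intro DERIV_diff DERIV_cmult E_tilde_has_field_derivative DERIV_chain2[OF E_tilde_has_field_derivative])
           (auto intro!: derivative_eq_intros)
      thus ?thesis using ds[of x] t by simp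
    qed
    hence "\<exists>c. \<forall>x\<in>UNIV. H x = c" by (intro has_field_derivative_zero_constant) auto
    hence "H \<beta> = H 0" by auto
    also have "H 0 = 0"
    proof (cases "even s")
      case False
      obtain m where m: "t = Suc (Suc m)" using t(2) by (metis Suc_le_D numeral_2_eq_2 Suc_le_mono)
      \<comment> \<open>Here t is even, so the integral starts at 0 and E_t' is odd; both terms of
        the recursive clause vanish at 0.\<close>
      have "deriv (E_tilde t) 0 = 0" using dE[of t 0] False t by simp
      hence "E_tilde s 0 = 0" using False t by (simp add: m Let_def)
      thus ?thesis by (simp add: H_def)
    qed (simp add: H_def)
    finally show ?thesis by (simp add: H_def)
  qed auto
qed

subsection \<open>The Riccati residual\<close>

text \<open>The pairs (j, k) are split by whether j + k <= n - 1. The overflow is numbered by s = j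
  + k + 1 - n, which produces the double sum of \<open>omega_tilde\<close>.\<close>

lemma sum_square_split:
  fixes a :: "nat \<Rightarrow> complex"
  assumes "n \<ge> 1"
  shows "(\<Sum>s = 1..n - 1. a s * x ^ s)\<^sup>2 = (\<Sum>s = 1..n - 1. x ^ s * (\<Sum>j = 1..s - 1. a j * a (s - j)))
     + (\<Sum>s = 1..n - 1. x ^ (s + n - 1) * (\<Sum>k = s..n - 1. a k * a (s + n - k - 1)))"
proof -
  let ?A = "{1..n-1} \<times> {1..n-1}"
  let ?f = "\<lambda>(j, k). (a j * x ^ j) * (a k * x ^ k)"
  have "(\<Sum>s = 1..n - 1. a s * x ^ s)\<^sup>2 = sum ?f ?A"
    by (simp add: power2_eq_square sum_product sum.cartesian_product)
  also have "?A = {p \<in> ?A. fst p + snd p \<le> n - 1} \<union> {p \<in> ?A. fst p + snd p > n - 1}" by auto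
  also have "sum ?f \<dots> = sum ?f {p \<in> ?A. fst p + snd p \<le> n - 1} + sum ?f {p \<in> ?A. fst p + snd p > n - 1}"
    by (rule sum.union_disjoint) auto
  also have "sum ?f {p \<in> ?A. fst p + snd p \<le> n - 1} = (\<Sum>(s, j)\<in>(SIGMA s:{1..n-1}. {1..s-1}). x ^ s * (a j * a (s - j)))"
    by (rule sum.reindex_bij_witness[of _ "\<lambda>(s, j). (j, s - j)" "\<lambda>(j, k). (j + k, j)"])
       (auto simp: power_add)
  also have "\<dots> = (\<Sum>s = 1..n - 1. x ^ s * (\<Sum>j = 1..s - 1. a j * a (s - j)))"
    by (simp add: sum.Sigma[symmetric] sum_distrib_left)
  also have "sum ?f {p \<in> ?A. fst p + snd p > n - 1} = (\<Sum>(s, k)\<in>(SIGMA s:{1..n-1}. {s..n-1}). x ^ (s + n - 1) * (a k * a (s + n - k - 1)))"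
    by (rule sum.reindex_bij_witness[of _ "\<lambda>(s, k). (k, s + n - k - 1)" "\<lambda>(j, k). (j + k + 1 - n, j)"])
       (use assms in \<open>auto simp flip: power_add\<close>)
  also have "\<dots> = (\<Sum>s = 1..n - 1. x ^ (s + n - 1) * (\<Sum>k = s..n - 1. a k * a (s + n - k - 1)))"
    by (simp add: sum.Sigma[symmetric] sum_distrib_left)
  finally show ?thesis .
qed

text \<open>Here x stands for -1/u. The recurrence cancels all intermediate powers of x; what is
  left is 2 F_1, the first neglected coefficient and the overflow of the square.\<close>

lemma riccati_residual:
  fixes F DF :: "nat \<Rightarrow> complex"
  assumes "n \<ge> 1" "x \<noteq> 0" and rec: "\<And>s. s \<ge> 1 \<Longrightarrow> F (Suc s) = - DF s / 2 - (\<Sum>j = 1..s - 1. F j * F (s - j)) / 2"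
  shows "(\<Sum>s = 1..n - 1. DF s * x ^ s) + 2 * (\<Sum>s = 1..n - 1. F s * x ^ s) / x + (\<Sum>s = 1..n - 1. F s * x ^ s)\<^sup>2
    = 2 * F 1 - 2 * F n * x ^ (n - 1) + (\<Sum>s = 1..n - 1. x ^ (s + n - 1) * (\<Sum>k = s..n - 1. F k * F (s + n - k - 1)))"
proof -
  \<comment> \<open>A telescoping sum: each step trades -2 F_(m+1) x^m for -2 F_(m+2)
    x^(m+1).\<close>
  have "(\<Sum>s = 1..m. DF s * x ^ s) + 2 * (\<Sum>s = 1..m. F s * x ^ s) / x + (\<Sum>s = 1..m. x ^ s * (\<Sum>j = 1..s - 1. F j * F (s - j)))
     = 2 * F 1 - 2 * F (Suc m) * x ^ m" for m
  proof (induction m)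
    case (Suc m)
    define S where "S = (\<Sum>j = 1..m. F j * F (Suc m - j))"
    have D: "DF (Suc m) = - 2 * F (Suc (Suc m)) - S" using rec[of "Suc m"] unfolding S_def[symmetric, unfolded One_nat_def] diff_Suc_1 by (simp add: S_def field_simps eq_neg_iff_add_eq_0)
    have "(\<Sum>s = 1..Suc m. DF s * x ^ s) + 2 * (\<Sum>s = 1..Suc m. F s * x ^ s) / x + (\<Sum>s = 1..Suc m. x ^ s * (\<Sum>j = 1..s - 1. F j * F (s - j)))
      = ((\<Sum>s = 1..m. DF s * x ^ s) + 2 * (\<Sum>s = 1..m. F s * x ^ s) / x + (\<Sum>s = 1..m. x ^ s * (\<Sum>j = 1..s - 1. F j * F (s - j))))
        + (DF (Suc m) * x ^ Suc m + 2 * F (Suc m) * x ^ m + x ^ Suc m * S)"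
      using assms(2) by (simp add: S_def field_simps)
    also have "\<dots> = 2 * F 1 - 2 * F (Suc (Suc m)) * x ^ Suc m"
      unfolding Suc.IH D by (simp add: algebra_simps)
    finally show ?case .
  qed simp
  from this[of "n - 1"] show ?thesis unfolding sum_square_split[OF assms(1)] using assms(1) by (simp add: algebra_simps)
qed

subsection \<open>Existence of the parabolic cylinder function\<close>

text \<open>The Gaussian coefficient \<open>k\<close> is a parameter because rotating the contour by \<open>c\<close> turns \<open>k = 1\<close> into
  \<open>k = c\<^sup>2\<close>; this extends the asymptotics of \<open>U\<close> from a half plane to \<open>|arg z| < 3 \<pi> / 4\<close>.\<close>

definition gauss_kernel :: "real \<Rightarrow> complex \<Rightarrow> complex \<Rightarrow> real \<Rightarrow> complex" where
  "gauss_kernel p k s t = of_real (t powr (p - 1)) * exp (- k * of_real (t\<^sup>2 / 2) - s * of_real t)"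

definition gauss_laplace :: "real \<Rightarrow> complex \<Rightarrow> complex \<Rightarrow> complex" where
  "gauss_laplace p k s = (LINT t:{0<..}|lborel. gauss_kernel p k s t)"

text \<open>The two regimes in which exp (- \<alpha> t^2/2 - \<beta> t) decays. The degenerate one
  covers the pure Laplace integral used for comparison.\<close>

definition decaying :: "real \<Rightarrow> real \<Rightarrow> bool" where
  "decaying \<alpha> \<beta> \<longleftrightarrow> \<alpha> > 0 \<or> (\<alpha> = 0 \<and> \<beta> > 0)"

section \<open>Integrability and dependence on the parameters\<close>

lemma set_integrable_powr_exp:
  fixes p a :: real
  assumes "p > 0" "a > 0"
  shows "set_integrable lborel {0<..} (\<lambda>t. t powr (p - 1) * exp (- a * t))"
proof -
  have "(\<lambda>t. complex_of_real t powr (of_real p - 1) / of_real (exp (a * t))) absolutely_integrable_on {0<..}"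
    using absolutely_integrable_Gamma_integral[of "of_real p" a] assms by simp
  hence "set_integrable lebesgue {0<..} (\<lambda>t. norm (complex_of_real t powr (of_real p - 1) / of_real (exp (a * t))))"
    by (rule set_integrable_norm)
  also have "?this \<longleftrightarrow> set_integrable lebesgue {0<..} (\<lambda>t. t powr (p - 1) * exp (- a * t))"
    by (intro set_integrable_cong)
       (auto simp: norm_mult norm_inverse norm_powr_real_powr exp_minus divide_inverse norm_powr_real)
  finally have "integrable lebesgue (\<lambda>t. indicator {0<..} t *\<^sub>R (t powr (p - 1) * exp (- a * t)))"
    by (simp add: set_integrable_def)
  thus ?thesis unfolding set_integrable_def
    by (subst (asm) integrable_completion) auto
qed

lemma gauss_le_exp:
  fixes \<alpha> \<beta> :: real
  assumes "decaying \<alpha> \<beta>"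
  shows "\<exists>C a. a > 0 \<and> C > 0 \<and> (\<forall>t. exp (- \<alpha> * (t\<^sup>2 / 2) - \<beta> * t) \<le> C * exp (- a * t))"
proof (cases "\<alpha> > 0")
    case True
    \<comment> \<open>Completing the square; the rate 1 is an arbitrary positive choice.\<close>
    have "- \<alpha> * (t\<^sup>2 / 2) - \<beta> * t \<le> (\<beta> - 1)\<^sup>2 / (2 * \<alpha>) + (- 1 * t)" for t
    proof -
      have "(\<beta> - 1)\<^sup>2 / (2 * \<alpha>) + (- 1 * t) - (- \<alpha> * (t\<^sup>2 / 2) - \<beta> * t) = (\<alpha> * t + (\<beta> - 1))\<^sup>2 / (2 * \<alpha>)"
        using True by (simp add: field_simps power2_eq_square)
      also have "\<dots> \<ge> 0" using True by simp
      finally show ?thesis by simp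
    qed
    hence "exp (- \<alpha> * (t\<^sup>2 / 2) - \<beta> * t) \<le> exp ((\<beta> - 1)\<^sup>2 / (2 * \<alpha>)) * exp (- 1 * t)" for t
      unfolding exp_add[symmetric] by (subst exp_le_cancel_iff)
    thus ?thesis by (intro exI[of _ "exp ((\<beta> - 1)\<^sup>2 / (2 * \<alpha>))"] exI[of _ 1]) auto
  next
    case False
    thus ?thesis using assms by (intro exI[of _ 1] exI[of _ \<beta>]) (auto simp: decaying_def)
  qed

lemma set_integrable_gauss:
  fixes p \<alpha> \<beta> :: real
  assumes "p > 0" "decaying \<alpha> \<beta>"
  shows "set_integrable lborel {0<..} (\<lambda>t. t powr (p - 1) * exp (- \<alpha> * (t\<^sup>2 / 2) - \<beta> * t))"
proof -
  obtain C a where Ca: "a > 0" "C > 0" "\<And>t. exp (- \<alpha> * (t\<^sup>2 / 2) - \<beta> * t) \<le> C * exp (- a * t)"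
    using gauss_le_exp[OF assms(2)] by blast
  have "set_integrable lborel {0<..} (\<lambda>t. C * (t powr (p - 1) * exp (- a * t)))"
    using set_integrable_powr_exp[OF assms(1) Ca(1)] by simp
  thus ?thesis
    by (rule set_integrable_bound)
       (use Ca in \<open>auto simp: set_borel_measurable_def abs_mult mult.left_commute[of C] intro!: mult_left_mono AE_I2\<close>)
qed

lemma set_integrable_gauss_kernel:
  assumes "p > 0" "decaying (Re k) (Re s)"
  shows "set_integrable lborel {0<..} (gauss_kernel p k s)"
  by (rule set_integrable_bound[OF set_integrable_gauss[OF assms]])
     (auto simp: gauss_kernel_def set_borel_measurable_def norm_mult)

lemma norm_gauss_kernel:
  "norm (gauss_kernel p k s t) = t powr (p - 1) * exp (- Re k * (t\<^sup>2 / 2) - Re s * t)"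
  by (simp add: gauss_kernel_def norm_mult)

lemma gauss_kernel_shift:
  assumes "t > 0"
  shows "gauss_kernel (p + 1) k s t = of_real t * gauss_kernel p k s t"
    and "gauss_kernel (p + 2) k s t = of_real (t\<^sup>2) * gauss_kernel p k s t"
proof -
  have "t powr (p + 1 - 1) = t * t powr (p - 1)" "t powr (p + 2 - 1) = t\<^sup>2 * t powr (p - 1)"
    using assms powr_add[of t 1 "p - 1"] powr_add[of t 2 "p - 1"]
    by (auto simp: add_ac add_diff_eq)
  thus "gauss_kernel (p + 1) k s t = of_real t * gauss_kernel p k s t"
    "gauss_kernel (p + 2) k s t = of_real (t\<^sup>2) * gauss_kernel p k s t"
    by (simp_all add: gauss_kernel_def)
qed

text \<open>The integrand of the remainder is the kernel times exp w - 1 - w, where w collects the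
  perturbations h and j, and |exp w - 1 - w| <= |w|^2 exp |w|. The margins in k and s absorb exp |w|
  into a fixed weight, so C is uniform and differentiability follows in both parameters at
  once.\<close>

lemma gauss_laplace_estimate:
  assumes "p > 0" "decaying \<alpha> \<beta>"
  obtains C where "\<And>k s h j. Re k - norm h \<ge> \<alpha> \<Longrightarrow> Re s - norm j \<ge> \<beta> \<Longrightarrow> \<alpha> > 0 \<or> Re k = 0 \<and> h = 0 \<Longrightarrow>
    norm (gauss_laplace p (k + h) (s + j) - gauss_laplace p k s
       + h / 2 * gauss_laplace (p + 2) k s + j * gauss_laplace (p + 1) k s) \<le> C * (norm h + norm j)\<^sup>2"
proof -
  \<comment> \<open>The dominating function, from |w| <= (|h| + |j|) (t^2/2 + t).\<close>
  define m where "m t = (t\<^sup>2 / 2 + t)\<^sup>2 * (t powr (p - 1) * exp (- \<alpha> * (t\<^sup>2 / 2) - \<beta> * t))" for t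
  have int_m: "set_integrable lborel {0<..} m"
  proof -
    define g where "g q t = t powr (q - 1) * exp (- \<alpha> * (t\<^sup>2 / 2) - \<beta> * t)" for q t
    have g: "set_integrable lborel {0<..} (g q)" if "q > 0" for q
      unfolding g_def[abs_def] by (rule set_integrable_gauss[OF that assms(2)])
    have "set_integrable lborel {0<..} (\<lambda>t. g (p+4) t / 4)"
      by (rule set_integrable_divide) (use assms g in auto)
    moreover have "set_integrable lborel {0<..} (\<lambda>t. g (p+3) t + g (p+2) t)"
      by (rule set_integral_add(1)) (use assms g in auto)
    ultimately have *: "set_integrable lborel {0<..} (\<lambda>t. g (p+4) t / 4 + (g (p+3) t + g (p+2) t))"
      by (rule set_integral_add(1))
    have "m t = g (p+4) t / 4 + (g (p+3) t + g (p+2) t)" if "t > 0" for t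
    proof -
      have "t powr (p + 4 - 1) = t^4 * t powr (p - 1)" "t powr (p + 3 - 1) = t^3 * t powr (p - 1)"
        "t powr (p + 2 - 1) = t^2 * t powr (p - 1)"
        using that powr_add[of t 4 "p - 1"] powr_add[of t 3 "p - 1"] powr_add[of t 2 "p - 1"]
        by (auto simp: add_ac add_diff_eq)
      moreover have "(t\<^sup>2 / 2 + t)\<^sup>2 * a = t^4 * a / 4 + (t^3 * a + t^2 * a)" for a :: real
        by (simp add: field_simps power2_eq_square power3_eq_cube power4_eq_xxxx)
      ultimately show ?thesis unfolding m_def g_def mult.assoc[symmetric]
        by (metis (no_types, lifting) mult.assoc)
    qed
    hence "set_integrable lborel {0<..} m \<longleftrightarrow> set_integrable lborel {0<..} (\<lambda>t. g (p+4) t / 4 + (g (p+3) t + g (p+2) t))"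
      by (intro set_integrable_cong) auto
    with * show ?thesis by blast
  qed
  define C where "C = (LINT t:{0<..}|lborel. m t)"
  show ?thesis
  proof (rule that[of C])
    fix k s h j :: complex
    assume A: "Re k - norm h \<ge> \<alpha>" "Re s - norm j \<ge> \<beta>" and B: "\<alpha> > 0 \<or> Re k = 0 \<and> h = 0"
    have dec: "decaying (Re k) (Re s)" "decaying (Re (k + h)) (Re (s + j))"
    proof -
      have "Re (k + h) \<ge> \<alpha>" "Re (s + j) \<ge> \<beta>" "Re k \<ge> \<alpha>" "Re s \<ge> \<beta>"
        using A abs_Re_le_cmod[of h] abs_Re_le_cmod[of j] by auto
      thus "decaying (Re k) (Re s)" "decaying (Re (k + h)) (Re (s + j))"
        using assms(2) B by (auto simp: decaying_def)
    qed
    let ?D = "\<lambda>t. gauss_kernel p (k + h) (s + j) t - gauss_kernel p k s t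
       + h / 2 * gauss_kernel (p + 2) k s t + j * gauss_kernel (p + 1) k s t"
    have ints: "set_integrable lborel {0<..} (gauss_kernel p (k + h) (s + j))"
      "set_integrable lborel {0<..} (gauss_kernel p k s)"
      "set_integrable lborel {0<..} (gauss_kernel (p+2) k s)"
      "set_integrable lborel {0<..} (gauss_kernel (p+1) k s)"
      using assms dec by (auto intro!: set_integrable_gauss_kernel)
    have eq: "(LINT t:{0<..}|lborel. ?D t) = gauss_laplace p (k + h) (s + j) - gauss_laplace p k s
       + h / 2 * gauss_laplace (p + 2) k s + j * gauss_laplace (p + 1) k s"
      using ints unfolding gauss_laplace_def
      by (simp add: set_integral_add set_integral_diff)
    have bound: "norm (?D t) \<le> (norm h + norm j)\<^sup>2 * m t" if t: "t > 0" for t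
    proof -
      define w where "w = - h * of_real (t\<^sup>2 / 2) - j * of_real t"
      have "- (k + h) * of_real (t\<^sup>2 / 2) - (s + j) * of_real t = (- k * of_real (t\<^sup>2 / 2) - s * of_real t) + w"
        by (simp add: w_def ring_distribs add_divide_distrib diff_divide_distrib)
      hence "gauss_kernel p (k + h) (s + j) t = gauss_kernel p k s t * exp w"
        by (simp only: gauss_kernel_def exp_add mult.assoc)
      hence "?D t = gauss_kernel p k s t * (exp w - 1 - w)"
        unfolding gauss_kernel_shift[OF t] w_def by (simp add: algebra_simps)
      also have "norm \<dots> \<le> t powr (p - 1) * exp (- Re k * (t\<^sup>2 / 2) - Re s * t) * (exp (norm w) * norm w ^ 2)"
      proof -
        have "norm (exp w - 1 - w) \<le> exp (norm w) * norm w ^ 2"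
          using Taylor_exp_field[of w 1] by (simp add: power2_eq_square algebra_simps)
        thus ?thesis by (simp add: norm_mult norm_gauss_kernel mult_left_mono)
      qed
      also have "norm w \<le> norm h * (t\<^sup>2 / 2) + norm j * t"
        unfolding w_def using t norm_triangle_ineq4[of "- h * of_real (t\<^sup>2 / 2)" "j * of_real t"]
        by (simp add: norm_mult norm_divide norm_power)
      hence nw: "norm w \<le> norm h * (t\<^sup>2 / 2) + norm j * t" .
      hence "exp (norm w) * norm w ^ 2 \<le> exp (norm h * (t\<^sup>2 / 2) + norm j * t) * ((norm h + norm j) * (t\<^sup>2 / 2 + t)) ^ 2"
      proof -
        have "norm h * (t\<^sup>2 / 2) + norm j * t \<le> (norm h + norm j) * (t\<^sup>2 / 2 + t)"
          using t unfolding distrib_left distrib_right by (intro add_mono) auto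
        with nw have "norm w \<le> (norm h + norm j) * (t\<^sup>2 / 2 + t)" by linarith
        thus ?thesis using nw by (intro mult_mono power_mono) auto
      qed
      hence "t powr (p - 1) * exp (- Re k * (t\<^sup>2 / 2) - Re s * t) * (exp (norm w) * norm w ^ 2)
        \<le> t powr (p - 1) * (exp (- Re k * (t\<^sup>2 / 2) - Re s * t) * (exp (norm h * (t\<^sup>2 / 2) + norm j * t) * ((norm h + norm j) * (t\<^sup>2 / 2 + t)) ^ 2))"
        by (simp add: mult.assoc mult_left_mono)
      also have "\<dots> = t powr (p - 1) * (exp (- (Re k - norm h) * (t\<^sup>2 / 2) - (Re s - norm j) * t) * ((norm h + norm j) * (t\<^sup>2 / 2 + t)) ^ 2)"
      proof -
        have "- (Re k - norm h) * (t\<^sup>2 / 2) - (Re s - norm j) * t = (- Re k * (t\<^sup>2 / 2) - Re s * t) + (norm h * (t\<^sup>2 / 2) + norm j * t)"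
          by (simp add: left_diff_distrib)
        thus ?thesis by (simp only: exp_add mult.assoc)
      qed
      also have "\<dots> \<le> t powr (p - 1) * (exp (- \<alpha> * (t\<^sup>2 / 2) - \<beta> * t) * ((norm h + norm j) * (t\<^sup>2 / 2 + t)) ^ 2)"
      proof -
        have "(Re k - norm h) * (t\<^sup>2 / 2) \<ge> \<alpha> * (t\<^sup>2/2)" "(Re s - norm j) * t \<ge> \<beta> * t"
          using A t by (intro mult_right_mono; simp)+
        hence "- (Re k - norm h) * (t\<^sup>2 / 2) - (Re s - norm j) * t \<le> - \<alpha> * (t\<^sup>2 / 2) - \<beta> * t"
          unfolding mult_minus_left by linarith
        thus ?thesis by (intro mult_left_mono mult_right_mono) (simp_all only: exp_le_cancel_iff, auto)
      qed
      finally show ?thesis by (simp add: m_def power_mult_distrib mult_ac)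
    qed
    have int_D: "set_integrable lborel {0<..} ?D"
      by (rule set_integral_add(1) set_integral_diff(1) set_integrable_mult_right impI ints)+
    have "norm (LINT t:{0<..}|lborel. ?D t) \<le> (LINT t:{0<..}|lborel. (norm h + norm j)\<^sup>2 * m t)"
    proof -
      have "norm (LINT t:{0<..}|lborel. ?D t) \<le> (LINT t:{0<..}|lborel. norm (?D t))"
        by (rule set_integral_norm_bound[OF int_D])
      also have "\<dots> \<le> (LINT t:{0<..}|lborel. (norm h + norm j)\<^sup>2 * m t)"
        using int_m int_D bound by (intro set_integral_mono set_integrable_norm) auto
      finally show ?thesis .
    qed
    also have "\<dots> = C * (norm h + norm j)\<^sup>2" by (simp add: C_def mult.commute)
    finally show "norm (gauss_laplace p (k + h) (s + j) - gauss_laplace p k s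
       + h / 2 * gauss_laplace (p + 2) k s + j * gauss_laplace (p + 1) k s) \<le> C * (norm h + norm j)\<^sup>2"
      unfolding eq .
  qed
qed

lemma gauss_laplace_has_field_derivative:
  assumes "p > 0" and K: "(K has_field_derivative K') (at c)" and S: "(S has_field_derivative S') (at c)"
    and dec: "Re (K c) > 0 \<or> (\<forall>c. K c = 0) \<and> Re (S c) > 0"
  shows "((\<lambda>c. gauss_laplace p (K c) (S c)) has_field_derivative
    - (K' / 2 * gauss_laplace (p + 2) (K c) (S c) + S' * gauss_laplace (p + 1) (K c) (S c))) (at c)"
proof -
  \<comment> \<open>Half of Re (K c), and a \<beta> below Re (S c), leave room for small increments
    of K and S.\<close>
  define \<alpha> where "\<alpha> = Re (K c) / 2"
  define \<beta> where "\<beta> = (if Re (K c) > 0 then Re (S c) - 1 else Re (S c) / 2)"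
  have dab: "decaying \<alpha> \<beta>" using dec by (auto simp: decaying_def \<alpha>_def \<beta>_def)
  define G where "G c = gauss_laplace p (K c) (S c)" for c
  define G1 where "G1 = gauss_laplace (p + 1) (K c) (S c)"
  define G2 where "G2 = gauss_laplace (p + 2) (K c) (S c)"
  obtain C where C: "\<And>k s h j. Re k - norm h \<ge> \<alpha> \<Longrightarrow> Re s - norm j \<ge> \<beta> \<Longrightarrow> \<alpha> > 0 \<or> Re k = 0 \<and> h = 0 \<Longrightarrow>
    norm (gauss_laplace p (k + h) (s + j) - gauss_laplace p k s
       + h / 2 * gauss_laplace (p + 2) k s + j * gauss_laplace (p + 1) k s) \<le> C * (norm h + norm j)\<^sup>2"
    using gauss_laplace_estimate[OF assms(1) dab] by metis
  define h j where "h y = K y - K c" and "j y = S y - S c" for y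
  define E where "E y = (G y - G c + h y / 2 * G2 + j y * G1) / (y - c)" for y
  have K0: "isCont K c" and S0: "isCont S c" using K S by (auto intro: DERIV_isCont)
  have h0: "(h \<longlongrightarrow> 0) (at c)" and j0: "(j \<longlongrightarrow> 0) (at c)"
    using K0 S0 unfolding h_def[abs_def] j_def[abs_def] isCont_def by (auto intro: tendsto_eq_intros)
  have h1: "((\<lambda>y. h y / (y - c)) \<longlongrightarrow> K') (at c)" and j1: "((\<lambda>y. j y / (y - c)) \<longlongrightarrow> S') (at c)"
    using K S unfolding h_def j_def has_field_derivative_iff by auto
  have evh: "eventually (\<lambda>y. Re (K c) - norm (h y) \<ge> \<alpha> \<and> (\<alpha> > 0 \<or> Re (K c) = 0 \<and> h y = 0)) (at c)"
  proof (cases "Re (K c) > 0")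
    case True
    have "eventually (\<lambda>y. norm (h y) < Re (K c) / 2) (at c)"
      using h0 True by (intro order_tendstoD(2)[OF tendsto_norm_zero]) auto
    thus ?thesis by eventually_elim (use True in \<open>auto simp: \<alpha>_def\<close>)
  next
    case False
    thus ?thesis using dec by (auto simp: h_def \<alpha>_def)
  qed
  have evj: "eventually (\<lambda>y. Re (S c) - norm (j y) \<ge> \<beta>) (at c)"
  proof -
    have "Re (S c) - \<beta> > 0" using dec by (auto simp: \<beta>_def)
    hence "eventually (\<lambda>y. norm (j y) < Re (S c) - \<beta>) (at c)"
      using j0 by (intro order_tendstoD(2)[OF tendsto_norm_zero]) auto
    thus ?thesis by eventually_elim auto
  qed
  have "(E \<longlongrightarrow> 0) (at c)"
  proof (rule Lim_null_comparison)
    show "eventually (\<lambda>y. norm (E y) \<le> C * ((norm (h y / (y - c)) + norm (j y / (y - c))) * (norm (h y) + norm (j y)))) (at c)"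
      using evh evj
    proof eventually_elim
      case (elim y)
      have "norm (G y - G c + h y / 2 * G2 + j y * G1) \<le> C * (norm (h y) + norm (j y))\<^sup>2"
        using C[of "K c" "h y" "S c" "j y"] elim by (simp add: G_def G1_def G2_def h_def j_def)
      hence "norm (E y) \<le> C * (norm (h y) + norm (j y))\<^sup>2 / norm (y - c)"
        unfolding E_def norm_divide by (rule divide_right_mono) simp
      also have "\<dots> = C * ((norm (h y / (y - c)) + norm (j y / (y - c))) * (norm (h y) + norm (j y)))"
        by (simp add: norm_divide power2_eq_square add_divide_distrib[symmetric])
      finally show ?case .
    qed
    have "((\<lambda>y. C * ((norm (h y / (y - c)) + norm (j y / (y - c))) * (norm (h y) + norm (j y)))) \<longlongrightarrow> C * ((norm K' + norm S') * (norm (0::complex) + norm (0::complex)))) (at c)"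
      by (intro tendsto_intros h0 j0 h1 j1)
    thus "((\<lambda>y. C * ((norm (h y / (y - c)) + norm (j y / (y - c))) * (norm (h y) + norm (j y)))) \<longlongrightarrow> 0) (at c)"
      by simp
  qed
  hence "((\<lambda>y. E y - (h y / (y - c) / 2 * G2 + j y / (y - c) * G1)) \<longlongrightarrow> 0 - (K' / 2 * G2 + S' * G1)) (at c)"
    by (intro tendsto_intros h1 j1) auto
  also have "(\<lambda>y. E y - (h y / (y - c) / 2 * G2 + j y / (y - c) * G1)) = (\<lambda>y. (G y - G c) / (y - c))"
    by (auto simp: E_def add_divide_distrib diff_divide_distrib)
  finally show ?thesis
    unfolding has_field_derivative_iff G_def G1_def G2_def by simp
qed

text \<open>Integrate the derivative of t^p exp (-k t^2/2 - s t) over the half line; the boundary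
  terms vanish. This yields the differential equation of U and makes the rotated integrals
  constant.\<close>

lemma gauss_laplace_recurrence:
  assumes "p > 0" "decaying (Re k) (Re s)"
  shows "k * gauss_laplace (p + 2) k s + s * gauss_laplace (p + 1) k s = of_real p * gauss_laplace p k s"
proof -
  define F where "F t = of_real (t powr p) * exp (- k * of_real (t\<^sup>2 / 2) - s * of_real t)" for t
  define F' where "F' t = of_real p * gauss_kernel p k s t - (k * gauss_kernel (p + 2) k s t + s * gauss_kernel (p + 1) k s t)" for t
  have ints: "set_integrable lborel {0<..} (gauss_kernel p k s)"
      "set_integrable lborel {0<..} (gauss_kernel (p+2) k s)"
      "set_integrable lborel {0<..} (gauss_kernel (p+1) k s)"
    using assms by (auto intro!: set_integrable_gauss_kernel)
  have int: "set_integrable lborel {0<..} F'"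
    unfolding F'_def by (rule set_integral_add(1) set_integral_diff(1) set_integrable_mult_right impI ints)+
  have nF: "norm (F t) = t powr p * exp (- Re k * (t\<^sup>2 / 2) - Re s * t)" for t
    by (simp add: F_def norm_mult)
  have "(LBINT t=0..\<infinity>. F' t) = 0 - 0"
  proof (rule interval_integral_FTC_integrable)
    fix x :: real assume "0 < ereal x"
    hence x: "x > 0" by simp
    have 1: "((\<lambda>t. of_real (t powr p) :: complex) has_vector_derivative of_real (p * x powr (p - 1))) (at x)"
      by (rule has_vector_derivative_of_real) (use x in \<open>auto intro!: derivative_eq_intros\<close>)
    have 2: "((\<lambda>t. exp (- k * of_real (t\<^sup>2 / 2) - s * of_real t)) has_vector_derivative
        (- k * of_real x - s) * exp (- k * of_real (x\<^sup>2 / 2) - s * of_real x)) (at x)"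
    proof -
      have "((\<lambda>w. exp (- k * (w\<^sup>2 / 2) - s * w)) has_field_derivative
        (- k * of_real x - s) * exp (- k * ((of_real x)\<^sup>2 / 2) - s * of_real x)) (at (of_real x))"
        by (auto intro!: derivative_eq_intros)
      from has_vector_derivative_real_field[OF this] show ?thesis by (simp add: o_def)
    qed
    have "x powr p = x * x powr (p - 1)" using x by (simp add: powr_diff)
    with has_vector_derivative_mult[OF 1 2] show "(F has_vector_derivative F' x) (at x)"
      unfolding F_def[abs_def] F'_def gauss_kernel_shift[OF x] unfolding gauss_kernel_def
      by (simp add: algebra_simps power2_eq_square)
    show "isCont F' x"
      unfolding F'_def gauss_kernel_def using x by (intro continuous_intros) auto
  next
    show "set_integrable lborel (einterval 0 \<infinity>) F'"
      using int by (simp add: zero_ereal_def[symmetric] greaterThan_def einterval_def)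
  next
    have "((\<lambda>x::real. x powr p) \<longlongrightarrow> 0) (at_right 0)"
      using assms(1) by real_asymp
    hence "((\<lambda>x. norm (F x)) \<longlongrightarrow> 0 * exp (- Re k * (0\<^sup>2 / 2) - Re s * 0)) (at_right 0)"
      unfolding nF by (intro tendsto_intros) auto
    hence "(F \<longlongrightarrow> 0) (at_right 0)" by (simp add: tendsto_norm_zero_iff)
    thus "((F \<circ> real_of_ereal) \<longlongrightarrow> 0) (at_right 0)"
      using ereal_tendsto_simps1(2)[of F 0 0] by (simp only: zero_ereal_def[symmetric])
  next
    obtain C a where Ca: "a > 0" "C > 0" "\<And>t. exp (- Re k * (t\<^sup>2 / 2) - Re s * t) \<le> C * exp (- a * t)"
      using gauss_le_exp[OF assms(2)] by blast
    have "(F \<longlongrightarrow> 0) at_top"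
    proof (rule Lim_null_comparison)
      show "eventually (\<lambda>t. norm (F t) \<le> C * (t powr p * exp (- a * t))) at_top"
        using mult_left_mono[OF Ca(3), of "_ powr p"]
        by (auto simp: nF mult.left_commute[of C])
      show "((\<lambda>t. C * (t powr p * exp (- a * t))) \<longlongrightarrow> 0) at_top"
        using Ca(1) by real_asymp
    qed
    thus "((F \<circ> real_of_ereal) \<longlongrightarrow> 0) (at_left \<infinity>)"
      by (simp only: ereal_tendsto_simps1)
  qed auto
  also have "(LBINT t=0..\<infinity>. F' t) = (LINT t:{0<..}|lborel. F' t)"
    by (simp add: interval_lebesgue_integral_def zero_ereal_def[symmetric] greaterThan_def einterval_def)
  also have "\<dots> = of_real p * gauss_laplace p k s - (k * gauss_laplace (p + 2) k s + s * gauss_laplace (p + 1) k s)"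
    unfolding F'_def gauss_laplace_def using ints
    by (simp add: set_integral_add set_integral_diff)
  finally show ?thesis by simp
qed

text \<open>Replaces a rotation of the path of integration: the derivative of the left side in c
  vanishes by \<open>gauss_laplace_recurrence\<close>, and c = 1 gives the right side. On the cone,
  which is convex, Re (c^2) > 0 keeps the integral convergent.\<close>

lemma gauss_laplace_rotate:
  assumes "p > 0" "\<bar>Im c\<bar> < Re c"
  shows "c powr of_real p * gauss_laplace p (c\<^sup>2) (c * z) = gauss_laplace p 1 z"
proof -
  define S where "S = {c::complex. \<bar>Im c\<bar> < Re c}"
  define \<phi> where "\<phi> c = c powr of_real p * gauss_laplace p (c\<^sup>2) (c * z)" for c
  have "S = {c. Complex (- 1) 1 \<bullet> c < 0} \<inter> {c. Complex (- 1) (- 1) \<bullet> c < 0}"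
    by (auto simp: S_def inner_complex_def)
  hence conv: "convex S" by (auto intro: convex_Int convex_halfspace_lt)
  have "(\<phi> has_field_derivative 0) (at c)" if "c \<in> S" for c
  proof -
    have c: "Re c > 0" "c \<notin> \<real>\<^sub>\<le>\<^sub>0" "c \<noteq> 0" using that by (auto simp: S_def complex_nonpos_Reals_iff)
    have Rec2: "Re (c\<^sup>2) > 0"
    proof -
      have "(Im c)\<^sup>2 < (Re c)\<^sup>2" using that unfolding S_def by (metis (mono_tags) abs_ge_zero mem_Collect_eq power2_abs power_strict_mono zero_less_numeral)
      thus ?thesis by (simp add: Re_power2)
    qed
    define G0 G1 G2 where "G0 = gauss_laplace p (c\<^sup>2) (c * z)" and "G1 = gauss_laplace (p + 1) (c\<^sup>2) (c * z)"
      and "G2 = gauss_laplace (p + 2) (c\<^sup>2) (c * z)"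
    have 1: "((\<lambda>c. gauss_laplace p (c\<^sup>2) (c * z)) has_field_derivative - (2 * c / 2 * G2 + z * G1)) (at c)"
      unfolding G1_def G2_def
      by (rule gauss_laplace_has_field_derivative[where K = "\<lambda>c. c\<^sup>2" and S = "\<lambda>c. c * z"])
         (use assms(1) Rec2 in \<open>auto intro!: derivative_eq_intros\<close>)
    have rec: "c\<^sup>2 * G2 + (c * z) * G1 = of_real p * G0"
      unfolding G0_def G1_def G2_def
      by (rule gauss_laplace_recurrence) (use assms(1) Rec2 in \<open>auto simp: decaying_def\<close>)
    have 2: "((\<lambda>c. c powr of_real p) has_field_derivative (of_real p * c powr (of_real p - 1))) (at c)"
      by (rule has_field_derivative_powr) (use c in auto)
    have 3: "c powr of_real p = c * c powr (of_real p - 1)" using c by (simp add: powr_diff)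
    have "of_real p * c powr (of_real p - 1) * G0 + - (2 * c / 2 * G2 + z * G1) * c powr of_real p
       = c powr (of_real p - 1) * (of_real p * G0 - (c\<^sup>2 * G2 + (c * z) * G1))"
      unfolding 3 by (simp add: algebra_simps power2_eq_square)
    also have "\<dots> = 0" by (simp add: rec)
    finally show ?thesis
      using DERIV_mult[OF 2 1] unfolding \<phi>_def[abs_def] G0_def[symmetric] by simp
  qed
  hence "\<exists>k. \<forall>x\<in>S. \<phi> x = k"
    by (rule has_field_derivative_zero_constant[OF conv, OF has_field_derivative_at_within])
  moreover have "1 \<in> S" "c \<in> S" using assms by (auto simp: S_def)
  ultimately have "\<phi> c = \<phi> 1" by metis
  thus ?thesis by (simp add: \<phi>_def)
qed

section \<open>Asymptotics by comparison with the pure Laplace integral\<close>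

lemma gauss_laplace_0_1:
  assumes "p > 0"
  shows "gauss_laplace p 0 1 = of_real (Gamma p)"
proof -
  have eq: "gauss_kernel p 0 1 t = of_real (t powr (p - 1) * exp (- 1 * t))" for t
    by (simp add: gauss_kernel_def exp_of_real[symmetric])
  have int: "set_integrable lborel {0<..} (\<lambda>t. t powr (p - 1) * exp (- 1 * t))"
    by (rule set_integrable_powr_exp) (use assms in auto)
  have "gauss_laplace p 0 1 = of_real (LINT t:{0<..}|lborel. t powr (p - 1) * exp (- 1 * t))"
    unfolding gauss_laplace_def eq by (rule set_integral_complex_of_real)
  also have "(LINT t:{0<..}|lborel. t powr (p - 1) * exp (- 1 * t)) = integral {0<..} (\<lambda>t. t powr (p - 1) * exp (- 1 * t))"
    by (rule set_borel_integral_eq_integral(2)[OF int])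
  also have "\<dots> = integral {0..} (\<lambda>t. t powr (p - 1) * exp (- 1 * t))"
    by (rule integral_spike_set) (auto intro: negligible_subset[of "{0}"])
  also have "\<dots> = Gamma p"
    using Gamma_integral_real[OF assms] by (simp add: has_integral_iff exp_minus divide_inverse)
  finally show ?thesis .
qed

text \<open>The left side has derivative zero in s by the recurrence at k = 0, and its value at s =
  1 is Euler's integral.\<close>

lemma gauss_laplace_0:
  assumes "p > 0" "Re s > 0"
  shows "s powr of_real p * gauss_laplace p 0 s = of_real (Gamma p)"
proof -
  define S where "S = {c::complex. 0 < Re c}"
  define \<phi> where "\<phi> c = c powr of_real p * gauss_laplace p 0 c" for c
  have conv: "convex S" unfolding S_def by (rule convex_halfspace_Re_gt)
  have "(\<phi> has_field_derivative 0) (at c)" if "c \<in> S" for c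
  proof -
    have c: "Re c > 0" "c \<notin> \<real>\<^sub>\<le>\<^sub>0" "c \<noteq> 0" using that by (auto simp: S_def complex_nonpos_Reals_iff)
    define G0 G1 G2 where "G0 = gauss_laplace p 0 c" and "G1 = gauss_laplace (p + 1) 0 c"
      and "G2 = gauss_laplace (p + 2) 0 c"
    have 1: "((\<lambda>c. gauss_laplace p 0 c) has_field_derivative - (0 / 2 * G2 + 1 * G1)) (at c)"
      unfolding G1_def G2_def
      by (rule gauss_laplace_has_field_derivative[where K = "\<lambda>c. 0" and S = "\<lambda>c. c"])
         (use assms(1) c in \<open>auto intro!: derivative_eq_intros\<close>)
    have rec: "c * G1 = of_real p * G0"
      using gauss_laplace_recurrence[of p 0 c] c assms(1)
      unfolding G0_def G1_def G2_def by (auto simp: decaying_def)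
    have 2: "((\<lambda>c. c powr of_real p) has_field_derivative (of_real p * c powr (of_real p - 1))) (at c)"
      by (rule has_field_derivative_powr) (use c in auto)
    have 3: "c powr of_real p = c * c powr (of_real p - 1)" using c by (simp add: powr_diff)
    have "of_real p * c powr (of_real p - 1) * G0 + - (0 / 2 * G2 + 1 * G1) * c powr of_real p
       = c powr (of_real p - 1) * (of_real p * G0 - c * G1)"
      unfolding 3 by (simp add: algebra_simps power2_eq_square)
    also have "\<dots> = 0" by (simp add: rec)
    finally show ?thesis
      using DERIV_mult[OF 2 1] unfolding \<phi>_def[abs_def] G0_def[symmetric] by simp
  qed
  hence "\<exists>k. \<forall>x\<in>S. \<phi> x = k"
    by (rule has_field_derivative_zero_constant[OF conv, OF has_field_derivative_at_within])
  moreover have "1 \<in> S" "s \<in> S" using assms by (auto simp: S_def)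
  ultimately have "\<phi> s = \<phi> 1" by metis
  thus ?thesis by (simp add: \<phi>_def gauss_laplace_0_1[OF assms(1)])
qed

lemma norm_exp_minus_one_le:
  fixes w :: complex
  assumes "Re w \<le> 0"
  shows "norm (exp w - 1) \<le> norm w"
proof -
  have "norm (exp w - exp 0) \<le> 1 * norm (w - 0)"
  proof (rule field_differentiable_bound[where S = "{w. Re w \<le> 0}" and f' = exp])
    show "convex {w. Re w \<le> 0}" by (rule convex_halfspace_Re_le)
  qed (use assms in \<open>auto intro: has_field_derivative_at_within[OF DERIV_exp]\<close>)
  thus ?thesis by simp
qed

text \<open>Dropping the Gaussian costs at most |k| t^2/2 pointwise, as |exp w - 1| <= |w| for Re w
  <= 0; the extra t^2 raises p to p + 2 and gains two powers of Re s.\<close>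

lemma gauss_laplace_diff_bound:
  assumes "p > 0" "Re k \<ge> 0" "Re s > 0"
  shows "norm (gauss_laplace p k s - gauss_laplace p 0 s) \<le> norm k / 2 * Gamma (p + 2) * Re s powr (- p - 2)"
proof -
  have dec: "decaying (Re k) (Re s)" "decaying (Re 0) (Re s)" using assms by (auto simp: decaying_def)
  have ints: "set_integrable lborel {0<..} (gauss_kernel p k s)" "set_integrable lborel {0<..} (gauss_kernel p 0 s)"
    using assms(1) dec by (auto intro!: set_integrable_gauss_kernel)
  define m where "m t = t powr (p + 2 - 1) * exp (- Re s * t)" for t
  have m: "set_integrable lborel {0<..} m"
    unfolding m_def[abs_def] by (rule set_integrable_powr_exp) (use assms in auto)
  have bound: "norm (gauss_kernel p k s t - gauss_kernel p 0 s t) \<le> norm k / 2 * m t" if "t > 0" for t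
  proof -
    have "gauss_kernel p k s t - gauss_kernel p 0 s t = gauss_kernel p 0 s t * (exp (- k * of_real (t\<^sup>2 / 2)) - 1)"
    proof -
      have "- k * of_real (t\<^sup>2 / 2) - s * of_real t = (- 0 * of_real (t\<^sup>2 / 2) - s * of_real t) + (- k * of_real (t\<^sup>2 / 2))"
        by simp
      thus ?thesis by (simp only: gauss_kernel_def exp_add right_diff_distrib mult.assoc mult_1_right)
    qed
    also have "norm \<dots> \<le> norm (gauss_kernel p 0 s t) * norm (- k * of_real (t\<^sup>2 / 2))"
    proof -
      have "norm (exp (- k * of_real (t\<^sup>2 / 2)) - 1) \<le> norm (- k * of_real (t\<^sup>2 / 2))"
        by (rule norm_exp_minus_one_le) (use assms(2) in auto)
      thus ?thesis by (subst norm_mult) (rule mult_left_mono, auto)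
    qed
    also have "\<dots> = norm k / 2 * norm (gauss_kernel (p + 2) 0 s t)"
      unfolding gauss_kernel_shift(2)[OF that] by (simp add: norm_mult norm_divide norm_power)
    also have "norm (gauss_kernel (p + 2) 0 s t) = m t"
      by (simp add: norm_gauss_kernel m_def)
    finally show ?thesis .
  qed
  have "gauss_laplace p k s - gauss_laplace p 0 s = (LINT t:{0<..}|lborel. gauss_kernel p k s t - gauss_kernel p 0 s t)"
    unfolding gauss_laplace_def using ints by (simp add: set_integral_diff)
  also have "norm \<dots> \<le> (LINT t:{0<..}|lborel. norm (gauss_kernel p k s t - gauss_kernel p 0 s t))"
    using ints by (intro set_integral_norm_bound set_integral_diff(1))
  also have "\<dots> \<le> (LINT t:{0<..}|lborel. norm k / 2 * m t)"
    using ints m bound by (intro set_integral_mono set_integrable_norm set_integral_diff(1) set_integrable_mult_right) auto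
  also have "\<dots> = norm k / 2 * (LINT t:{0<..}|lborel. m t)" by simp
  also have "(LINT t:{0<..}|lborel. m t) = Gamma (p + 2) * Re s powr (- p - 2)"
  proof -
    have "gauss_kernel (p + 2) 0 (of_real (Re s)) t = of_real (m t)" for t
      by (simp add: gauss_kernel_def m_def exp_of_real[symmetric])
    hence "gauss_kernel (p + 2) 0 (of_real (Re s)) = (\<lambda>t. of_real (m t))" by (rule ext)
    hence "gauss_laplace (p + 2) 0 (of_real (Re s)) = of_real (LINT t:{0<..}|lborel. m t)"
      unfolding gauss_laplace_def by (simp only: set_integral_complex_of_real)
    moreover have "of_real (Re s) powr of_real (p + 2) * gauss_laplace (p + 2) 0 (of_real (Re s)) = of_real (Gamma (p + 2))"
      by (rule gauss_laplace_0) (use assms in auto)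
    ultimately have "of_real (Re s powr (p + 2) * (LINT t:{0<..}|lborel. m t)) = complex_of_real (Gamma (p + 2))"
      using assms(3) by (simp add: powr_of_real[symmetric])
    hence "Re s powr (p + 2) * (LINT t:{0<..}|lborel. m t) = Gamma (p + 2)" by (simp only: of_real_eq_iff)
    moreover have "Re s powr (- p - 2) = inverse (Re s powr (p + 2))"
      by (simp add: powr_minus[symmetric])
    moreover have "Re s powr (p + 2) \<noteq> 0" using assms(3) by simp
    ultimately show ?thesis by (metis inverse_eq_divide mult.commute nonzero_mult_div_cancel_left times_divide_eq_left mult_1)
  qed
  finally show ?thesis by (simp add: mult.assoc)
qed

text \<open>A turn by almost pi/4, clockwise for Arg z >= 0 and anticlockwise otherwise, brings
  every z of the sector strictly inside the right half plane, while Re (c^2) stays nonnegative. That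
  is where 3 pi/4 = pi/2 + pi/4 comes from. After the turn the Gaussian costs only an error of order
  |z|^(-2).\<close>

lemma gauss_laplace_asymptotic:
  assumes p: "p > 0" and \<delta>: "\<delta> > 0"
  shows "((\<lambda>z. gauss_laplace p 1 z * z powr of_real p) \<longlongrightarrow> of_real (Gamma p))
    (inf at_infinity (principal {z. \<bar>Arg z\<bar> \<le> 3 / 4 * pi - \<delta>}))"
proof -
  \<comment> \<open>The margin \<epsilon> is spent twice within \<delta>, in the turn and in the
    distance to the imaginary axis, and pi/4 - \<epsilon> has to stay positive.\<close>
  define \<epsilon> where "\<epsilon> = min \<delta> (pi / 4) / 2"
  have \<epsilon>: "\<epsilon> > 0" "2 * \<epsilon> \<le> \<delta>" "\<epsilon> \<le> pi / 8" using \<delta> by (auto simp: \<epsilon>_def)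
  define C where "C = 1 / 2 * Gamma (p + 2) * sin \<epsilon> powr (- p - 2)"
  have sin: "sin \<epsilon> > 0" using \<epsilon> by (intro sin_gt_zero) auto
  have main: "norm (gauss_laplace p 1 z * z powr of_real p - of_real (Gamma p)) \<le> C * norm z powr (- 2)"
    if z: "z \<noteq> 0" "\<bar>Arg z\<bar> \<le> 3 / 4 * pi - \<delta>" for z
  proof -
    define \<phi> where "\<phi> = (if Arg z \<ge> 0 then pi / 4 - \<epsilon> else - (pi / 4 - \<epsilon>))"
    define c where "c = exp (\<i> * of_real (- \<phi>))"
    have \<phi>: "\<bar>\<phi>\<bar> \<le> pi / 4 - \<epsilon>" "\<bar>Arg z - \<phi>\<bar> \<le> pi / 2 - \<epsilon>"
      using \<epsilon> z by (auto simp: \<phi>_def abs_if split: if_splits)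
    have c: "Re c = cos \<phi>" "Im c = - sin \<phi>" by (simp_all add: c_def Re_exp Im_exp)
    have c_cone: "\<bar>Im c\<bar> < Re c"
    proof -
      have "cos (2 * \<phi>) > 0" using \<phi> \<epsilon> by (intro cos_gt_zero_pi) (auto simp: abs_le_iff)
      hence "(sin \<phi>)\<^sup>2 < (cos \<phi>)\<^sup>2" by (simp add: cos_double)
      moreover have "cos \<phi> > 0" using \<phi> \<epsilon> by (intro cos_gt_zero_pi) (auto simp: abs_le_iff)
      ultimately show ?thesis unfolding c using abs_le_square_iff[of "cos \<phi>" "sin \<phi>"] by force
    qed
    have Lnc: "Ln c = \<i> * of_real (- \<phi>)" unfolding c_def
      by (rule Ln_exp) (use \<phi> \<epsilon> in \<open>auto simp: abs_le_iff\<close>)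
    have c0: "c \<noteq> 0" by (simp add: c_def)
    have nc: "norm c = 1" by (simp add: c_def)
    have ncp: "norm (c powr of_real p) = 1" using c0 by (simp add: powr_def Lnc)
    have Lnz: "Im (Ln z) = Arg z" "Re (Ln z) = ln (norm z)" using z by (simp_all add: Arg_eq_Im_Ln)
    have Lncz: "Ln (c * z) = Ln c + Ln z"
      by (rule Ln_times_simple) (use c0 z \<phi> \<epsilon> in \<open>auto simp: Lnc Lnz abs_le_iff\<close>)
    have nzp: "norm (z powr of_real p) = norm z powr p"
      using z by (simp add: powr_def Lnz mult.commute)
    have powr_cz: "(c * z) powr of_real p = c powr of_real p * z powr of_real p"
      using c0 z by (simp add: powr_def Lncz exp_add[symmetric] ring_distribs)
    have Re_cz: "Re (c * z) \<ge> norm z * sin \<epsilon>"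
    proof -
      have "c * z = exp (Ln c + Ln z)" using c0 z by (simp add: exp_add)
      hence "Re (c * z) = exp (Re (Ln c + Ln z)) * cos (Im (Ln c + Ln z))" by (simp only: Re_exp)
      also have "\<dots> = norm z * cos (Arg z - \<phi>)"
        using z by (simp add: Lnc Lnz)
      also have "cos (Arg z - \<phi>) \<ge> cos (pi / 2 - \<epsilon>)"
        using \<phi> \<epsilon> cos_monotone_0_pi_le[of "\<bar>Arg z - \<phi>\<bar>" "pi / 2 - \<epsilon>"] by simp
      hence "norm z * cos (Arg z - \<phi>) \<ge> norm z * sin \<epsilon>"
        by (intro mult_left_mono) (auto simp: cos_diff)
      finally show ?thesis .
    qed
    hence Re_cz0: "Re (c * z) > 0" using z sin by (meson less_le_trans mult_pos_pos zero_less_norm_iff)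
    have Re_c2: "Re (c\<^sup>2) \<ge> 0"
    proof -
      have "(Im c)\<^sup>2 \<le> (Re c)\<^sup>2" using c_cone by (intro power2_le_iff_abs_le[THEN iffD2]) auto
      thus ?thesis by (simp add: Re_power2)
    qed
    have "gauss_laplace p 1 z * z powr of_real p = (c * z) powr of_real p * gauss_laplace p (c\<^sup>2) (c * z)"
      using gauss_laplace_rotate[OF p c_cone, of z] by (simp add: powr_cz mult_ac)
    also have "\<dots> - of_real (Gamma p) = (c * z) powr of_real p * (gauss_laplace p (c\<^sup>2) (c * z) - gauss_laplace p 0 (c * z))"
      using gauss_laplace_0[OF p Re_cz0] by (simp add: right_diff_distrib)
    also have "norm \<dots> = norm z powr p * norm (gauss_laplace p (c\<^sup>2) (c * z) - gauss_laplace p 0 (c * z))"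
      by (simp add: norm_mult powr_cz ncp nzp)
    also have "\<dots> \<le> norm z powr p * (norm (c\<^sup>2) / 2 * Gamma (p + 2) * Re (c * z) powr (- p - 2))"
      by (intro mult_left_mono gauss_laplace_diff_bound p Re_c2 Re_cz0) auto
    also have "\<dots> \<le> norm z powr p * (norm (c\<^sup>2) / 2 * Gamma (p + 2) * (norm z * sin \<epsilon>) powr (- p - 2))"
      using p Re_cz z sin by (intro mult_left_mono powr_mono2') (auto intro!: mult_pos_pos)
    also have "\<dots> = C * (norm z powr p * norm z powr (- p - 2))"
      using z sin by (simp add: C_def nc norm_power powr_mult)
    also have "norm z powr p * norm z powr (- p - 2) = norm z powr (- 2)"
      by (subst powr_add[symmetric]) simp
    finally show ?thesis .
  qed
  have "((\<lambda>z. gauss_laplace p 1 z * z powr of_real p - of_real (Gamma p)) \<longlongrightarrow> 0)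
    (inf at_infinity (principal {z. \<bar>Arg z\<bar> \<le> 3 / 4 * pi - \<delta>}))"
  proof (rule Lim_null_comparison)
    show "\<forall>\<^sub>F z in inf at_infinity (principal {z. \<bar>Arg z\<bar> \<le> 3 / 4 * pi - \<delta>}).
        norm (gauss_laplace p 1 z * z powr of_real p - of_real (Gamma p)) \<le> C * norm z powr (- 2)"
      unfolding eventually_inf_principal
      using eventually_not_equal_at_infinity[of 0] by eventually_elim (use main in auto)
    have "((\<lambda>x. C * x powr (- 2)) \<longlongrightarrow> 0) at_top" by real_asymp
    hence "((\<lambda>z. C * norm z powr (- 2)) \<longlongrightarrow> 0) (at_infinity :: complex filter)"
      by (rule filterlim_compose) (rule filterlim_norm_at_top)
    thus "((\<lambda>z. C * norm z powr (- 2)) \<longlongrightarrow> 0) (inf at_infinity (principal {z::complex. \<bar>Arg z\<bar> \<le> 3 / 4 * pi - \<delta>}))"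
      by (rule filterlim_mono) auto
  qed
  thus ?thesis by (simp add: LIM_zero_iff)
qed

text \<open>The classical integral representation of U(a,z) for a > -1/2, used for a = u/2.\<close>

definition gauss_pcU :: "real \<Rightarrow> complex \<Rightarrow> complex" where
  "gauss_pcU a z = exp (- z\<^sup>2 / 4) * gauss_laplace (a + 1 / 2) 1 z / of_real (Gamma (a + 1 / 2))"

lemma gauss_laplace_1_deriv:
  assumes "p > 0"
  shows "(gauss_laplace p 1 has_field_derivative - gauss_laplace (p + 1) 1 z) (at z)"
  using gauss_laplace_has_field_derivative[OF assms, of "\<lambda>_. 1" 0 z "\<lambda>z. z" 1] by auto

text \<open>Each derivative in z raises p by one; the recurrence with p = a + 1/2 eliminates the
  integral with p = a + 5/2, and the differential equation remains.\<close>

lemma gauss_pcU_derivs: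
  assumes "a > 0"
  shows "(gauss_pcU a has_field_derivative
    exp (- z\<^sup>2 / 4) * (- z / 2 * gauss_laplace (a + 1 / 2) 1 z - gauss_laplace (a + 3 / 2) 1 z) / of_real (Gamma (a + 1 / 2))) (at z)"
    and "deriv (deriv (gauss_pcU a)) z = (z\<^sup>2 / 4 + of_real a) * gauss_pcU a z"
proof -
  define g :: complex where "g = of_real (Gamma (a + 1 / 2))"
  define G0 G1 G2 where "G0 = gauss_laplace (a + 1 / 2) 1" and "G1 = gauss_laplace (a + 3 / 2) 1"
    and "G2 = gauss_laplace (a + 5 / 2) 1"
  have "Gamma (a + 1 / 2) > 0" using assms by (intro Gamma_real_pos) auto
  hence g: "g \<noteq> 0" by (simp add: g_def)
  have d1: "(G0 has_field_derivative - G1 z) (at z)" and d2: "(G1 has_field_derivative - G2 z) (at z)" for z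
    unfolding G0_def G1_def G2_def
    using gauss_laplace_1_deriv[of "a + 1 / 2" z] gauss_laplace_1_deriv[of "a + 3 / 2" z] assms by (simp_all add: add_ac)
  have rec: "G2 z = of_real (a + 1 / 2) * G0 z - z * G1 z"
    using gauss_laplace_recurrence[of "a + 1 / 2" 1 z] assms
    unfolding G0_def G1_def G2_def by (simp add: add_ac decaying_def algebra_simps)
  have f: "gauss_pcU a = (\<lambda>z. exp (- z\<^sup>2 / 4) * G0 z / g)"
    by (auto simp: gauss_pcU_def G0_def g_def)
  have 1: "(gauss_pcU a has_field_derivative exp (- z\<^sup>2 / 4) * (- z / 2 * G0 z - G1 z) / g) (at z)" for z
    unfolding f using g by (auto intro!: derivative_eq_intros d1 simp: field_simps)
  thus "(gauss_pcU a has_field_derivative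
    exp (- z\<^sup>2 / 4) * (- z / 2 * gauss_laplace (a + 1 / 2) 1 z - gauss_laplace (a + 3 / 2) 1 z) / of_real (Gamma (a + 1 / 2))) (at z)"
    by (simp add: G0_def G1_def g_def)
  have 2: "deriv (gauss_pcU a) = (\<lambda>z. exp (- z\<^sup>2 / 4) * (- z / 2 * G0 z - G1 z) / g)"
    by (rule ext, rule DERIV_imp_deriv, rule 1)
  have "deriv (deriv (gauss_pcU a)) z =
     exp (- z\<^sup>2 / 4) * (- z / 2) * (- z / 2 * G0 z - G1 z) / g
     + exp (- z\<^sup>2 / 4) * (- 1 / 2 * G0 z + z / 2 * G1 z + G2 z) / g"
    unfolding 2 using g by (intro DERIV_imp_deriv) (auto intro!: derivative_eq_intros d1 d2 simp: field_simps)
  also have "\<dots> = (z\<^sup>2 / 4 + of_real a) * (exp (- z\<^sup>2 / 4) * G0 z / g)"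
    unfolding rec using g by (simp add: field_simps power2_eq_square)
  finally show "deriv (deriv (gauss_pcU a)) z = (z\<^sup>2 / 4 + of_real a) * gauss_pcU a z" by (simp add: f)
qed

definition pcU_leading :: "real \<Rightarrow> complex \<Rightarrow> complex" where
  "pcU_leading a z = z powr (- of_real a - 1 / 2) * exp (- z\<^sup>2 / 4)"

lemma pcU_leading_nonzero: "z \<noteq> 0 \<Longrightarrow> pcU_leading a z \<noteq> 0"
  by (simp add: pcU_leading_def)

lemma eventually_nonzero_sector: "\<forall>\<^sub>F z::complex in inf at_infinity (principal S). z \<noteq> 0"
  unfolding eventually_inf_principal using eventually_not_equal_at_infinity[of 0] by eventually_elim auto

text \<open>An asymptotic relation cannot be differentiated, so U' is treated through its own
  formula: the integral with p = a + 3/2 is smaller by a factor z^(-2) than z times the one with p =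
  a + 1/2, and the derivative of the exponential leaves -z/2 times the leading form.\<close>

lemma gauss_pcU_asymptotic:
  assumes "a > 0" "\<delta> > 0"
  shows "((\<lambda>z. gauss_pcU a z / pcU_leading a z) \<longlongrightarrow> 1)
    (inf at_infinity (principal {z. \<bar>Arg z\<bar> \<le> 3 / 4 * pi - \<delta>}))" (is "(_ \<longlongrightarrow> _) ?F")
    and "((\<lambda>z. deriv (gauss_pcU a) z / (z * pcU_leading a z)) \<longlongrightarrow> - 1 / 2)
    (inf at_infinity (principal {z. \<bar>Arg z\<bar> \<le> 3 / 4 * pi - \<delta>}))"
proof -
  define g :: complex where "g = of_real (Gamma (a + 1 / 2))"
  define G0 G1 where "G0 = gauss_laplace (a + 1 / 2) 1" and "G1 = gauss_laplace (a + 3 / 2) 1"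
  have "Gamma (a + 1 / 2) > 0" using assms by (intro Gamma_real_pos) auto
  hence g: "g \<noteq> 0" by (simp add: g_def)
  have l0: "((\<lambda>z. G0 z * z powr of_real (a + 1 / 2)) \<longlongrightarrow> g) ?F"
    unfolding G0_def g_def by (rule gauss_laplace_asymptotic) (use assms in auto)
  have l1: "((\<lambda>z. G1 z * z powr of_real (a + 3 / 2)) \<longlongrightarrow> of_real (Gamma (a + 3 / 2))) ?F"
    unfolding G1_def by (rule gauss_laplace_asymptotic) (use assms in auto)
  have inv: "((\<lambda>z. 1 / z\<^sup>2) \<longlongrightarrow> 0) ?F"
  proof (rule tendsto_mono[where F' = at_infinity])
    have "((\<lambda>z::complex. inverse z ^ 2) \<longlongrightarrow> 0 ^ 2) at_infinity"
      by (intro tendsto_power tendsto_inverse_0)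
    thus "((\<lambda>z::complex. 1 / z\<^sup>2) \<longlongrightarrow> 0) at_infinity" by (simp add: power_inverse divide_inverse)
  qed auto
  have lead: "exp (- z\<^sup>2 / 4) / pcU_leading a z = z powr of_real (a + 1 / 2)"
    "z powr of_real (a + 1 / 2) = z powr of_real (a + 3 / 2) / z" if "z \<noteq> 0" for z
  proof -
    have "z powr (- of_real a - 1 / 2) * z powr (of_real (a + 1 / 2)) = 1"
      using that by (subst powr_add[symmetric]) auto
    thus "exp (- z\<^sup>2 / 4) / pcU_leading a z = z powr of_real (a + 1 / 2)"
      using that by (simp add: pcU_leading_def field_simps)
    have "z powr of_real (a + 1 / 2) * z powr 1 = z powr of_real (a + 3 / 2)"
      by (subst powr_add[symmetric]) (simp add: add_ac)
    thus "z powr of_real (a + 1 / 2) = z powr of_real (a + 3 / 2) / z"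
      using that by (simp add: field_simps)
  qed
  show "((\<lambda>z. gauss_pcU a z / pcU_leading a z) \<longlongrightarrow> 1) ?F"
  proof (rule Lim_transform_eventually)
    show "((\<lambda>z. G0 z * z powr of_real (a + 1 / 2) / g) \<longlongrightarrow> 1) ?F"
      using tendsto_divide[OF l0 tendsto_const g] g by simp
    show "\<forall>\<^sub>F z in ?F. G0 z * z powr of_real (a + 1 / 2) / g = gauss_pcU a z / pcU_leading a z"
      using eventually_nonzero_sector
    proof eventually_elim
      case (elim z)
      show ?case unfolding lead(1)[OF elim, symmetric] gauss_pcU_def G0_def g_def
        by (simp add: field_simps)
    qed
  qed
  have der: "deriv (gauss_pcU a) z = exp (- z\<^sup>2 / 4) * (- z / 2 * G0 z - G1 z) / g" for z
    unfolding g_def G0_def G1_def by (rule DERIV_imp_deriv, rule gauss_pcU_derivs[OF assms(1)])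
  show "((\<lambda>z. deriv (gauss_pcU a) z / (z * pcU_leading a z)) \<longlongrightarrow> - 1 / 2) ?F"
  proof (rule Lim_transform_eventually)
    have "((\<lambda>z. - 1 / 2 * (G0 z * z powr of_real (a + 1 / 2)) / g - (G1 z * z powr of_real (a + 3 / 2)) * (1 / z\<^sup>2) / g)
       \<longlongrightarrow> - 1 / 2 * g / g - of_real (Gamma (a + 3 / 2)) * 0 / g) ?F"
      by (intro tendsto_intros l0 l1 inv g)
    thus "((\<lambda>z. - 1 / 2 * (G0 z * z powr of_real (a + 1 / 2)) / g - (G1 z * z powr of_real (a + 3 / 2)) * (1 / z\<^sup>2) / g)
       \<longlongrightarrow> - 1 / 2) ?F" using g by simp
    show "\<forall>\<^sub>F z in ?F. - 1 / 2 * (G0 z * z powr of_real (a + 1 / 2)) / g - (G1 z * z powr of_real (a + 3 / 2)) * (1 / z\<^sup>2) / g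
        = deriv (gauss_pcU a) z / (z * pcU_leading a z)"
      using eventually_nonzero_sector
    proof eventually_elim
      case (elim z)
      have 3: "z powr of_real (a + 3 / 2) = z powr of_real (a + 1 / 2) * z" using lead(2)[OF elim] elim by simp
      show ?case unfolding 3 unfolding lead(1)[OF elim, symmetric] der
        using elim g pcU_leading_nonzero[OF elim, of a] by (simp add: field_simps power2_eq_square)
    qed
  qed
qed

lemma gauss_pcU_is_parabolic_cylinder_U:
  assumes "a > 0"
  shows "is_parabolic_cylinder_U (of_real a) (gauss_pcU a)"
  unfolding is_parabolic_cylinder_U_def
proof (intro conjI allI impI)
  show "gauss_pcU a holomorphic_on UNIV"
    using gauss_pcU_derivs(1)[OF assms] unfolding holomorphic_on_open[OF open_UNIV] by blast
  show "deriv (deriv (gauss_pcU a)) z - (z\<^sup>2 / 4 + of_real a) * gauss_pcU a z = 0" for z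
    by (simp add: gauss_pcU_derivs(2)[OF assms])
  fix \<delta> :: real assume "\<delta> > 0"
  thus "gauss_pcU a \<sim>[inf at_infinity (principal {z. \<bar>Arg z\<bar> \<le> 3 / 4 * pi - \<delta>})]
        (\<lambda>z. z powr (- complex_of_real a - 1 / 2) * exp (- z\<^sup>2 / 4))"
    using gauss_pcU_asymptotic(1)[OF assms, of \<delta>] unfolding pcU_leading_def
    by (intro asymp_equivI') auto
qed

section \<open>Uniqueness of the solution with the prescribed asymptotics\<close>

lemma of_real_filterlim_sector:
  assumes "\<delta> \<le> 3 / 4 * pi"
  shows "filterlim complex_of_real (inf at_infinity (principal {z. \<bar>Arg z\<bar> \<le> 3 / 4 * pi - \<delta>})) at_top"
  unfolding filterlim_inf filterlim_principal
proof
  show "filterlim complex_of_real at_infinity at_top"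
    unfolding filterlim_at_infinity_conv_norm_at_top norm_of_real by (rule filterlim_abs_real)
  show "\<forall>\<^sub>F x in at_top. complex_of_real x \<in> {z. \<bar>Arg z\<bar> \<le> 3 / 4 * pi - \<delta>}"
    using eventually_gt_at_top[of 0] by eventually_elim (use assms in \<open>simp add: Arg_of_real\<close>)
qed

text \<open>The Wronskian of two candidates is a constant c, and on the positive real axis (f/g)' =
  -c / g^2. As g decays, a nonzero c would make f/g grow at least linearly, against f/g -> 1. So f/g
  is constant far out, equals its limit 1, and the identity theorem gives f = g.\<close>

lemma parabolic_cylinder_U_unique:
  assumes a: "a > 0" and f: "is_parabolic_cylinder_U (of_real a) f"
  shows "f = gauss_pcU a"
proof -
  define g where "g = gauss_pcU a"
  define F where "F = inf at_infinity (principal {z. \<bar>Arg z\<bar> \<le> 3 / 4 * pi - pi / 4})"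
  have hol: "f holomorphic_on UNIV" "g holomorphic_on UNIV"
    using f gauss_pcU_is_parabolic_cylinder_U[OF a] by (auto simp: is_parabolic_cylinder_U_def g_def)
  have ode: "deriv (deriv f) z = (z\<^sup>2 / 4 + of_real a) * f z" "deriv (deriv g) z = (z\<^sup>2 / 4 + of_real a) * g z" for z
    using f gauss_pcU_derivs(2)[OF a] by (auto simp: is_parabolic_cylinder_U_def g_def)
  have d: "(f has_field_derivative deriv f z) (at z)" "(g has_field_derivative deriv g z) (at z)"
    "(deriv f has_field_derivative deriv (deriv f) z) (at z)" "(deriv g has_field_derivative deriv (deriv g) z) (at z)" for z
    using hol holomorphic_deriv[OF hol(1)] holomorphic_deriv[OF hol(2)] by (auto intro: holomorphic_derivI)
  define W where "W z = f z * deriv g z - deriv f z * g z" for z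
  have "(W has_field_derivative 0) (at z)" for z
    unfolding W_def[abs_def] by (auto intro!: derivative_eq_intros d simp: ode)
  hence "\<exists>c. \<forall>z\<in>UNIV. W z = c" by (intro has_field_derivative_zero_constant) auto
  then obtain c where c: "\<And>z. W z = c" by auto
  have lg: "((\<lambda>z. g z / pcU_leading a z) \<longlongrightarrow> 1) F"
    unfolding F_def g_def by (rule gauss_pcU_asymptotic) (use a in auto)
  have lf: "((\<lambda>z. f z / pcU_leading a z) \<longlongrightarrow> 1) F"
  proof -
    have "f \<sim>[F] (\<lambda>z. z powr (- complex_of_real a - 1 / 2) * exp (- z\<^sup>2 / 4))"
      unfolding F_def by (rule f[unfolded is_parabolic_cylinder_U_def, THEN conjunct2, THEN conjunct2, rule_format]) simp
    hence "((\<lambda>z. f z / pcU_leading a z) \<longlongrightarrow> 1) F"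
      unfolding pcU_leading_def[symmetric]
    proof (rule asymp_equivD_strong)
      show "\<forall>\<^sub>F z in F. f z \<noteq> 0 \<or> pcU_leading a z \<noteq> 0"
        unfolding F_def using eventually_nonzero_sector by eventually_elim (simp add: pcU_leading_nonzero)
    qed
    thus ?thesis .
  qed
  have re: "filterlim complex_of_real F at_top"
    unfolding F_def by (rule of_real_filterlim_sector) simp
  define m where "m x = x powr (- a - 1 / 2) * exp (- x\<^sup>2 / 4)" for x :: real
  have m: "pcU_leading a (of_real x) = of_real (m x)" if "x > 0" for x
  proof -
    have "complex_of_real x powr (- of_real a - 1 / 2) = complex_of_real x powr of_real (- a - 1 / 2)" by simp
    also have "\<dots> = of_real (x powr (- a - 1 / 2))" using that by (subst powr_of_real) auto
    finally show ?thesis by (simp add: pcU_leading_def m_def exp_of_real[symmetric])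
  qed
  have lf': "((\<lambda>x. f (of_real x) / pcU_leading a (of_real x)) \<longlongrightarrow> 1) at_top"
    and lg': "((\<lambda>x. g (of_real x) / pcU_leading a (of_real x)) \<longlongrightarrow> 1) at_top"
    using filterlim_compose[OF lf re] filterlim_compose[OF lg re] by auto
  define h where "h x = f (of_real x) / g (of_real x)" for x :: real
  \<comment> \<open>With the real leading form m, m^2/g^2 tends to 1; once its real part exceeds 1/2
    and m^2 <= 1/2, Re (1/g^2) >= 1.\<close>
  have "eventually (\<lambda>x::real. Re ((pcU_leading a (of_real x) / g (of_real x))\<^sup>2) > 1 / 2) at_top"
  proof (rule order_tendstoD(1))
    have "((\<lambda>x. Re ((inverse (g (of_real x) / pcU_leading a (of_real x)))\<^sup>2)) \<longlongrightarrow> Re ((inverse 1)\<^sup>2)) at_top"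
      by (intro tendsto_intros lg') auto
    thus "((\<lambda>x. Re ((pcU_leading a (of_real x) / g (of_real x))\<^sup>2)) \<longlongrightarrow> 1) at_top" by simp
  qed simp
  moreover have "eventually (\<lambda>x. m x ^ 2 \<le> 1 / 2) at_top"
  proof -
    have "((\<lambda>x. m x ^ 2) \<longlongrightarrow> 0) at_top" unfolding m_def using a by real_asymp
    hence "eventually (\<lambda>x. m x ^ 2 < 1 / 2) at_top" by (rule order_tendstoD(2)) auto
    thus ?thesis by eventually_elim simp
  qed
  ultimately have "eventually (\<lambda>x::real. x > 0 \<and> g (of_real x) \<noteq> 0 \<and> Re (1 / (g (of_real x))\<^sup>2) \<ge> 1) at_top"
    using eventually_gt_at_top[of 0]
  proof eventually_elim
    case (elim x)
    have gx: "g (of_real x) \<noteq> 0" using elim by auto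
    have "(pcU_leading a (of_real x) / g (of_real x))\<^sup>2 = of_real ((m x)\<^sup>2) * (1 / (g (of_real x))\<^sup>2)"
      using m[of x] elim by (simp add: power_divide)
    hence "Re ((pcU_leading a (of_real x) / g (of_real x))\<^sup>2) = (m x)\<^sup>2 * Re (1 / (g (of_real x))\<^sup>2)"
      by (simp only: times_complex.sel Re_complex_of_real Im_complex_of_real mult_zero_left diff_zero)
    hence 1: "(m x)\<^sup>2 * Re (1 / (g (of_real x))\<^sup>2) > 1 / 2" using elim by simp
    have "Re (1 / (g (of_real x))\<^sup>2) \<ge> 1"
    proof (rule ccontr)
      assume "\<not> ?thesis"
      hence "(m x)\<^sup>2 * Re (1 / (g (of_real x))\<^sup>2) \<le> (m x)\<^sup>2 * 1" by (intro mult_left_mono) auto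
      with 1 elim show False by simp
    qed
    with gx elim show ?case by auto
  qed
  then obtain X where X: "\<And>x::real. x \<ge> X \<Longrightarrow> g (of_real x) \<noteq> 0 \<and> Re (1 / (g (of_real x))\<^sup>2) \<ge> 1"
    by (auto simp: eventually_at_top_linorder)
  have hl: "(h \<longlongrightarrow> 1) at_top"
  proof (rule Lim_transform_eventually)
    show "((\<lambda>x. (f (of_real x) / pcU_leading a (of_real x)) / (g (of_real x) / pcU_leading a (of_real x))) \<longlongrightarrow> 1) at_top"
      using tendsto_divide[OF lf' lg'] by simp
    show "\<forall>\<^sub>F x in at_top. (f (of_real x) / pcU_leading a (of_real x)) / (g (of_real x) / pcU_leading a (of_real x)) = h x"
      using eventually_gt_at_top[of 0] by eventually_elim (auto simp: h_def pcU_leading_nonzero)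
  qed
  have c0: "c = 0"
  proof (rule ccontr)
    assume c0: "c \<noteq> 0"
    define k where "k x = Re (h x / (- c))" for x
    have kd: "(k has_real_derivative Re (1 / (g (of_real x))\<^sup>2)) (at x)" if "x \<ge> X" for x
    proof -
      have gx: "g (of_real x) \<noteq> 0" using X[OF that] by blast
      have "((\<lambda>z. f z / g z / (- c)) has_field_derivative (1 / (g (of_real x))\<^sup>2)) (at (of_real x))"
        by (rule derivative_eq_intros d gx refl)+
           (use gx c0 c[of "of_real x"] in \<open>auto simp: W_def power2_eq_square field_simps\<close>)
      from has_vector_derivative_real_field[OF this]
      have "((\<lambda>x. h x / (- c)) has_vector_derivative (1 / (g (of_real x))\<^sup>2)) (at x)"
        by (simp add: o_def h_def[abs_def])
      thus ?thesis unfolding k_def has_real_derivative_iff_has_vector_derivative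
        by (rule bounded_linear.has_vector_derivative[OF bounded_linear_Re])
    qed
    have step: "k (x + 1) - k x \<ge> 1" if "x \<ge> X" for x
    proof -
      have "\<exists>z>x. z < x + 1 \<and> k (x + 1) - k x = (x + 1 - x) * Re (1 / (g (of_real z))\<^sup>2)"
        using that by (intro MVT2 kd) auto
      then obtain z where "z > x" "k (x + 1) - k x = Re (1 / (g (of_real z))\<^sup>2)" by auto
      thus ?thesis using X[of z] that by simp
    qed
    have kl: "(k \<longlongrightarrow> Re (1 / (- c))) at_top"
      unfolding k_def[abs_def] by (intro tendsto_intros hl) (use c0 in auto)
    have "filterlim (\<lambda>x::real. x + 1) at_top at_top" by real_asymp
    from filterlim_compose[OF kl this] have "((\<lambda>x. k (x + 1)) \<longlongrightarrow> Re (1 / (- c))) at_top" .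
    from tendsto_diff[OF this kl] have "((\<lambda>x. k (x + 1) - k x) \<longlongrightarrow> 0) at_top" by simp
    moreover have "\<forall>\<^sub>F x in at_top. 1 \<le> k (x + 1) - k x"
      using eventually_ge_at_top[of X] by eventually_elim (rule step)
    ultimately have "(1::real) \<le> 0"
      by (intro tendsto_lowerbound[of "\<lambda>x. k (x + 1) - k x" 0 at_top]) auto
    thus False by simp
  qed
  have eq1: "f z = g z" if "x \<ge> X" "z = of_real x" for z and x :: real
  proof -
    have "h y = h x" if "y \<ge> x" for y
    proof (cases "y = x")
      case False
      have d0: "((\<lambda>x. h x) has_vector_derivative 0) (at w)" if "w \<ge> x" for w
      proof -
        have gx: "g (of_real w) \<noteq> 0" using X[of w] that \<open>x \<ge> X\<close> by auto
        have "((\<lambda>z. f z / g z) has_field_derivative 0) (at (of_real w))"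
          by (rule derivative_eq_intros d gx refl)+
             (use gx c0 c[of "of_real w"] in \<open>auto simp: W_def power2_eq_square field_simps\<close>)
        from has_vector_derivative_real_field[OF this]
        show ?thesis by (simp add: o_def h_def[abs_def])
      qed
      obtain k where "\<And>w. w \<in> {x..y} \<Longrightarrow> h w = k"
        by (rule has_vector_derivative_zero_constant[of "{x..y}" h])
           (auto intro: has_vector_derivative_at_within d0)
      thus ?thesis using that by auto
    qed auto
    hence "eventually (\<lambda>y. h y = h x) at_top"
      using eventually_ge_at_top[of x] by (rule eventually_mono[rotated])
    hence "(h \<longlongrightarrow> h x) at_top" by (rule tendsto_eventually)
    hence "h x = 1" using hl tendsto_unique[of at_top h] by auto
    thus ?thesis using X[of x] that by (simp add: h_def)
  qed
  have "f z = g z" for z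
  proof -
    have "f z - g z = 0"
    proof (rule analytic_continuation[of "\<lambda>z. f z - g z" UNIV "complex_of_real ` {X..}" "of_real X" z])
      show "complex_of_real X islimpt complex_of_real ` {X..}"
        unfolding islimpt_approachable
      proof (intro allI impI)
        fix e :: real assume "e > 0"
        hence "X + e / 2 \<in> {X..}" by simp
        from imageI[OF this, of complex_of_real]
        show "\<exists>x'\<in>complex_of_real ` {X..}. x' \<noteq> complex_of_real X \<and> dist x' (complex_of_real X) < e"
          by (rule bexI[rotated]) (use \<open>e > 0\<close> in \<open>auto simp: dist_norm norm_divide\<close>)
      qed
    qed (use eq1 hol in \<open>auto intro!: holomorphic_intros\<close>)
    thus ?thesis by simp
  qed
  thus ?thesis by (auto simp: g_def)
qed

lemma parabolic_cylinder_U_eq: "a > 0 \<Longrightarrow> parabolic_cylinder_U (of_real a) = gauss_pcU a"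
  unfolding parabolic_cylinder_U_def
  by (rule the_equality) (use gauss_pcU_is_parabolic_cylinder_U parabolic_cylinder_U_unique in auto)

subsection \<open>Uniformization by the hyperbolic sine\<close>

definition Xi :: "complex \<Rightarrow> complex" where
  "Xi w = w / 2 + sinh (2 * w) / 4"

lemma Re_Im_sinh_cosh:
  "Re (sinh w) = sinh (Re w) * cos (Im w)" "Im (sinh w) = cosh (Re w) * sin (Im w)"
  "Re (cosh w) = cosh (Re w) * cos (Im w)" "Im (cosh w) = sinh (Re w) * sin (Im w)" for w :: complex
  by (simp_all add: sinh_def cosh_def Re_exp Im_exp algebra_simps)

lemma Xi_eq: "Xi w = (w + sinh w * cosh w) / 2"
  by (simp add: Xi_def sinh_double)

lemma Re_Xi: "Re (Xi w) = Re w / 2 + sinh (2 * Re w) * cos (2 * Im w) / 4"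
  by (simp add: Xi_def Re_Im_sinh_cosh)

lemma has_field_derivative_Xi: "(Xi has_field_derivative (cosh w)\<^sup>2) (at w within A)"
proof -
  have "(Xi has_field_derivative 1 / 2 + 2 * cosh (2 * w) / 4) (at w within A)"
    unfolding Xi_def[abs_def] by (auto intro!: derivative_eq_intros)
  also have "1 / 2 + 2 * cosh (2 * w) / 4 = (cosh w)\<^sup>2"
    using cosh_double[of w] cosh_square_eq[of w] by (simp add: field_simps)
  finally show ?thesis .
qed

lemma Xi_minus: "Xi (- w) = - Xi w"
  by (simp add: Xi_def)

text \<open>The reflection w -> k pi i - w gives the other preimage under sinh. It changes the sign
  of cosh w, so it leads across a cut to the other branch, and it changes the sign of Re (Xi w)
  too.\<close>

lemma Xi_reflect:
  assumes "k = 1 \<or> k = - 1"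
  shows "sinh (of_real (k * pi) * \<i> - w) = sinh w" "Re (Xi (of_real (k * pi) * \<i> - w)) = - Re (Xi w)"
proof -
  have "cos (k * pi) = - 1" "sin (k * pi) = 0" "cos (2 * (k * pi)) = 1" "sin (2 * (k * pi)) = 0" using assms by auto
  thus "sinh (of_real (k * pi) * \<i> - w) = sinh w" "Re (Xi (of_real (k * pi) * \<i> - w)) = - Re (Xi w)"
    by (auto simp: complex_eq_iff Re_Im_sinh_cosh Re_Xi cos_diff sin_diff right_diff_distrib)
qed

lemma cosh_nonzero_off_branch: "\<bar>Im w\<bar> < pi / 2 \<Longrightarrow> Re (cosh w) > 0"
  by (auto simp: Re_Im_sinh_cosh intro!: mult_pos_pos cos_gt_zero_pi cosh_real_pos)

text \<open>On the open strip Re (cosh w) > 0 selects the principal square root, and sinh w + cosh w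
  = exp w the principal logarithm: the strip is the principal branch.\<close>

lemma principal_sinh:
  assumes "\<bar>Im w\<bar> < pi / 2"
  shows "csqrt ((sinh w)\<^sup>2 + 1) = cosh w" "xi_bar (sinh w) = Xi w"
    "Ln (sinh w + csqrt ((sinh w)\<^sup>2 + 1)) = w"
proof -
  show 1: "csqrt ((sinh w)\<^sup>2 + 1) = cosh w"
    using cosh_nonzero_off_branch[OF assms] by (subst cosh_square_eq[symmetric], intro csqrt_square) auto
  have e: "sinh w + csqrt ((sinh w)\<^sup>2 + 1) = exp w"
    unfolding 1 by (rule sinh_plus_cosh)
  have "- pi < Im w" "Im w \<le> pi" using assms pi_gt_zero by linarith+
  thus 2: "Ln (sinh w + csqrt ((sinh w)\<^sup>2 + 1)) = w"
    unfolding e by (rule Ln_exp)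
  show "xi_bar (sinh w) = Xi w"
    unfolding xi_bar_def 2 unfolding 1 by (simp add: Xi_eq)
qed

definition arsinh_pr :: "complex \<Rightarrow> complex" where
  "arsinh_pr z = Ln (z + csqrt (z\<^sup>2 + 1))"

text \<open>With r the principal root, (z + r) (r - z) = 1 gives exp v = z + r and exp (-v) = r - z.
  Re r >= 0 confines v to the closed strip, whose boundary lies over the two cuts; off the imaginary
  axis Re v has the sign of Re z.\<close>

lemma arsinh_pr:
  "sinh (arsinh_pr z) = z" "cosh (arsinh_pr z) = csqrt (z\<^sup>2 + 1)" "\<bar>Im (arsinh_pr z)\<bar> \<le> pi / 2"
  "xi_bar z = Xi (arsinh_pr z)"
  "Re z > 0 \<Longrightarrow> Re (arsinh_pr z) > 0 \<and> \<bar>Im (arsinh_pr z)\<bar> < pi / 2"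
  "Re z < 0 \<Longrightarrow> Re (arsinh_pr z) < 0 \<and> \<bar>Im (arsinh_pr z)\<bar> < pi / 2"
  "Re z = 0 \<Longrightarrow> Re (arsinh_pr z) = 0 \<or> \<bar>Im (arsinh_pr z)\<bar> = pi / 2"
proof -
  define r where "r = csqrt (z\<^sup>2 + 1)"
  have "r\<^sup>2 = z\<^sup>2 + 1" by (simp add: r_def)
  hence prod: "(z + r) * (r - z) = 1" by (simp add: algebra_simps power2_eq_square)
  hence nz: "z + r \<noteq> 0" by auto
  have "exp (arsinh_pr z) = z + r"
    unfolding arsinh_pr_def r_def[symmetric] using nz by (rule exp_Ln)
  moreover have "inverse (z + r) = r - z" by (rule inverse_unique[OF prod])
  ultimately have e: "exp (arsinh_pr z) = z + r" "exp (- arsinh_pr z) = r - z"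
    by (simp_all add: exp_minus)
  show s: "sinh (arsinh_pr z) = z" and c: "cosh (arsinh_pr z) = csqrt (z\<^sup>2 + 1)"
    by (simp_all add: sinh_def cosh_def e r_def[symmetric] scaleR_conv_of_real)
  show "xi_bar z = Xi (arsinh_pr z)"
    using s c by (simp add: xi_bar_def Xi_eq arsinh_pr_def[symmetric])
  define w where "w = arsinh_pr z"
  have imw: "- pi < Im w" "Im w \<le> pi" using nz by (auto simp: w_def arsinh_pr_def r_def[symmetric] mpi_less_Im_Ln Im_Ln_le_pi)
  have "Re (cosh w) \<ge> 0" unfolding w_def c by (rule Re_csqrt)
  hence cosb: "cos (Im w) \<ge> 0" using cosh_real_pos[of "Re w"] by (auto simp: Re_Im_sinh_cosh zero_le_mult_iff)
  show b: "\<bar>Im (arsinh_pr z)\<bar> \<le> pi / 2"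
  proof (rule ccontr)
    assume "\<not> ?thesis"
    hence "cos \<bar>Im w\<bar> < cos (pi / 2)" using imw by (intro cos_monotone_0_pi) (auto simp: w_def)
    thus False using cosb by simp
  qed
  have "Re z = sinh (Re w) * cos (Im w)" using s by (metis Re_Im_sinh_cosh(1) w_def)
  moreover have "cos (Im w) = 0 \<longleftrightarrow> \<bar>Im w\<bar> = pi / 2"
  proof
    assume "cos (Im w) = 0"
    hence "\<not> (- (pi / 2) < Im w \<and> Im w < pi / 2)" using cos_gt_zero_pi[of "Im w"] by auto
    hence "\<not> \<bar>Im w\<bar> < pi / 2" by linarith
    thus "\<bar>Im w\<bar> = pi / 2" using b by (simp add: w_def)
  next
    assume "\<bar>Im w\<bar> = pi / 2"
    thus "cos (Im w) = 0" using cos_abs_real[of "Im w"] by (metis cos_pi_half)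
  qed
  ultimately show "Re z > 0 \<Longrightarrow> Re (arsinh_pr z) > 0 \<and> \<bar>Im (arsinh_pr z)\<bar> < pi / 2"
    "Re z < 0 \<Longrightarrow> Re (arsinh_pr z) < 0 \<and> \<bar>Im (arsinh_pr z)\<bar> < pi / 2"
    "Re z = 0 \<Longrightarrow> Re (arsinh_pr z) = 0 \<or> \<bar>Im (arsinh_pr z)\<bar> = pi / 2"
    using b cosb by (auto simp: w_def[symmetric] zero_less_mult_iff mult_less_0_iff less_le zero_le_mult_iff mult_le_0_iff)
qed

text \<open>Lets the factor Re w / 2 be taken out of Re (Xi w); the other factor is 1 +
  \<open>sinhc2 (Re w)\<close> cos (2 Im w). The value 1 at 0 makes it continuous, so that factor
  can be followed through Re w = 0.\<close>

definition sinhc2 :: "real \<Rightarrow> real" where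
  "sinhc2 a = (if a = 0 then 1 else sinh (2 * a) / (2 * a))"

lemma continuous_sinhc2: "continuous_on UNIV sinhc2"
proof -
  have "isCont sinhc2 a" for a
  proof (cases "a = 0")
    case True
    have "((\<lambda>x::real. sinh (2 * x)) has_field_derivative 2) (at 0)"
      by (auto intro!: derivative_eq_intros)
    hence "((\<lambda>x::real. sinh (2 * x) / x) \<longlongrightarrow> 2) (at 0)"
      unfolding has_field_derivative_iff by simp
    from tendsto_divide[OF this tendsto_const, of 2]
    have "((\<lambda>x::real. sinh (2 * x) / x / 2) \<longlongrightarrow> 1) (at 0)" by simp
    hence "(sinhc2 \<longlongrightarrow> 1) (at 0)"
      by (rule Lim_transform_eventually)
         (auto simp: eventually_at_filter sinhc2_def intro!: always_eventually)
    thus ?thesis using True by (simp add: isCont_def sinhc2_def)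
  next
    case False
    have "isCont (\<lambda>a. sinh (2 * a) / (2 * a)) a" using False by (intro continuous_intros) auto
    moreover have "eventually (\<lambda>x. x \<noteq> 0) (nhds a)" using False by (intro t1_space_nhds) auto
    hence "eventually (\<lambda>x. sinhc2 x = sinh (2 * x) / (2 * x)) (nhds a)"
      by eventually_elim (simp add: sinhc2_def)
    ultimately show ?thesis by (simp add: isCont_cong)
  qed
  thus ?thesis by (simp add: continuous_at_imp_continuous_on)
qed

lemma sinh_gt_self: "x > 0 \<Longrightarrow> sinh x > (x::real)"
proof -
  assume x: "x > 0"
  have "(\<lambda>x. sinh x - x) 0 < sinh x - x"
  proof (rule DERIV_pos_imp_increasing_open[OF x])
    fix y :: real assume "0 < y"
    hence "cosh y > 1" using cosh_real_ge_1[of y] cosh_real_one_iff[of y] by linarith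
    thus "\<exists>D. ((\<lambda>x. sinh x - x) has_real_derivative D) (at y) \<and> D > 0"
      by (intro exI[of _ "cosh y - 1"]) (auto intro!: derivative_eq_intros)
  qed (auto intro!: continuous_intros)
  thus "sinh x > x" by simp
qed

lemma sinhc2_gt_1: "a \<noteq> 0 \<Longrightarrow> sinhc2 a > 1"
  using sinh_gt_self[of "2 * a"] sinh_gt_self[of "- 2 * a"]
  by (cases "a > 0") (auto simp: sinhc2_def field_simps)

lemma sinhc2_ge_1: "sinhc2 a \<ge> 1"
  using sinhc2_gt_1[of a] by (cases "a = 0") (auto simp: sinhc2_def)

lemma Re_Xi_sinhc2: "Re (Xi w) = Re w / 2 * (1 + sinhc2 (Re w) * cos (2 * Im w))"
  by (simp add: Re_Xi sinhc2_def field_simps)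

text \<open>The part of the Riemann surface of \<open>\<xi>\<close> that admissible paths to \<open>+\<infinity>\<close> sweep out, in the
  coordinate \<open>w\<close> with \<open>z = sinh w\<close>. It is the plane cut along the two left level curves.\<close>

definition sheet :: "complex set" where
  "sheet = {w. Re w > 0 \<and> \<bar>Im w\<bar> \<le> pi / 2} \<union> {w. Re w > 0 \<and> \<bar>Im w\<bar> < pi \<and> Re (Xi w) < 0}
    \<union> {w. \<bar>Im w\<bar> < pi / 2 \<and> Re w \<le> 0 \<and> sinhc2 (Re w) * cos (2 * Im w) > - 1}"

lemma sheet_neg_iff: "Re w < 0 \<Longrightarrow> w \<in> sheet \<longleftrightarrow> \<bar>Im w\<bar> < pi / 2 \<and> Re (Xi w) < 0"
  by (auto simp: sheet_def Re_Xi_sinhc2 mult_less_0_iff)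

lemma sheet_zero_iff: "Re w = 0 \<Longrightarrow> w \<in> sheet \<longleftrightarrow> \<bar>Im w\<bar> < pi / 2"
proof -
  assume "Re w = 0"
  moreover have "\<bar>Im w\<bar> < pi / 2 \<Longrightarrow> cos (Im w) > 0" by (intro cos_gt_zero_pi) auto
  ultimately show ?thesis by (auto simp: sheet_def sinhc2_def cos_double_cos)
qed

lemma sheet_pos_iff: "Re w > 0 \<Longrightarrow> w \<in> sheet \<longleftrightarrow> \<bar>Im w\<bar> \<le> pi / 2 \<or> \<bar>Im w\<bar> < pi \<and> Re (Xi w) < 0"
  by (auto simp: sheet_def)

lemma Re_Xi_imag_half_pi: "\<bar>Im w\<bar> = pi / 2 \<Longrightarrow> Re (Xi w) = Re w / 2 * (1 - sinhc2 (Re w))"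
proof -
  assume "\<bar>Im w\<bar> = pi / 2"
  hence "\<bar>2 * Im w\<bar> = pi" by (simp add: abs_mult)
  hence "cos (2 * Im w) = - 1" using cos_abs_real[of "2 * Im w"] by (metis cos_pi)
  thus ?thesis by (simp add: Re_Xi_sinhc2)
qed

lemma continuous_on_Re_Xi: "continuous_on A (\<lambda>w. Re (Xi w))"
  unfolding Re_Xi by (intro continuous_intros) auto

text \<open>Points with Re w > 0 and |Im w| = pi/2 have Re (Xi w) < 0 and lie in the second piece,
  and extending the third piece to Re w > 0 only adds points of the first. So all inequalities can
  be taken strict.\<close>

lemma open_sheet: "open sheet"
proof -
  have eq: "sheet = {w. Re w > 0 \<and> \<bar>Im w\<bar> < pi / 2} \<union> {w. Re w > 0 \<and> \<bar>Im w\<bar> < pi \<and> Re (Xi w) < 0}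
    \<union> {w. \<bar>Im w\<bar> < pi / 2 \<and> sinhc2 (Re w) * cos (2 * Im w) > - 1}" (is "_ = ?A \<union> ?B \<union> ?C")
  proof -
    have "w \<in> ?B" if "Re w > 0" "\<bar>Im w\<bar> = pi / 2" for w
    proof -
      have "Re w / 2 * (1 - sinhc2 (Re w)) < 0" using that sinhc2_gt_1[of "Re w"] by (intro mult_pos_neg) auto
      hence "Re (Xi w) < 0" using Re_Xi_imag_half_pi[OF that(2)] by simp
      moreover have "\<bar>Im w\<bar> < pi" using that(2) pi_gt_zero by linarith
      ultimately show ?thesis using that(1) by blast
    qed
    moreover have "\<bar>Im w\<bar> \<le> pi / 2 \<longleftrightarrow> \<bar>Im w\<bar> < pi / 2 \<or> \<bar>Im w\<bar> = pi / 2" for w by auto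
    ultimately show ?thesis unfolding sheet_def by fastforce
  qed
  have cont: "continuous_on UNIV (\<lambda>w. sinhc2 (Re w) * cos (2 * Im w))"
    by (intro continuous_intros continuous_on_compose2[OF continuous_sinhc2]) auto
  show ?thesis unfolding eq
    by (intro open_Un open_Collect_conj open_Collect_less continuous_intros continuous_on_Re_Xi cont)
qed

text \<open>Makes \<open>csqrt (cosh w)\<close> a continuous branch of q on the whole sheet. A
  nonpositive real cosh w would need |Im w| >= pi/2, hence Re w > 0, hence sin (Im w) = 0, which |Im
  w| < pi excludes.\<close>

lemma cosh_not_nonpos_on_sheet:
  assumes "w \<in> sheet"
  shows "cosh w \<notin> \<real>\<^sub>\<le>\<^sub>0"
proof
  assume "cosh w \<in> \<real>\<^sub>\<le>\<^sub>0"
  hence 1: "cos (Im w) \<le> 0" "Re w = 0 \<or> sin (Im w) = 0"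
    by (auto simp: complex_nonpos_Reals_iff Re_Im_sinh_cosh mult_le_0_iff)
       (use cosh_real_pos[of "Re w"] in linarith)+
  have "\<bar>Im w\<bar> \<ge> pi / 2"
  proof (rule ccontr)
    assume "\<not> ?thesis"
    hence "cos (Im w) > 0" by (intro cos_gt_zero_pi) auto
    thus False using 1(1) by simp
  qed
  hence "Re w > 0" using assms sheet_neg_iff[of w] sheet_zero_iff[of w] by (cases "Re w" "0::real" rule: linorder_cases) auto
  hence "\<bar>Im w\<bar> < pi" "sin (Im w) = 0" using assms 1 pi_gt_zero unfolding sheet_def by (auto simp del: pi_gt_zero)
  hence "Im w = 0" using sin_gt_zero[of "Im w"] sin_gt_zero[of "- Im w"] by (cases "Im w" "0::real" rule: linorder_cases) auto
  thus False using \<open>\<bar>Im w\<bar> \<ge> pi / 2\<close> pi_gt_zero by linarith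
qed

text \<open>Two points with the same sinh differ by a period, which |Im w| < pi reduces to equality,
  or are reflections of each other. Reflected points have opposite Re (Xi w), while the sheet would
  require both values to be negative.\<close>

lemma inj_on_sinh_sheet: "inj_on sinh sheet"
proof (rule inj_onI)
  fix w w' assume w: "w \<in> sheet" "w' \<in> sheet" and eq: "sinh w = sinh w'"
  have bb: "\<bar>Im v\<bar> < pi" if "v \<in> sheet" for v
    using that pi_gt_zero unfolding sheet_def by (auto simp del: pi_gt_zero)
  note b = bb[OF w(1)] bb[OF w(2)]
  have "(exp w - exp w') * (1 + exp (- w) * exp (- w')) = 2 * (sinh w - sinh w')"
    by (simp add: sinh_def exp_minus scaleR_conv_of_real field_simps)
  hence "exp w = exp w' \<or> 1 + exp (- w) * exp (- w') = 0"
    using eq by simp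
  moreover have "1 + exp (- w) * exp (- w') = 0 \<Longrightarrow> exp (w + w') = - 1"
    by (simp add: exp_add exp_minus field_simps add_eq_0_iff)
  ultimately have "exp w = exp w' \<or> exp (w + w') = - 1" by blast
  thus "w = w'"
  proof
    assume "exp w = exp w'"
    moreover have "\<bar>Im w - Im w'\<bar> < 2 * pi" using b by linarith
    ultimately show ?thesis using exp_complex_eqI by blast
  next
    assume e: "exp (w + w') = - 1"
    have "norm (exp (w + w')) = 1" by (simp add: e)
    hence a: "Re w' = - Re w" by simp
    have "Re (exp (w + w')) = -1" by (simp add: e)
    hence c: "cos (Im w + Im w') = - 1" by (simp add: Re_exp a)
    \<comment> \<open>By symmetry Re v >= 0. Then v' lies in the open strip, which forces |Im v| >
      pi/2, and at both points the sheet requires a negative Re (Xi).\<close>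
    have *: False if "v \<in> sheet" "v' \<in> sheet" "Re v' = - Re v" "Re v \<ge> 0" "cos (Im v + Im v') = - 1" "sinh v = sinh v'" for v v'
    proof -
      have v': "\<bar>Im v'\<bar> < pi / 2"
        using that sheet_neg_iff[of v'] sheet_zero_iff[of v'] by (cases "Re v = 0") auto
      have v: "\<bar>Im v\<bar> > pi / 2"
      proof (rule ccontr)
        assume "\<not> ?thesis"
        hence "\<bar>Im v + Im v'\<bar> < pi" using v' by linarith
        hence "cos \<bar>Im v + Im v'\<bar> > cos pi" by (intro cos_monotone_0_pi) auto
        thus False using that by simp
      qed
      hence pos: "Re v > 0" using that sheet_zero_iff[of v] by (cases "Re v = 0") auto
      hence neg: "Re (Xi v) < 0" "Re (Xi v') < 0"
        using that v sheet_pos_iff[of v] sheet_neg_iff[of v'] by auto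
      have "cos (2 * (Im v + Im v')) = 1" using that(5) cos_double_cos[of "Im v + Im v'"] by simp
      moreover have "sin (2 * (Im v + Im v')) = 0"
        using that(5) sin_cos_squared_add[of "Im v + Im v'"] sin_double[of "Im v + Im v'"] by simp
      ultimately have "cos (2 * Im v') = cos (2 * Im v)"
        using cos_diff[of "2 * (Im v + Im v')" "2 * Im v"] by (simp add: algebra_simps)
      hence "Re (Xi v') = - Re (Xi v)" unfolding Re_Xi by (simp add: that(3))
      with neg show False by simp
    qed
    show ?thesis
      using *[OF w] *[OF w(2) w(1)] a c eq by (cases "Re w \<ge> 0") (auto simp: add.commute)
  qed
qed

text \<open>The principal preimage v lies in the sheet except where Re z < 0 and Re (Xi v) > 0, and
  on the cuts when Re v < 0. There its reflection does: such z are reached by continuation across a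
  cut.\<close>

lemma sinh_image_sheet_cover:
  assumes "z \<noteq> \<i>" "z \<noteq> - \<i>" "\<not> (Re z < 0 \<and> Re (xi_bar z) = 0)"
  obtains w where "w \<in> sheet" "sinh w = z"
proof -
  define v where "v = arsinh_pr z"
  note v = arsinh_pr[of z, folded v_def]
  consider "Re z > 0" | "Re z = 0" "Re v = 0" | "Re z = 0" "Re v \<noteq> 0" "\<bar>Im v\<bar> = pi / 2"
    | "Re z < 0" "Re (Xi v) < 0" | "Re z < 0" "Re (Xi v) > 0"
    using assms(3) v(4,7) by (metis linorder_less_linear)
  thus ?thesis
  proof cases
    case 1
    thus ?thesis using v sheet_pos_iff[of v] by (intro that[of v]) auto
  next
    case 2
    have "\<bar>Im v\<bar> \<noteq> pi / 2"
    proof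
      assume "\<bar>Im v\<bar> = pi / 2"
      hence "Im v = pi / 2 \<or> Im v = - (pi / 2)" by linarith
      hence "sin (Im v) = 1 \<or> sin (Im v) = - 1" by (metis sin_pi_half sin_minus)
      hence "sinh v = \<i> \<or> sinh v = - \<i>" using 2 v(1) by (auto simp: complex_eq_iff Re_Im_sinh_cosh)
      thus False using v(1) assms by auto
    qed
    thus ?thesis using 2 v sheet_zero_iff[of v] by (intro that[of v]) auto
  next
    case 3
    \<comment> \<open>The sign of Im v selects the reflection that returns to the closed
      strip.\<close>
    define k :: real where "k = (if Im v > 0 then 1 else - 1)"
    have k: "k = 1 \<or> k = - 1" "\<bar>k * pi - Im v\<bar> = pi / 2" using 3(3) pi_gt_zero by (auto simp: k_def abs_if split: if_splits)
    show ?thesis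
    proof (cases "Re v > 0")
      case True
      thus ?thesis using 3 v sheet_pos_iff[of v] by (intro that[of v]) auto
    next
      case False
      thus ?thesis using 3 v k Xi_reflect(1)[OF k(1), of v] sheet_pos_iff[of "of_real (k * pi) * \<i> - v"]
        by (intro that[of "of_real (k * pi) * \<i> - v"]) auto
    qed
  next
    case 4
    thus ?thesis using v sheet_neg_iff[of v] by (intro that[of v]) auto
  next
    case 5
    have a: "Re v < 0" "\<bar>Im v\<bar> < pi / 2" using v(6) 5 by auto
    have "Im v \<noteq> 0" using 5 a sinhc2_ge_1[of "Re v"] by (auto simp: Re_Xi_sinhc2 zero_less_mult_iff)
    define k :: real where "k = (if Im v > 0 then 1 else - 1)"
    have k: "k = 1 \<or> k = - 1" "\<bar>k * pi - Im v\<bar> < pi" using a(2) \<open>Im v \<noteq> 0\<close> by (auto simp: k_def abs_if split: if_splits)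
    show ?thesis
      using a 5 v k Xi_reflect[OF k(1), of v] sheet_pos_iff[of "of_real (k * pi) * \<i> - v"]
      by (intro that[of "of_real (k * pi) * \<i> - v"]) auto
  qed
qed

text \<open>If Re (sinh w) < 0, the principal preimage is w, with Re (Xi w) < 0, or the reflection
  of w, with the opposite sign; the value 0 never occurs.\<close>

lemma sinh_sheet_not_exceptional:
  assumes "w \<in> sheet"
  shows "sinh w \<noteq> \<i>" "sinh w \<noteq> - \<i>" "\<not> (Re (sinh w) < 0 \<and> Re (xi_bar (sinh w)) = 0)"
proof -
  have "cosh w \<noteq> 0" using cosh_not_nonpos_on_sheet[OF assms] by auto
  moreover have "(cosh w)\<^sup>2 = (sinh w)\<^sup>2 + 1" by (rule cosh_square_eq)
  ultimately show "sinh w \<noteq> \<i>" "sinh w \<noteq> - \<i>" by auto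
  show "\<not> (Re (sinh w) < 0 \<and> Re (xi_bar (sinh w)) = 0)"
  proof (intro notI, elim conjE)
    assume neg: "Re (sinh w) < 0" and 0: "Re (xi_bar (sinh w)) = 0"
    define v where "v = arsinh_pr (sinh w)"
    note v = arsinh_pr[of "sinh w", folded v_def]
    have v': "Re v < 0" "\<bar>Im v\<bar> < pi / 2" "Re (Xi v) = 0" using v neg 0 by auto
    consider "\<bar>Im w\<bar> < pi / 2" | "Re w > 0" "Re (Xi w) < 0" "\<bar>Im w\<bar> < pi" "\<bar>Im w\<bar> \<ge> pi / 2" | "\<bar>Im w\<bar> = pi / 2"
      using assms unfolding sheet_def by fastforce
    thus False
    proof cases
      case 1
      hence "- (pi / 2) < Im w" "Im w < pi / 2" by linarith+
      hence "cos (Im w) > 0" by (rule cos_gt_zero_pi)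
      hence "Re w < 0" using neg by (auto simp: Re_Im_sinh_cosh mult_less_0_iff)
      hence "Re (Xi w) < 0" using assms sheet_neg_iff by blast
      thus False using 0 principal_sinh(2)[OF 1] by simp
    next
      case 2
      have "Im w \<noteq> 0" using 2(4) pi_gt_zero by (metis abs_zero half_gt_zero_iff not_le)
      define k :: real where "k = (if Im w > 0 then 1 else - 1)"
      have k: "k = 1 \<or> k = - 1" "\<bar>k * pi - Im w\<bar> \<le> pi / 2" using 2 \<open>Im w \<noteq> 0\<close> by (auto simp: k_def abs_if split: if_splits)
      define w' where "w' = of_real (k * pi) * \<i> - w"
      have w': "sinh w' = sinh w" "Re (Xi w') > 0" "\<bar>Im w'\<bar> \<le> pi / 2"
        using Xi_reflect[OF k(1), of w] 2 k by (auto simp: w'_def)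
      have "\<bar>Im w'\<bar> \<noteq> pi / 2"
      proof
        assume "\<bar>Im w'\<bar> = pi / 2"
        hence "cos (Im w') = 0" using cos_abs_real[of "Im w'"] by (metis cos_pi_half)
        thus False using neg w'(1) Re_Im_sinh_cosh(1)[of w'] by simp
      qed
      hence "\<bar>Im w'\<bar> < pi / 2" using w' by simp
      from principal_sinh(2)[OF this] show False using w' 0 by simp
    next
      case 3
      hence "cos (Im w) = 0" using cos_abs_real[of "Im w"] by (metis cos_pi_half)
      thus False using neg by (simp add: Re_Im_sinh_cosh)
    qed
  qed
qed

subsection \<open>The exceptional set\<close>

lemma Re_xi_bar_branch_points: "Re (xi_bar \<i>) = 0" "Re (xi_bar (- \<i>)) = 0"
  by (simp_all add: xi_bar_def)

text \<open>For Re w = a < 0 the level Re (Xi w) = 0 is \<open>sinhc2 a\<close> cos (2 b) = -1.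
  Solving for b = Im w gives a continuous arc over a <= 0 ending at the branch point, so the curve
  is connected. The level set misses the real axis, which separates the two curves.\<close>

lemma left_level_curve_eq:
  assumes s: "s = 1 \<or> s = - 1"
  shows "left_level_curve (of_real s * \<i>) = {z. Re z < 0 \<and> Re (xi_bar z) = 0 \<and> s * Im z > 0} \<union> {of_real s * \<i>}"
proof -
  define c where "c = of_real s * \<i>"
  define L where "L = {z. Re z < 0 \<and> Re (xi_bar z) = 0}"
  define h where "h a = arccos (- 1 / sinhc2 a) / 2" for a
  define \<gamma> where "\<gamma> a = sinh (Complex a (s * h a))" for a
  have h: "0 \<le> h a" "h a \<le> pi / 2" "cos (2 * h a) = - 1 / sinhc2 a" for a
    using sinhc2_ge_1[of a] arccos_lbound[of "- 1 / sinhc2 a"] arccos_ubound[of "- 1 / sinhc2 a"]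
    by (auto simp: h_def field_simps)
  have cont: "continuous_on {..0} \<gamma>"
  proof -
    have s1: "1 / sinhc2 a \<le> 1" "- 1 \<le> 1 / sinhc2 a" "sinhc2 a \<noteq> 0" for a
      using sinhc2_ge_1[of a] by (auto simp: field_simps)
    have "continuous_on {..0} h" unfolding h_def
      by (intro continuous_intros continuous_on_subset[OF continuous_sinhc2]) (auto simp: s1)
    thus ?thesis unfolding \<gamma>_def by (intro continuous_intros continuous_on_Complex) auto
  qed
  have sh: "\<bar>s * h a\<bar> = h a" "cos (2 * (s * h a)) = cos (2 * h a)" for a using s h(1)[of a] by auto
  have im: "\<gamma> ` {..0} \<subseteq> (L \<inter> {z. s * Im z > 0}) \<union> {c}"
  proof
    fix z assume "z \<in> \<gamma> ` {..0}"
    then obtain a where a: "a \<le> 0" "z = \<gamma> a" by auto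
    show "z \<in> (L \<inter> {z. s * Im z > 0}) \<union> {c}"
    proof (cases "a = 0")
      case True
      have "sin (h 0) = 1" "cos (h 0) = 0" by (simp_all add: h_def sinhc2_def)
      thus ?thesis using a True s by (auto simp: \<gamma>_def c_def complex_eq_iff Re_Im_sinh_cosh)
    next
      case False
      hence a0: "a < 0" using a by simp
      have g1: "sinhc2 a > 1" using sinhc2_gt_1 False by blast
      have "cos (2 * h a) > - 1" unfolding h(3) using g1 by (simp add: field_simps)
      hence "2 * h a \<noteq> pi" by auto
      hence "h a \<noteq> pi / 2" by simp
      moreover have "cos (2 * h a) < 1" unfolding h(3) using g1 by (simp add: field_simps)
      hence "h a \<noteq> 0" by auto
      ultimately have ha: "0 < h a" "h a < pi / 2" using h[of a] by auto
      define w where "w = Complex a (s * h a)"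
      have w: "Re w = a" "\<bar>Im w\<bar> < pi / 2" "Re (Xi w) = 0"
        using sh(1)[of a] ha g1 sh(2)[of a] h(3)[of a] by (auto simp: w_def Re_Xi_sinhc2)
      have "cos (Im w) > 0" using w by (intro cos_gt_zero_pi) auto
      hence "Re z < 0" using a a0 w(1) by (simp add: \<gamma>_def w_def[symmetric] Re_Im_sinh_cosh mult_less_0_iff)
      moreover have "Re (xi_bar z) = 0" using principal_sinh(2)[OF w(2)] w(3) a by (simp add: \<gamma>_def w_def)
      moreover have "s * Im z > 0"
      proof -
        have "s * Im z = cosh a * (s * sin (s * h a))" using a by (simp add: \<gamma>_def Re_Im_sinh_cosh)
        also have "s * sin (s * h a) = sin (h a)" using s by auto
        also have "cosh a * sin (h a) > 0" using ha by (intro mult_pos_pos cosh_real_pos sin_gt_zero) auto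
        finally show ?thesis .
      qed
      ultimately show ?thesis by (simp add: L_def)
    qed
  qed
  have im': "(L \<inter> {z. s * Im z > 0}) \<union> {c} \<subseteq> \<gamma> ` {..0}"
  proof
    fix z assume z: "z \<in> (L \<inter> {z. s * Im z > 0}) \<union> {c}"
    show "z \<in> \<gamma> ` {..0}"
    proof (cases "z = c")
      case True
      have "sin (h 0) = 1" "cos (h 0) = 0" by (simp_all add: h_def sinhc2_def)
      hence "z = \<gamma> 0" using True s by (auto simp: \<gamma>_def c_def complex_eq_iff Re_Im_sinh_cosh)
      thus ?thesis by auto
    next
      case False
      hence L: "Re z < 0" "Re (xi_bar z) = 0" "s * Im z > 0" using z by (auto simp: L_def)
      define v where "v = arsinh_pr z"
      note v = arsinh_pr[of z, folded v_def]
      have v': "Re v < 0" "\<bar>Im v\<bar> < pi / 2" "Re (Xi v) = 0" using v L by auto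
      have "1 + sinhc2 (Re v) * cos (2 * Im v) = 0" using v'(1,3) by (simp add: Re_Xi_sinhc2)
      hence "cos (2 * Im v) = - 1 / sinhc2 (Re v)"
        using sinhc2_ge_1[of "Re v"] by (auto simp: field_simps)
      hence "arccos (- 1 / sinhc2 (Re v)) = arccos (cos \<bar>2 * Im v\<bar>)" by simp
      also have "\<dots> = \<bar>2 * Im v\<bar>" using v' by (intro arccos_cos) auto
      finally have "h (Re v) = \<bar>Im v\<bar>" by (simp add: h_def abs_mult)
      moreover have "cosh (Re v) * (s * sin (Im v)) > 0"
        using L(3) v(1) Re_Im_sinh_cosh(2)[of v] by (simp add: mult_ac)
      hence "s * sin (Im v) > 0" using cosh_real_pos zero_less_mult_pos by blast
      hence "s * \<bar>Im v\<bar> = Im v"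
        using s sin_gt_zero[of "Im v"] sin_gt_zero[of "- Im v"] v'
        by (cases "Im v" "0::real" rule: linorder_cases) (auto simp: zero_less_mult_iff)
      ultimately have "\<gamma> (Re v) = z" using v(1) by (simp add: \<gamma>_def)
      thus ?thesis using v' by (auto intro!: image_eqI[of _ _ "Re v"])
    qed
  qed
  have eq: "\<gamma> ` {..0} = (L \<inter> {z. s * Im z > 0}) \<union> {c}" using im im' by auto
  have conn: "connected ((L \<inter> {z. s * Im z > 0}) \<union> {c})"
    unfolding eq[symmetric] by (intro connected_continuous_image cont) auto
  have Re_c: "Re (xi_bar c) = 0" using s Re_xi_bar_branch_points by (auto simp: c_def)
  have "left_level_curve c = connected_component_set (L \<union> {c}) c"
    by (simp add: left_level_curve_def Re_c L_def)
  also have "\<dots> = (L \<inter> {z. s * Im z > 0}) \<union> {c}"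
  proof
    show "(L \<inter> {z. s * Im z > 0}) \<union> {c} \<subseteq> connected_component_set (L \<union> {c}) c"
      by (intro connected_component_maximal conn) auto
    define C where "C = connected_component_set (L \<union> {c}) c"
    have C: "connected C" "C \<subseteq> L \<union> {c}" "c \<in> C"
      unfolding C_def by (auto simp: connected_component_subset intro: connected_component_subset[THEN subsetD])
    have nz: "Im z \<noteq> 0" if "z \<in> L" for z
    proof
      assume 0: "Im z = 0"
      define v where "v = arsinh_pr z"
      note v = arsinh_pr[of z, folded v_def]
      have v': "Re v < 0" "\<bar>Im v\<bar> < pi / 2" "Re (Xi v) = 0" using v that by (auto simp: L_def)
      have "sin (Im v) = 0" using 0 v(1) cosh_real_pos[of "Re v"] Re_Im_sinh_cosh(2)[of v] by simp
      hence "Im v = 0" using sin_gt_zero[of "Im v"] sin_gt_zero[of "- Im v"] v'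
        by (cases "Im v" "0::real" rule: linorder_cases) auto
      thus False using v' sinhc2_ge_1[of "Re v"] by (auto simp: Re_Xi_sinhc2)
    qed
    have sc: "s * Im c > 0" using s by (auto simp: c_def)
    \<comment> \<open>The component is connected, contains c and avoids the real axis, so it cannot
      reach the other half plane.\<close>
    have "C \<inter> {z. s * Im z < 0} = {}"
    proof (rule ccontr)
      assume "\<not> ?thesis"
      moreover have "C \<subseteq> {z. s * Im z > 0} \<union> {z. s * Im z < 0}"
        using C(2) nz sc s by (fastforce simp: linorder_neq_iff)
      moreover have "open {z. s * Im z > 0}" "open {z. s * Im z < 0}"
        by (intro open_Collect_less continuous_intros)+
      moreover have "{z. s * Im z > 0} \<inter> {z. s * Im z < 0} \<inter> C = {}" by auto
      ultimately show False using C(1,3) sc unfolding connected_def by blast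
    qed
    thus "connected_component_set (L \<union> {c}) c \<subseteq> (L \<inter> {z. s * Im z > 0}) \<union> {c}"
      unfolding C_def[symmetric] using C(2) nz sc s by (fastforce simp: linorder_neq_iff)
  qed
  finally show ?thesis by (auto simp: c_def L_def)
qed

lemma exceptional_set_eq: "exceptional_set = {z. Re z < 0 \<and> Re (xi_bar z) = 0} \<union> {\<i>, - \<i>}"
proof -
  have "Im z \<noteq> 0" if "Re z < 0" "Re (xi_bar z) = 0" for z
  proof
    assume 0: "Im z = 0"
    define v where "v = arsinh_pr z"
    note v = arsinh_pr[of z, folded v_def]
    have v': "Re v < 0" "\<bar>Im v\<bar> < pi / 2" "Re (Xi v) = 0" using v that by auto
    have "sin (Im v) = 0" using 0 v(1) cosh_real_pos[of "Re v"] Re_Im_sinh_cosh(2)[of v] by simp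
    hence "Im v = 0" using sin_gt_zero[of "Im v"] sin_gt_zero[of "- Im v"] v'
      by (cases "Im v" "0::real" rule: linorder_cases) auto
    thus False using v' sinhc2_ge_1[of "Re v"] by (auto simp: Re_Xi_sinhc2)
  qed
  thus ?thesis
    using left_level_curve_eq[of 1] left_level_curve_eq[of "- 1"]
    by (fastforce simp: exceptional_set_def linorder_neq_iff)
qed

lemma sinh_image_sheet: "sinh ` sheet = - exceptional_set"
proof
  show "sinh ` sheet \<subseteq> - exceptional_set"
    using sinh_sheet_not_exceptional by (auto simp: exceptional_set_eq)
  show "- exceptional_set \<subseteq> sinh ` sheet"
  proof
    fix z assume "z \<in> - exceptional_set"
    then obtain w where "w \<in> sheet" "sinh w = z"
      by (auto simp: exceptional_set_eq intro: sinh_image_sheet_cover[of z])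
    thus "z \<in> sinh ` sheet" by auto
  qed
qed

subsection \<open>Lifting admissible paths\<close>

lemma R2_arc_on_continuous: "R2_arc_on \<gamma> I \<Longrightarrow> continuous_on I \<gamma>"
  unfolding R2_arc_on_def continuous_on_eq_continuous_within
  by (blast intro: has_vector_derivative_continuous)

lemma breakpoints_mono:
  fixes \<tau> :: "nat \<Rightarrow> real"
  assumes "\<And>i. i < m \<Longrightarrow> \<tau> i < \<tau> (Suc i)" "i \<le> j" "j \<le> m"
  shows "\<tau> i \<le> \<tau> j"
  using assms(2,3)
proof (induction j)
  case (Suc j)
  thus ?case using assms(1)[of j] by (cases "i = Suc j") force+
qed auto

lemma R2_chain_continuous:
  assumes "R2_chain \<gamma>"
  shows "continuous_on {0..} \<gamma>"
proof -
  obtain m \<tau> where \<tau>: "\<tau> 0 = 0" "\<And>i. i < m \<Longrightarrow> \<tau> i < \<tau> (Suc i)"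
    "\<And>i. i < m \<Longrightarrow> R2_arc_on \<gamma> {\<tau> i..\<tau> (Suc i)}" "R2_arc_on \<gamma> {\<tau> m..}"
    using assms by (auto simp: R2_chain_def)
  have "continuous_on {0..\<tau> i} \<gamma>" if "i \<le> m" for i
    using that
  proof (induction i)
    case (Suc i)
    have "{0..\<tau> (Suc i)} = {0..\<tau> i} \<union> {\<tau> i..\<tau> (Suc i)}"
      using \<tau>(1) less_imp_le[OF \<tau>(2)[of i]] breakpoints_mono[of m \<tau> 0 i] \<tau>(2) Suc.prems
      by (intro ivl_disj_un_two_touch(4)[symmetric]) auto
    thus ?case using Suc R2_arc_on_continuous[OF \<tau>(3)] by (auto intro: continuous_on_closed_Un)
  qed (simp add: \<tau>(1))
  moreover have "{0..} = {0..\<tau> m} \<union> {\<tau> m..}"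
    using \<tau>(1) breakpoints_mono[of m \<tau> 0 m] \<tau>(2) by auto
  ultimately show ?thesis using R2_arc_on_continuous[OF \<tau>(4)] by (auto intro: continuous_on_closed_Un)
qed

text \<open>The conditions, in the coordinate w, under which the sinh of a path is admissible. The
  strip condition on the tail says that the continuation starts from the principal branch.\<close>

definition lifted_path :: "(real \<Rightarrow> complex) \<Rightarrow> bool" where
  "lifted_path w \<longleftrightarrow> continuous_on {0..} w \<and> R2_chain w \<and> (\<forall>t\<ge>0. cosh (w t) \<noteq> 0) \<and>
     mono_on {0..} (\<lambda>t. Re (Xi (w t))) \<and> (\<forall>\<^sub>F t in at_top. \<bar>Im (w t)\<bar> < pi / 2) \<and>
     filterlim (\<lambda>t. Re (sinh (w t))) at_top at_top"

text \<open>Consider the last time T outside the sheet. Unless w T is a branch point, the path right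
  after T runs through a part of the sheet where Re (Xi w) < 0, so by monotonicity Re (Xi (w T)) <
  0. But on the boundary of those parts Re (Xi w) >= 0.\<close>

lemma stays_in_sheet:
  assumes cont: "continuous_on {0..} w" and nz: "\<And>t. t \<ge> 0 \<Longrightarrow> cosh (w t) \<noteq> 0"
    and mono: "mono_on {0..} (\<lambda>t. Re (Xi (w t)))"
    and ev: "\<forall>\<^sub>F t in at_top. Re (w t) > 0 \<and> \<bar>Im (w t)\<bar> < pi / 2"
    and t: "t \<ge> (0::real)"
  shows "w t \<in> sheet"
proof (rule ccontr)
  assume out: "w t \<notin> sheet"
  define S where "S = {s \<in> {0..}. w s \<notin> sheet}"
  obtain B where B: "\<And>s. s \<ge> B \<Longrightarrow> Re (w s) > 0 \<and> \<bar>Im (w s)\<bar> < pi / 2"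
    using ev by (auto simp: eventually_at_top_linorder)
  have SB: "s \<le> B" if "s \<in> S" for s
    using that B[of s] sheet_pos_iff[of "w s"] by (force simp: S_def)
  have bdd: "bdd_above S" by (rule bdd_aboveI) (rule SB)
  have ne: "S \<noteq> {}" using t out by (auto simp: S_def)
  have "closed S"
  proof -
    have "S = {0..} \<inter> w -` (- sheet)" by (auto simp: S_def)
    also have "closed \<dots>" by (rule continuous_closed_preimage[OF cont]) (auto simp: open_sheet closed_def[symmetric])
    finally show ?thesis .
  qed
  define T where "T = Sup S"
  have "T \<in> S" unfolding T_def by (rule closed_contains_Sup[OF ne bdd \<open>closed S\<close>])
  hence T: "T \<ge> 0" "w T \<notin> sheet" by (auto simp: S_def)
  have after: "w s \<in> sheet" if "s > T" for s
    using cSup_upper[OF _ bdd, of s] that T by (force simp: S_def T_def)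
  have lim: "(w \<longlongrightarrow> w T) (at_right T)"
    using cont T(1) by (auto simp: continuous_on_def intro: tendsto_within_subset)
  have lims: "((\<lambda>s. Re (w s)) \<longlongrightarrow> Re (w T)) (at_right T)" "((\<lambda>s. \<bar>Im (w s)\<bar>) \<longlongrightarrow> \<bar>Im (w T)\<bar>) (at_right T)"
    by (intro tendsto_intros lim)+
  have right: "\<forall>\<^sub>F s in at_right T. s > T" by (simp add: eventually_at_right_less)
  have mono': "Re (Xi (w T)) \<le> Re (Xi (w s))" if "s > T" for s
    using mono_onD[OF mono, of T s] that T(1) by auto
  \<comment> \<open>Points of the sheet with Re w < 0 or |Im w| > pi/2 have Re (Xi w) < 0, and the
    value at T is not larger than the later ones.\<close>
  have neg_if: "Re (Xi (w T)) < 0" if "\<forall>\<^sub>F s in at_right T. Re (w s) < 0 \<or> \<bar>Im (w s)\<bar> > pi / 2"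
  proof -
    have "\<forall>\<^sub>F s in at_right T. Re (Xi (w T)) < 0" using that right
    proof eventually_elim
      case (elim s)
      have "Re (Xi (w s)) < 0" using after[OF elim(2)] elim(1) by (auto simp: sheet_def Re_Xi_sinhc2 mult_less_0_iff)
      thus ?case using mono'[OF elim(2)] by simp
    qed
    thus ?thesis by (simp add: eventually_False trivial_limit_at_right_real)
  qed
  have le: "\<bar>Im (w T)\<bar> \<le> pi"
  proof (rule tendsto_upperbound[OF lims(2)])
    show "\<forall>\<^sub>F s in at_right T. \<bar>Im (w s)\<bar> \<le> pi"
      using right
    proof eventually_elim
      case (elim s)
      show ?case using after[OF elim] pi_gt_zero unfolding sheet_def by (auto simp del: pi_gt_zero)
    qed
  qed (simp add: trivial_limit_at_right_real)
  consider "Re (w T) > 0" | "Re (w T) = 0" | "Re (w T) < 0" by linarith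
  thus False
  proof cases
    case 1
    hence *: "\<bar>Im (w T)\<bar> > pi / 2" "\<bar>Im (w T)\<bar> < pi \<longrightarrow> Re (Xi (w T)) \<ge> 0" using T(2) sheet_pos_iff[OF 1] by auto
    have "\<forall>\<^sub>F s in at_right T. \<bar>Im (w s)\<bar> > pi / 2" using order_tendstoD(1)[OF lims(2) *(1)] .
    hence neg: "Re (Xi (w T)) < 0" by (intro neg_if) (auto elim: eventually_mono)
    hence "\<bar>Im (w T)\<bar> = pi" using * le by auto
    hence "cos (2 * Im (w T)) = 1" using cos_abs_real[of "2 * Im (w T)"] by (simp add: abs_mult)
    thus False using neg 1 sinhc2_ge_1[of "Re (w T)"] by (simp add: Re_Xi_sinhc2 mult_less_0_iff)
  next
    case 2
    hence "\<bar>Im (w T)\<bar> \<ge> pi / 2" using T(2) sheet_zero_iff by force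
    moreover have "\<bar>Im (w T)\<bar> \<noteq> pi / 2"
    proof
      assume "\<bar>Im (w T)\<bar> = pi / 2"
      hence "cos (Im (w T)) = 0" using cos_abs_real[of "Im (w T)"] by (metis cos_pi_half)
      hence "cosh (w T) = 0" by (simp add: complex_eq_iff Re_Im_sinh_cosh 2)
      thus False using nz T(1) by auto
    qed
    ultimately have "\<bar>Im (w T)\<bar> > pi / 2" by simp
    from order_tendstoD(1)[OF lims(2) this]
    have "Re (Xi (w T)) < 0" by (intro neg_if) (auto elim: eventually_mono)
    thus False by (simp add: Re_Xi 2)
  next
    case 3
    have ev3: "\<forall>\<^sub>F s in at_right T. Re (w s) < 0" using order_tendstoD(2)[OF lims(1) 3] .
    hence neg: "Re (Xi (w T)) < 0" by (intro neg_if) (auto elim: eventually_mono)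
    have "\<bar>Im (w T)\<bar> \<le> pi / 2"
    proof (rule tendsto_upperbound[OF lims(2)])
      show "\<forall>\<^sub>F s in at_right T. \<bar>Im (w s)\<bar> \<le> pi / 2"
        using right ev3
      proof eventually_elim
        case (elim s)
        show ?case using after[OF elim(1)] sheet_neg_iff[OF elim(2)] by auto
      qed
    qed (simp add: trivial_limit_at_right_real)
    moreover have "\<not> \<bar>Im (w T)\<bar> < pi / 2" using T(2) neg sheet_neg_iff[OF 3] by auto
    ultimately have "Re (Xi (w T)) = Re (w T) / 2 * (1 - sinhc2 (Re (w T)))" by (intro Re_Xi_imag_half_pi) auto
    moreover have "Re (w T) / 2 * (1 - sinhc2 (Re (w T))) \<ge> 0"
      using 3 sinhc2_ge_1[of "Re (w T)"] by (intro mult_nonpos_nonpos) auto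
    ultimately show False using neg by simp
  qed
qed

lemma eventually_Re_pos_of_sinh:
  assumes "\<forall>\<^sub>F t in at_top. \<bar>Im (w t)\<bar> < pi / 2" "filterlim (\<lambda>t. Re (sinh (w t))) at_top at_top"
  shows "\<forall>\<^sub>F t in at_top. Re (w t) > 0 \<and> \<bar>Im (w t)\<bar> < pi / 2"
proof -
  have "\<forall>\<^sub>F t in at_top. Re (sinh (w t)) > 0" using assms(2) by (simp add: filterlim_at_top_dense)
  thus ?thesis using assms(1)
  proof eventually_elim
    case (elim t)
    have "cos (Im (w t)) > 0" using elim by (intro cos_gt_zero_pi) auto
    thus ?case using elim by (auto simp: Re_Im_sinh_cosh zero_less_mult_iff)
  qed
qed

text \<open>Re (cosh w) > 0 keeps twice the argument of cosh w inside (-pi, pi), so the principal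
  fourth root of (cosh w)^2 is the principal square root of cosh w.\<close>

lemma csqrt_cosh_principal:
  assumes "\<bar>Im w\<bar> < pi / 2"
  shows "(1 + (sinh w)\<^sup>2) powr (1 / 4) = csqrt (cosh w)"
proof -
  have pos: "Re (cosh w) > 0" by (rule cosh_nonzero_off_branch[OF assms])
  hence nz: "cosh w \<noteq> 0" by auto
  have "\<bar>Im (Ln (cosh w))\<bar> < pi / 2" using pos Re_Ln_pos_lt[OF nz] by simp
  hence b: "- pi < Im (2 * Ln (cosh w))" "Im (2 * Ln (cosh w)) \<le> pi" by auto
  have "1 + (sinh w)\<^sup>2 = exp (2 * Ln (cosh w))"
    using nz cosh_square_eq[of w] exp_double[of "Ln (cosh w)"] by simp
  hence "(1 + (sinh w)\<^sup>2) powr (1 / 4) = exp (1 / 4 * (2 * Ln (cosh w)))"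
    using Ln_exp[OF b] by (simp add: powr_def)
  also have "\<dots> = csqrt (cosh w)" using nz by (simp add: csqrt_exp_Ln)
  finally show ?thesis .
qed

text \<open>A root whose square avoids the nonpositive reals never meets the imaginary axis, so its
  real part keeps the sign it has on the tail.\<close>

lemma continuous_sqrt_eq_csqrt:
  fixes q c :: "real \<Rightarrow> complex"
  assumes "continuous_on {0..} q" "\<And>t. t \<ge> 0 \<Longrightarrow> (q t)\<^sup>2 \<notin> \<real>\<^sub>\<le>\<^sub>0" "\<forall>\<^sub>F t in at_top. Re (q t) > 0" "t \<ge> 0"
  shows "q t = csqrt ((q t)\<^sup>2)"
proof -
  have nz: "Re (q s) \<noteq> 0" if "s \<ge> 0" for s
    using assms(2)[OF that] by (auto simp: complex_nonpos_Reals_iff Re_power2 Im_power2)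
  have "Re (q t) > 0"
  proof (rule ccontr)
    assume "\<not> ?thesis"
    hence neg: "Re (q t) \<le> 0" by simp
    obtain B where "\<And>s. s \<ge> B \<Longrightarrow> Re (q s) > 0" using assms(3) by (auto simp: eventually_at_top_linorder)
    hence B: "Re (q (max B t)) \<ge> 0" by (simp add: less_imp_le)
    have "continuous_on {t..max B t} (\<lambda>s. Re (q s))"
      using assms(4) by (intro continuous_intros continuous_on_subset[OF assms(1)]) auto
    from IVT'[OF neg B _ this] obtain x where "x \<ge> t" "Re (q x) = 0" by auto
    thus False using nz[of x] assms(4) by auto
  qed
  thus ?thesis by (intro csqrt_square[symmetric]) auto
qed

text \<open>Solving Xi w = (w + sinh w cosh w) / 2 for w gives 2 X - z r with r = q^2. The
  exponential equation says exp w = z + r, and r^2 = 1 + z^2 gives exp (-w) = r - z.\<close>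

lemma continued_along_lift:
  assumes "continued_along \<gamma> q X" "t \<ge> 0"
  defines "w \<equiv> 2 * X t - \<gamma> t * (q t)\<^sup>2"
  shows "sinh w = \<gamma> t" "cosh w = (q t)\<^sup>2" "X t = Xi w"
proof -
  have q4: "(q t)\<^sup>2 * (q t)\<^sup>2 = 1 + (\<gamma> t)\<^sup>2" and e: "exp w = \<gamma> t + (q t)\<^sup>2"
    using assms(1,2) unfolding w_def continued_along_def by (auto simp: power4_eq_xxxx power2_eq_square algebra_simps)
  have prod: "(\<gamma> t + (q t)\<^sup>2) * ((q t)\<^sup>2 - \<gamma> t) = 1" using q4 by (simp add: algebra_simps power2_eq_square)
  have e': "exp (- w) = (q t)\<^sup>2 - \<gamma> t"
    unfolding exp_minus e by (rule inverse_unique[OF prod])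
  show s: "sinh w = \<gamma> t" and c: "cosh w = (q t)\<^sup>2"
    by (simp_all add: sinh_def cosh_def e e' scaleR_conv_of_real)
  show "X t = Xi w" by (simp add: Xi_eq s c) (simp add: w_def)
qed

text \<open>On the tail the prescribed principal values identify w with \<open>arsinh_pr\<close>;
  from there \<open>stays_in_sheet\<close> works backwards. As sinh is injective on the sheet, q and
  X at the starting point do not depend on the path.\<close>

lemma admissible_lift:
  assumes adm: "admissible_path 2 \<gamma> q X"
  defines "w \<equiv> \<lambda>t. 2 * X t - \<gamma> t * (q t)\<^sup>2"
  assumes t: "t \<ge> 0"
  shows "w t \<in> sheet" "\<gamma> t = sinh (w t)" "q t = csqrt (cosh (w t))" "X t = Xi (w t)"
    "continuous_on {0..} w"
proof -
  have c: "continued_along \<gamma> q X" and mono: "mono_on {0..} (\<lambda>t. Re (X t))"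
    and fl: "filterlim (\<lambda>t. Re (\<gamma> t)) at_top at_top" and ch: "R2_chain \<gamma>"
    and nb: "\<And>t. t \<ge> 0 \<Longrightarrow> \<gamma> t \<noteq> \<i> \<and> \<gamma> t \<noteq> - \<i>"
    using adm by (auto simp: admissible_path_def)
  have lift: "sinh (w t) = \<gamma> t" "cosh (w t) = (q t)\<^sup>2" "X t = Xi (w t)" if "t \<ge> 0" for t
    using continued_along_lift[OF c that] by (simp_all add: w_def)
  have contq: "continuous_on {0..} q" "continuous_on {0..} X" using c by (auto simp: continued_along_def)
  show cont: "continuous_on {0..} w"
    unfolding w_def by (intro continuous_intros contq R2_chain_continuous ch)
  have ev: "\<forall>\<^sub>F t in at_top. Re (w t) > 0 \<and> \<bar>Im (w t)\<bar> < pi / 2"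
  proof -
    have "\<forall>\<^sub>F t in at_top. q t = (1 + (\<gamma> t)\<^sup>2) powr (1 / 4) \<and> X t = xi_bar (\<gamma> t)"
      using c by (auto simp: continued_along_def)
    moreover have "\<forall>\<^sub>F t in at_top. Re (\<gamma> t) > 0" using fl by (simp add: filterlim_at_top_dense)
    ultimately show ?thesis
    proof eventually_elim
      case (elim t)
      note v = arsinh_pr[of "\<gamma> t"]
      have vv: "Re (arsinh_pr (\<gamma> t)) > 0" "\<bar>Im (arsinh_pr (\<gamma> t))\<bar> < pi / 2" using v(5) elim by auto
      have "q t = csqrt (cosh (arsinh_pr (\<gamma> t)))"
        using csqrt_cosh_principal[OF vv(2)] elim v(1) by simp
      hence "(q t)\<^sup>2 = cosh (arsinh_pr (\<gamma> t))" by simp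
      moreover have "X t = Xi (arsinh_pr (\<gamma> t))" using elim v(4) by simp
      ultimately have "w t = arsinh_pr (\<gamma> t)"
        unfolding w_def by (simp add: Xi_eq v(1) add_divide_distrib ring_distribs)
      thus ?case using vv by simp
    qed
  qed
  have sheet: "w t \<in> sheet" if "t \<ge> 0" for t
  proof (rule stays_in_sheet[OF cont _ _ ev that])
    show "cosh (w t) \<noteq> 0" if "t \<ge> 0" for t
    proof
      assume "cosh (w t) = 0"
      hence "(\<gamma> t)\<^sup>2 + 1 = 0" using cosh_square_eq[of "w t"] lift[OF that] by simp
      hence "(\<gamma> t - \<i>) * (\<gamma> t + \<i>) = 0" by (simp add: algebra_simps power2_eq_square)
      hence "\<gamma> t = \<i> \<or> \<gamma> t = - \<i>" unfolding mult_eq_0_iff eq_neg_iff_add_eq_0 by auto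
      thus False using nb[OF that] by blast
    qed
    show "mono_on {0..} (\<lambda>t. Re (Xi (w t)))"
      using mono lift(3) by (auto simp: mono_on_def)
  qed
  show "w t \<in> sheet" "\<gamma> t = sinh (w t)" "X t = Xi (w t)" using sheet lift t by auto
  have "q t = csqrt ((q t)\<^sup>2)"
  proof (rule continuous_sqrt_eq_csqrt[OF contq(1) _ _ t])
    show "(q s)\<^sup>2 \<notin> \<real>\<^sub>\<le>\<^sub>0" if "s \<ge> 0" for s
      using cosh_not_nonpos_on_sheet[OF sheet[OF that]] lift(2)[OF that] by simp
    have "\<forall>\<^sub>F t in at_top. q t = (1 + (\<gamma> t)\<^sup>2) powr (1 / 4)"
      using c by (auto simp: continued_along_def elim: eventually_mono)
    thus "\<forall>\<^sub>F t in at_top. Re (q t) > 0" using ev eventually_ge_at_top[of 0]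
    proof eventually_elim
      case (elim s)
      have "q s = csqrt (cosh (w s))" using elim csqrt_cosh_principal[of "w s"] lift(1)[of s] by simp
      moreover have "Re (cosh (w s)) > 0" using cosh_nonzero_off_branch elim by blast
      ultimately show ?case by (simp add: add_nonneg_pos)
    qed
  qed
  thus "q t = csqrt (cosh (w t))" using lift(2)[OF t] by simp
qed

lemma R2_arc_on_compose_holomorphic:
  assumes w: "R2_arc_on w I" and f: "f holomorphic_on S" "open S" "w ` I \<subseteq> S" "\<And>t. t \<in> I \<Longrightarrow> deriv f (w t) \<noteq> 0"
  shows "R2_arc_on (\<lambda>t. f (w t)) I"
proof -
  from w obtain w' w'' where *: "\<forall>t\<in>I. (w has_vector_derivative w' t) (at t within I)"
    "\<forall>t\<in>I. (w' has_vector_derivative w'' t) (at t within I)" "continuous_on I w''" "\<forall>t\<in>I. w' t \<noteq> 0"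
    unfolding R2_arc_on_def by blast
  note w' = *(1,2)[rule_format] *(3) *(4)[rule_format]
  have cont: "continuous_on I w" "continuous_on I w'"
    using w' by (auto simp: continuous_on_eq_continuous_within intro: has_vector_derivative_continuous)
  have hol: "deriv f holomorphic_on S" "deriv (deriv f) holomorphic_on S"
    by (intro holomorphic_deriv f)+
  have d: "(f has_field_derivative deriv f z) (at z)" "(deriv f has_field_derivative deriv (deriv f) z) (at z)" if "z \<in> S" for z
    using that f hol by (auto intro: holomorphic_derivI)
  have v: "((\<lambda>t. f (w t)) has_vector_derivative w' t * deriv f (w t)) (at t within I)"
    "((\<lambda>t. deriv f (w t)) has_vector_derivative w' t * deriv (deriv f) (w t)) (at t within I)" if "t \<in> I" for t
    using field_vector_diff_chain_within[OF w'(1)[OF that] has_field_derivative_at_within[OF d(1)]]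
      field_vector_diff_chain_within[OF w'(1)[OF that] has_field_derivative_at_within[OF d(2)]] f(3) that
    by (auto simp: o_def)
  show ?thesis unfolding R2_arc_on_def
  proof (intro exI conjI ballI)
    fix t assume t: "t \<in> I"
    show "((\<lambda>t. f (w t)) has_vector_derivative w' t * deriv f (w t)) (at t within I)" by (rule v[OF t])
    show "((\<lambda>t. w' t * deriv f (w t)) has_vector_derivative
       (w' t * (w' t * deriv (deriv f) (w t)) + w'' t * deriv f (w t))) (at t within I)"
      by (rule has_vector_derivative_mult[OF w'(2)[OF t] v(2)[OF t]])
    show "w' t * deriv f (w t) \<noteq> 0" using w'(4) f(4) t by simp
  next
    have "continuous_on I (\<lambda>t. deriv f (w t))" "continuous_on I (\<lambda>t. deriv (deriv f) (w t))"
      using f(3) by (auto intro!: continuous_on_compose2[OF holomorphic_on_imp_continuous_on cont(1)] hol)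
    thus "continuous_on I (\<lambda>t. w' t * (w' t * deriv (deriv f) (w t)) + w'' t * deriv f (w t))"
      using cont w'(3) by (intro continuous_intros)
  qed
qed

lemma R2_chain_map:
  assumes "R2_chain w" "\<And>I. R2_arc_on w I \<Longrightarrow> I \<subseteq> {0..} \<Longrightarrow> R2_arc_on v I"
  shows "R2_chain v"
proof -
  obtain m \<tau> where \<tau>: "\<tau> 0 = 0" "\<And>i. i < m \<Longrightarrow> \<tau> i < \<tau> (Suc i)"
    "\<And>i. i < m \<Longrightarrow> R2_arc_on w {\<tau> i..\<tau> (Suc i)}" "R2_arc_on w {\<tau> m..}"
    using assms(1) by (auto simp: R2_chain_def)
  have nn: "\<tau> i \<ge> 0" if "i \<le> m" for i using breakpoints_mono[of m \<tau> 0 i] \<tau> that by auto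
  show ?thesis unfolding R2_chain_def
  proof (intro exI[of _ m] exI[of _ \<tau>] conjI allI impI)
    fix i assume i: "i < m"
    show "R2_arc_on v {\<tau> i..\<tau> (Suc i)}"
      using nn[of i] i by (intro assms(2) \<tau>) auto
  next
    show "R2_arc_on v {\<tau> m..}" using nn[of m] by (intro assms(2) \<tau>) auto
  qed (use \<tau> in auto)
qed

lemma R2_chain_sinh:
  assumes "R2_chain w" "\<And>t. t \<ge> 0 \<Longrightarrow> cosh (w t) \<noteq> 0"
  shows "R2_chain (\<lambda>t. sinh (w t))"
proof (rule R2_chain_map[OF assms(1)])
  have d: "(sinh has_field_derivative cosh z) (at z)" for z :: complex
    using has_field_derivative_sinh[OF DERIV_ident, of z] by simp
  have dsinh: "deriv sinh z = cosh z" for z :: complex by (rule DERIV_imp_deriv[OF d])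
  have hol: "sinh holomorphic_on (UNIV :: complex set)"
    unfolding holomorphic_on_open[OF open_UNIV] using d by blast
  show "R2_arc_on (\<lambda>t. sinh (w t)) I" if "R2_arc_on w I" "I \<subseteq> {0..}" for I
    by (rule R2_arc_on_compose_holomorphic[OF that(1), of sinh UNIV])
       (use that(2) assms(2) hol in \<open>auto simp: dsinh\<close>)
qed

lemma lifted_path_in_sheet: "lifted_path w \<Longrightarrow> t \<ge> 0 \<Longrightarrow> w t \<in> sheet"
  unfolding lifted_path_def by (intro stays_in_sheet eventually_Re_pos_of_sinh) auto

text \<open>Inside the sheet cosh w never meets the cut of csqrt, so \<open>csqrt (cosh w)\<close>
  is the continued q; the tail in the strip supplies the principal values.\<close>

lemma admissible_of_lifted_path:
  assumes w: "lifted_path w"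
  shows "admissible_path 2 (\<lambda>t. sinh (w t)) (\<lambda>t. csqrt (cosh (w t))) (\<lambda>t. Xi (w t))"
proof -
  have cont: "continuous_on {0..} w" and nz: "\<And>t. t \<ge> 0 \<Longrightarrow> cosh (w t) \<noteq> 0" using w by (auto simp: lifted_path_def)
  have sheet: "w t \<in> sheet" if "t \<ge> 0" for t using lifted_path_in_sheet[OF w that] .
  have nb: "sinh (w t) \<noteq> \<i> \<and> sinh (w t) \<noteq> - \<i>" if "t \<ge> 0" for t
    using sinh_sheet_not_exceptional[OF sheet[OF that]] by auto
  have "continued_along (\<lambda>t. sinh (w t)) (\<lambda>t. csqrt (cosh (w t))) (\<lambda>t. Xi (w t))"
    unfolding continued_along_def
  proof (intro conjI allI impI)
    show "continuous_on {0..} (\<lambda>t. csqrt (cosh (w t)))"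
      using cosh_not_nonpos_on_sheet sheet
      by (intro continuous_on_compose2[OF continuous_on_csqrt] continuous_intros cont) auto
    show "continuous_on {0..} (\<lambda>t. Xi (w t))" unfolding Xi_def by (intro continuous_intros cont) auto
  next
    fix t :: real assume "t \<ge> 0"
    have "csqrt (cosh (w t)) ^ 4 = csqrt (cosh (w t)) ^ 2 * csqrt (cosh (w t)) ^ 2"
      by (simp only: power4_eq_xxxx power2_eq_square mult.assoc)
    hence "csqrt (cosh (w t)) ^ 4 = (cosh (w t))\<^sup>2" by (simp add: power2_eq_square[of "cosh _"])
    thus "csqrt (cosh (w t)) ^ 4 = 1 + (sinh (w t))\<^sup>2" by (simp add: cosh_square_eq)
    show "exp (2 * Xi (w t) - sinh (w t) * (csqrt (cosh (w t)))\<^sup>2) = sinh (w t) + (csqrt (cosh (w t)))\<^sup>2"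
      by (simp add: Xi_eq sinh_plus_cosh add_divide_distrib)
  next
    have "\<forall>\<^sub>F t in at_top. \<bar>Im (w t)\<bar> < pi / 2" using w by (auto simp: lifted_path_def)
    thus "\<forall>\<^sub>F t in at_top. csqrt (cosh (w t)) = (1 + (sinh (w t))\<^sup>2) powr (1 / 4) \<and> Xi (w t) = xi_bar (sinh (w t))"
      by eventually_elim (auto simp: csqrt_cosh_principal principal_sinh)
  qed
  thus ?thesis using w nb R2_chain_sinh[of w] by (auto simp: admissible_path_def lifted_path_def)
qed

subsection \<open>Construction of admissible paths\<close>

definition reach :: "complex \<Rightarrow> bool" where
  "reach z \<longleftrightarrow> (\<exists>w. lifted_path w \<and> w 0 = z)"

lemma R2_arc_on_cong:
  assumes "R2_arc_on \<gamma> I" "\<And>t. t \<in> I \<Longrightarrow> \<gamma> t = \<delta> t"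
  shows "R2_arc_on \<delta> I"
proof -
  obtain \<gamma>' \<gamma>'' where g: "\<forall>t\<in>I. (\<gamma> has_vector_derivative \<gamma>' t) (at t within I)"
    "\<forall>t\<in>I. (\<gamma>' has_vector_derivative \<gamma>'' t) (at t within I)" "continuous_on I \<gamma>''" "\<forall>t\<in>I. \<gamma>' t \<noteq> 0"
    using assms(1) unfolding R2_arc_on_def by blast
  have "\<forall>t\<in>I. (\<delta> has_vector_derivative \<gamma>' t) (at t within I)"
    using g(1) assms(2) by (auto intro: has_vector_derivative_transform[rotated -1])
  thus ?thesis using g unfolding R2_arc_on_def by blast
qed

lemma R2_arc_on_shift:
  assumes "R2_arc_on \<gamma> I"
  shows "R2_arc_on (\<lambda>t. \<gamma> (t - l)) ((\<lambda>t. t + l) ` I)"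
proof -
  from assms obtain \<gamma>' \<gamma>'' where *: "\<forall>t\<in>I. (\<gamma> has_vector_derivative \<gamma>' t) (at t within I)"
    "\<forall>t\<in>I. (\<gamma>' has_vector_derivative \<gamma>'' t) (at t within I)" "continuous_on I \<gamma>''" "\<forall>t\<in>I. \<gamma>' t \<noteq> 0"
    unfolding R2_arc_on_def by blast
  note g = *(1,2)[rule_format] *(3) *(4)[rule_format]
  have im: "(\<lambda>t. t - l) ` (\<lambda>t. t + l) ` I = I" by (auto simp: image_image)
  have *: "((\<lambda>t. f (t - l)) has_vector_derivative f') (at t within (\<lambda>t. t + l) ` I)"
    if "(f has_vector_derivative f') (at (t - l) within I)" for f :: "real \<Rightarrow> complex" and f' t
  proof -
    have "((f \<circ> (\<lambda>t. t - l)) has_vector_derivative 1 *\<^sub>R f') (at t within (\<lambda>t. t + l) ` I)"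
      by (rule vector_diff_chain_within) (use that in \<open>auto simp: im intro!: derivative_eq_intros\<close>)
    thus ?thesis by (simp add: o_def)
  qed
  show ?thesis unfolding R2_arc_on_def
    by (rule exI[of _ "\<lambda>t. \<gamma>' (t - l)"], rule exI[of _ "\<lambda>t. \<gamma>'' (t - l)"])
       (use g in \<open>auto intro!: * continuous_on_compose2[OF g(3)] continuous_intros\<close>)
qed

text \<open>Paths are built backwards from infinity: the new arc occupies [0, l] and the old path is
  delayed by l. The junction becomes a breakpoint, so a corner there is allowed.\<close>

lemma reach_prepend:
  assumes l: "l > 0" and arc: "R2_arc_on \<delta> {0..l}" and nz: "\<And>t. t \<in> {0..l} \<Longrightarrow> cosh (\<delta> t) \<noteq> 0"
    and mono: "mono_on {0..l} (\<lambda>t. Re (Xi (\<delta> t)))" and reach: "reach (\<delta> l)"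
  shows "reach (\<delta> 0)"
proof -
  obtain w where w: "lifted_path w" "w 0 = \<delta> l" using reach by (auto simp: reach_def)
  define v where "v t = (if t \<le> l then \<delta> t else w (t - l))" for t
  have v1: "v t = \<delta> t" if "t \<le> l" for t using that by (simp add: v_def)
  have v2: "v t = w (t - l)" if "t \<ge> l" for t using that w(2) by (cases "t = l") (auto simp: v_def)
  have shift: "filterlim (\<lambda>t::real. t - l) at_top at_top" by real_asymp
  have tl: "\<forall>\<^sub>F t in at_top. v t = w (t - l)" using eventually_ge_at_top[of l] by eventually_elim (rule v2)
  obtain m \<tau> where \<tau>: "\<tau> 0 = 0" "\<And>i. i < m \<Longrightarrow> \<tau> i < \<tau> (Suc i)"
    "\<And>i. i < m \<Longrightarrow> R2_arc_on w {\<tau> i..\<tau> (Suc i)}" "R2_arc_on w {\<tau> m..}"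
    using w(1) by (auto simp: lifted_path_def R2_chain_def)
  have nn: "\<tau> i \<ge> 0" if "i \<le> m" for i using breakpoints_mono[of m \<tau> 0 i] \<tau> that by auto
  have "lifted_path v" unfolding lifted_path_def
  proof (intro conjI allI impI)
    show chain: "R2_chain v" unfolding R2_chain_def
    proof (intro exI[of _ "Suc m"] exI[of _ "\<lambda>i. case i of 0 \<Rightarrow> 0 | Suc j \<Rightarrow> \<tau> j + l"] conjI allI impI)
      fix i assume i: "i < Suc m"
      show "(case i of 0 \<Rightarrow> 0 | Suc j \<Rightarrow> \<tau> j + l) < (case Suc i of 0 \<Rightarrow> 0 | Suc j \<Rightarrow> \<tau> j + l)"
        using i \<tau>(1,2) l by (auto split: nat.splits)
      show "R2_arc_on v {(case i of 0 \<Rightarrow> 0 | Suc j \<Rightarrow> \<tau> j + l)..(case Suc i of 0 \<Rightarrow> 0 | Suc j \<Rightarrow> \<tau> j + l)}"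
      proof (cases i)
        case 0
        thus ?thesis using R2_arc_on_cong[OF arc] v1 \<tau>(1) by simp
      next
        case (Suc j)
        have "R2_arc_on (\<lambda>t. w (t - l)) {\<tau> j + l..\<tau> (Suc j) + l}"
          using R2_arc_on_shift[OF \<tau>(3)[of j], of l] Suc i by simp
        hence "R2_arc_on v {\<tau> j + l..\<tau> (Suc j) + l}"
          by (rule R2_arc_on_cong) (use nn[of j] Suc i v2 in auto)
        thus ?thesis by (simp add: Suc)
      qed
    next
      have "(\<lambda>t. t + l) ` {\<tau> m..} = {\<tau> m + l..}"
        by (auto intro!: image_eqI[of _ _ "_ - l"])
      hence "R2_arc_on (\<lambda>t. w (t - l)) {\<tau> m + l..}"
        using R2_arc_on_shift[OF \<tau>(4), of l] by simp
      thus "R2_arc_on v {(case Suc m of 0 \<Rightarrow> 0 | Suc j \<Rightarrow> \<tau> j + l)..}"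
        unfolding nat.case by (rule R2_arc_on_cong) (use nn[of m] v2 in auto)
    qed simp
    show "continuous_on {0..} v" by (rule R2_chain_continuous[OF chain])
    show "cosh (v t) \<noteq> 0" if "t \<ge> 0" for t
      using nz[of t] w(1) that by (cases "t \<le> l") (auto simp: v_def lifted_path_def)
    have wm: "mono_on {0..} (\<lambda>t. Re (Xi (w t)))" using w(1) by (simp add: lifted_path_def)
    show "mono_on {0..} (\<lambda>t. Re (Xi (v t)))"
    proof (rule mono_onI)
      fix r s :: real assume rs: "r \<in> {0..}" "s \<in> {0..}" "r \<le> s"
      have A: "Re (Xi (\<delta> r)) \<le> Re (Xi (\<delta> s))" if "s \<le> l" using mono_onD[OF mono, of r s] rs that by auto
      have B: "Re (Xi (w (r - l))) \<le> Re (Xi (w (s - l)))" if "r \<ge> l" using mono_onD[OF wm, of "r - l" "s - l"] rs that by auto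
      show "Re (Xi (v r)) \<le> Re (Xi (v s))"
      proof (cases "s \<le> l \<or> r \<ge> l")
        case True
        thus ?thesis using A B rs v1[of r] v1[of s] v2[of r] v2[of s] by auto
      next
        case False
        have "Re (Xi (\<delta> r)) \<le> Re (Xi (\<delta> l))" using mono_onD[OF mono, of r l] rs False by auto
        also have "\<dots> \<le> Re (Xi (w (s - l)))" using mono_onD[OF wm, of 0 "s - l"] False w(2) by auto
        finally show ?thesis using False v1[of r] v2[of s] by auto
      qed
    qed
    have "\<forall>\<^sub>F t in at_top. \<bar>Im (w t)\<bar> < pi / 2" "filterlim (\<lambda>t. Re (sinh (w t))) at_top at_top"
      using w(1) by (auto simp: lifted_path_def)
    note e = this(1)[THEN eventually_compose_filterlim, OF shift] filterlim_compose[OF this(2) shift]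
    show "\<forall>\<^sub>F t in at_top. \<bar>Im (v t)\<bar> < pi / 2" using e(1) tl by eventually_elim simp
    have "\<forall>\<^sub>F t in at_top. Re (sinh (w (t - l))) = Re (sinh (v t))" using tl by eventually_elim simp
    thus "filterlim (\<lambda>t. Re (sinh (v t))) at_top at_top" using e(2) by (simp cong: filterlim_cong)
  qed
  moreover have "v 0 = \<delta> 0" using l by (simp add: v_def)
  ultimately show ?thesis by (auto simp: reach_def)
qed

lemma R2_arc_on_line: "c \<noteq> 0 \<Longrightarrow> R2_arc_on (\<lambda>t. a + of_real t * c) I"
  unfolding R2_arc_on_def
  by (rule exI[of _ "\<lambda>_. c"], rule exI[of _ "\<lambda>_. 0"]) (auto intro!: derivative_eq_intros)

text \<open>Reduces the construction of paths to Im z >= 0.\<close>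

lemma reach_cnj:
  assumes "reach z"
  shows "reach (cnj z)"
proof -
  obtain w where w: "lifted_path w" "w 0 = z" using assms by (auto simp: reach_def)
  have arc: "R2_arc_on (\<lambda>t. cnj (w t)) I" if "R2_arc_on w I" for I
  proof -
    from that obtain \<gamma>' \<gamma>'' where g: "\<forall>t\<in>I. (w has_vector_derivative \<gamma>' t) (at t within I)"
      "\<forall>t\<in>I. (\<gamma>' has_vector_derivative \<gamma>'' t) (at t within I)" "continuous_on I \<gamma>''" "\<forall>t\<in>I. \<gamma>' t \<noteq> 0"
      unfolding R2_arc_on_def by blast
    show ?thesis unfolding R2_arc_on_def
      by (rule exI[of _ "\<lambda>t. cnj (\<gamma>' t)"], rule exI[of _ "\<lambda>t. cnj (\<gamma>'' t)"])
         (use g in \<open>auto intro!: has_vector_derivative_cnj continuous_on_cnj\<close>)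
  qed
  have eq: "Re (Xi (cnj v)) = Re (Xi v)" "Re (sinh (cnj v)) = Re (sinh v)" for v
    by (simp_all add: Re_Xi Re_Im_sinh_cosh)
  have nz: "cosh (cnj v) = 0 \<longleftrightarrow> cosh v = 0" for v
    by (simp add: complex_eq_iff Re_Im_sinh_cosh)
  have "lifted_path (\<lambda>t. cnj (w t))"
    using w(1) arc unfolding lifted_path_def R2_chain_def eq nz by (auto intro!: continuous_on_cnj) blast
  thus ?thesis using w(2) by (auto simp: reach_def)
qed

lemma has_vector_derivative_iff_quotient:
  fixes w :: "real \<Rightarrow> complex"
  shows "(w has_vector_derivative d) (at t within I) \<longleftrightarrow> ((\<lambda>s. (w s - w t) / of_real (s - t)) \<longlongrightarrow> d) (at t within I)"
proof -
  have "(w has_vector_derivative d) (at t within I) \<longleftrightarrow>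
      ((\<lambda>s. norm (w s - w t - (s - t) *\<^sub>R d) / norm (s - t)) \<longlongrightarrow> 0) (at t within I)"
    unfolding has_vector_derivative_def has_derivative_iff_norm by (simp add: bounded_linear_scaleR_left)
  also have "\<dots> \<longleftrightarrow> ((\<lambda>s. norm ((w s - w t) / of_real (s - t) - d)) \<longlongrightarrow> 0) (at t within I)"
  proof (rule filterlim_cong[OF refl refl])
    have "norm (w s - w t - (s - t) *\<^sub>R d) / norm (s - t) = norm ((w s - w t) / of_real (s - t) - d)" if "s \<noteq> t" for s
    proof -
      have "(w s - w t) / of_real (s - t) - d = (w s - w t - (s - t) *\<^sub>R d) / of_real (s - t)"
        using that by (simp add: field_simps scaleR_conv_of_real del: of_real_diff)
      thus ?thesis by (simp add: norm_divide del: of_real_diff)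
    qed
    thus "\<forall>\<^sub>F s in at t within I. norm (w s - w t - (s - t) *\<^sub>R d) / norm (s - t) = norm ((w s - w t) / of_real (s - t) - d)"
      by (simp add: eventually_at_filter)
  qed
  also have "\<dots> \<longleftrightarrow> ((\<lambda>s. (w s - w t) / of_real (s - t)) \<longlongrightarrow> d) (at t within I)"
    unfolding tendsto_norm_zero_iff by (rule LIM_zero_iff)
  finally show ?thesis .
qed

text \<open>Caratheodory's factorization f z - f (w t) = g z (z - w t) turns the difference quotient
  of w into that of h divided by g (w s), so a continuous lift is differentiable without an inverse
  of f being constructed.\<close>

lemma has_vector_derivative_local_inverse:
  fixes w h :: "real \<Rightarrow> complex"
  assumes f: "(f has_field_derivative D) (at (w t))" "D \<noteq> 0"
    and w: "continuous (at t within I) w"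
    and h: "(h has_vector_derivative h') (at t within I)" "\<And>s. s \<in> I \<Longrightarrow> f (w s) = h s" and t: "t \<in> I"
  shows "(w has_vector_derivative h' / D) (at t within I)"
proof -
  obtain g where g: "\<And>z. f z - f (w t) = g z * (z - w t)" "isCont g (w t)" "g (w t) = D"
    using f(1) unfolding CARAT_DERIV by blast
  have gl: "((\<lambda>s. g (w s)) \<longlongrightarrow> D) (at t within I)"
    using isCont_tendsto_compose[OF g(2)] w g(3) by (auto simp: continuous_within)
  have "((\<lambda>s. (h s - h t) / of_real (s - t) / g (w s)) \<longlongrightarrow> h' / D) (at t within I)"
    using h(1) unfolding has_vector_derivative_iff_quotient by (rule tendsto_divide[OF _ gl f(2)])
  moreover have "\<forall>\<^sub>F s in at t within I. (h s - h t) / of_real (s - t) / g (w s) = (w s - w t) / of_real (s - t)"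
  proof -
    have "\<forall>\<^sub>F s in at t within I. g (w s) \<noteq> 0" using tendsto_imp_eventually_ne[OF gl f(2)] .
    moreover have "\<forall>\<^sub>F s in at t within I. s \<in> I" by (simp add: eventually_at_filter)
    ultimately show ?thesis
    proof eventually_elim
      case (elim s)
      have "h s - h t = g (w s) * (w s - w t)" using g(1)[of "w s"] h(2)[of s] h(2)[OF t] elim by simp
      thus ?case using elim by simp
    qed
  qed
  ultimately show ?thesis
    unfolding has_vector_derivative_iff_quotient by (rule Lim_transform_eventually)
qed

text \<open>Over a vertical segment of the xi plane Re (Xi) is constant, hence monotone. Away from
  the branch points the lifted curve is smooth, with nonvanishing velocity i k / cosh^2.\<close>

lemma reach_vertical_xi:
  assumes cont: "continuous_on {0..l} \<delta>" and l: "l > 0" and k: "k \<noteq> 0"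
    and Xi: "\<And>t. t \<in> {0..l} \<Longrightarrow> Xi (\<delta> t) = a + of_real t * (\<i> * of_real k)"
    and nz: "\<And>t. t \<in> {0..l} \<Longrightarrow> cosh (\<delta> t) \<noteq> 0" and reach: "reach (\<delta> l)"
  shows "reach (\<delta> 0)"
proof (rule reach_prepend[where \<delta> = \<delta>, OF l _ nz _ reach])
  define D where "D t = (\<i> * of_real k) / (cosh (\<delta> t))\<^sup>2" for t
  have dd: "(\<delta> has_vector_derivative D t) (at t within {0..l})" if "t \<in> {0..l}" for t
    unfolding D_def
  proof (rule has_vector_derivative_local_inverse[where f = Xi])
    show "(Xi has_field_derivative (cosh (\<delta> t))\<^sup>2) (at (\<delta> t))" by (rule has_field_derivative_Xi)
    show "((\<lambda>t. a + of_real t * (\<i> * of_real k)) has_vector_derivative (\<i> * of_real k)) (at t within {0..l})"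
      by (auto intro!: derivative_eq_intros)
  qed (use nz that Xi cont in \<open>auto simp: continuous_on_eq_continuous_within\<close>)
  define D2 where "D2 t = - 2 * D t * (\<i> * of_real k) * sinh (\<delta> t) / (cosh (\<delta> t)) ^ 3" for t
  have dD: "(D has_vector_derivative D2 t) (at t within {0..l})" if "t \<in> {0..l}" for t
  proof -
    have "((\<lambda>z. (\<i> * of_real k) / (cosh z)\<^sup>2) has_field_derivative - 2 * (\<i> * of_real k) * sinh (\<delta> t) / (cosh (\<delta> t)) ^ 3)
       (at (\<delta> t) within \<delta> ` {0..l})"
      using nz[OF that] by (auto intro!: derivative_eq_intros simp: power2_eq_square power3_eq_cube mult_ac)
    from field_vector_diff_chain_within[OF dd[OF that] this]
    show ?thesis by (simp add: D_def[abs_def] D2_def o_def mult_ac)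
  qed
  show "R2_arc_on \<delta> {0..l}"
    unfolding R2_arc_on_def
  proof (rule exI[of _ D], rule exI[of _ D2], intro conjI ballI dd dD)
    have "continuous_on {0..l} D"
      unfolding continuous_on_eq_continuous_within by (intro ballI has_vector_derivative_continuous[OF dD])
    thus "continuous_on {0..l} D2" unfolding D2_def using nz by (intro continuous_intros cont) auto
    show "D t \<noteq> 0" if "t \<in> {0..l}" for t using nz[OF that] k by (simp add: D_def)
  qed auto
  show "mono_on {0..l} (\<lambda>t. Re (Xi (\<delta> t)))"
    by (rule mono_onI) (simp add: Xi)
qed

text \<open>A level curve on which Im (Xi) is strictly monotone is reparametrised by k Im (Xi). Its
  image is then a vertical segment, so regularity comes from \<open>reach_vertical_xi\<close> and
  \<delta> need only be continuous.\<close>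

lemma reach_level_arc:
  fixes c d :: real
  assumes cd: "c < d" and cont: "continuous_on {c..d} \<delta>" and Re: "\<And>t. t \<in> {c..d} \<Longrightarrow> Re (Xi (\<delta> t)) = r"
    and inc: "\<And>s t. c \<le> s \<Longrightarrow> s < t \<Longrightarrow> t \<le> d \<Longrightarrow> k * Im (Xi (\<delta> s)) < k * Im (Xi (\<delta> t))" and k: "k = 1 \<or> k = - 1"
    and nz: "\<And>t. t \<in> {c..d} \<Longrightarrow> cosh (\<delta> t) \<noteq> 0" and reach: "reach (\<delta> d)"
  shows "reach (\<delta> c)"
proof -
  define f where "f t = k * Im (Xi (\<delta> t))" for t
  have fc: "continuous_on {c..d} f" unfolding f_def Xi_def by (intro continuous_intros cont) auto
  have inj: "inj_on f {c..d}"
  proof (rule inj_onI)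
    fix x y assume xy: "x \<in> {c..d}" "y \<in> {c..d}" "f x = f y"
    show "x = y" using inc[of x y] inc[of y x] xy by (cases x y rule: linorder_cases) (auto simp: f_def)
  qed
  define g where "g = inv_into {c..d} f"
  have gf: "g (f t) = t" if "t \<in> {c..d}" for t unfolding g_def using inj that by (rule inv_into_f_f)
  have gc: "continuous_on (f ` {c..d}) g" by (rule continuous_on_inv[OF fc]) (auto simp: gf)
  have im: "{f c..f d} \<subseteq> f ` {c..d}"
  proof
    fix y assume y: "y \<in> {f c..f d}"
    obtain x where "c \<le> x" "x \<le> d" "f x = y" using IVT'[of f c y d] y cd fc by auto
    thus "y \<in> f ` {c..d}" by auto
  qed
  define l where "l = f d - f c"
  have l: "l > 0" using inc[of c d] cd by (simp add: l_def f_def)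
  define \<epsilon> where "\<epsilon> t = \<delta> (g (f c + t))" for t
  have mem: "f c + t \<in> f ` {c..d}" if "t \<in> {0..l}" for t using that im by (auto simp: l_def)
  have gm: "g (f c + t) \<in> {c..d}" "f (g (f c + t)) = f c + t" if "t \<in> {0..l}" for t
    unfolding g_def using mem[OF that] by (auto intro: inv_into_into f_inv_into_f simp del: atLeastAtMost_iff)
  have "reach (\<epsilon> 0)"
  proof (rule reach_vertical_xi[OF _ l])
    show "continuous_on {0..l} \<epsilon>" unfolding \<epsilon>_def
      using mem gm(1)
      by (intro continuous_on_compose2[OF cont] continuous_on_compose2[OF gc] continuous_intros image_subsetI) auto
    show "k \<noteq> 0" using k by auto
    fix t assume t: "t \<in> {0..l}"
    have "k * Im (Xi (\<epsilon> t)) = f c + t" using gm(2)[OF t] by (simp add: f_def \<epsilon>_def)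
    hence "Im (Xi (\<epsilon> t)) = k * (f c + t)" using k by auto
    thus "Xi (\<epsilon> t) = Complex r (k * f c) + of_real t * (\<i> * of_real k)"
      using Re[OF gm(1)[OF t]] by (simp add: complex_eq_iff \<epsilon>_def algebra_simps)
    show "cosh (\<epsilon> t) \<noteq> 0" using nz[OF gm(1)[OF t]] by (simp add: \<epsilon>_def)
  next
    have "\<epsilon> l = \<delta> d" using gf[of d] cd by (simp add: \<epsilon>_def l_def)
    thus "reach (\<epsilon> l)" using reach by simp
  qed
  moreover have "\<epsilon> 0 = \<delta> c" using gf[of c] cd by (simp add: \<epsilon>_def)
  ultimately show ?thesis by simp
qed

text \<open>On the graph, constancy of Re (Xi) ties the slope b to C = cosh^2 and makes the
  derivative of Im (Xi) equal to Im C (1 + b^2), with Im C = sinh (2 t) sin (2 B t) / 2 < 0. Level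
  curves may be followed both ways, hence the equivalence. Differentiability is asked in the
  interior only, as arccos is not differentiable at 1.\<close>

lemma reach_graph_arc:
  assumes cd: "c < d" and cont: "continuous_on {c..d} B" and Re: "\<And>t. t \<in> {c..d} \<Longrightarrow> Re (Xi (Complex t (B t))) = r"
    and diff: "\<And>t. c < t \<Longrightarrow> t < d \<Longrightarrow> B differentiable (at t)"
    and neg: "\<And>t. c < t \<Longrightarrow> t < d \<Longrightarrow> sinh (2 * t) * sin (2 * B t) < 0"
    and nz: "\<And>t. t \<in> {c..d} \<Longrightarrow> cosh (Complex t (B t)) \<noteq> 0"
  shows "reach (Complex d (B d)) \<longleftrightarrow> reach (Complex c (B c))"
proof -
  define \<delta> where "\<delta> t = Complex t (B t)" for t
  have contd: "continuous_on {c..d} \<delta>" unfolding \<delta>_def by (intro continuous_on_Complex continuous_intros cont)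
  define f where "f t = Im (Xi (\<delta> t))" for t
  have fc: "continuous_on {c..d} f" unfolding f_def Xi_def by (intro continuous_intros contd) auto
  have dec: "f s > f t" if st: "c \<le> s" "s < t" "t \<le> d" for s t
  proof (rule DERIV_neg_imp_decreasing_open[OF st(2)])
    show "continuous_on {s..t} f" by (rule continuous_on_subset[OF fc]) (use st in auto)
    fix x assume x: "s < x" "x < t"
    hence x': "c < x" "x < d" using st by auto
    obtain b where b: "(B has_real_derivative b) (at x)" using diff[OF x'] by (auto simp: real_differentiable_def)
    have dd: "(\<delta> has_vector_derivative Complex 1 b) (at x)"
    proof -
      have "((\<lambda>t. of_real t + \<i> * of_real (B t)) has_vector_derivative (of_real 1 + \<i> * of_real b)) (at x)"
        by (intro has_vector_derivative_add has_vector_derivative_mult_right has_vector_derivative_of_real b DERIV_ident)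
      thus ?thesis by (simp add: \<delta>_def[abs_def] Complex_eq)
    qed
    define C where "C = (cosh (\<delta> x))\<^sup>2"
    have dX: "((\<lambda>t. Xi (\<delta> t)) has_vector_derivative Complex 1 b * C) (at x)"
      using field_vector_diff_chain_within[OF dd has_field_derivative_Xi] by (simp add: o_def C_def)
    have dRe: "((\<lambda>t. Re (Xi (\<delta> t))) has_real_derivative Re C - b * Im C) (at x)"
      and dIm: "(f has_real_derivative Im C + b * Re C) (at x)"
      using bounded_linear.has_vector_derivative[OF bounded_linear_Re dX] bounded_linear.has_vector_derivative[OF bounded_linear_Im dX]
      unfolding f_def[abs_def] has_real_derivative_iff_has_vector_derivative by simp_all
    have "((\<lambda>t. Re (Xi (\<delta> t))) has_real_derivative 0) (at x)"
    proof -
      have "\<forall>\<^sub>F t in nhds x. t \<in> {c<..<d}" using x' by (intro eventually_nhds_in_open) auto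
      hence "\<forall>\<^sub>F t in nhds x. Re (Xi (\<delta> t)) = r" by eventually_elim (auto simp: \<delta>_def Re)
      thus ?thesis by (subst DERIV_cong_ev[OF refl _ refl, of _ "\<lambda>_. r"]) auto
    qed
    hence 0: "Re C = b * Im C" using DERIV_unique[OF dRe] by force
    have ImC: "Im C < 0"
    proof -
      have "Im C = sinh (2 * x) * sin (2 * B x) / 2"
        by (simp add: C_def \<delta>_def Im_power2 Re_Im_sinh_cosh sinh_double sin_double)
      thus ?thesis using neg[OF x'] by simp
    qed
    have "Im C + b * Re C = Im C * (1 + b\<^sup>2)" unfolding 0 by (simp add: algebra_simps power2_eq_square)
    also have "\<dots> < 0" using ImC by (intro mult_neg_pos) (auto intro: add_pos_nonneg)
    finally show "\<exists>y. (f has_real_derivative y) (at x) \<and> y < 0" using dIm by blast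
  qed
  have one: "reach (\<delta> c)" if "reach (\<delta> d)"
    by (rule reach_level_arc[OF cd contd, of r "- 1"]) (use Re nz dec that in \<open>auto simp: \<delta>_def f_def\<close>)
  have two: "reach (\<delta> d)" if r: "reach (\<delta> c)"
  proof -
    define \<epsilon> where "\<epsilon> t = \<delta> (- t)" for t
    have "reach (\<epsilon> (- d))"
    proof (rule reach_level_arc[of "- d" "- c" \<epsilon> r 1])
      show "continuous_on {- d..- c} \<epsilon>" unfolding \<epsilon>_def
        by (intro continuous_on_compose2[OF contd] continuous_intros) auto
      show "1 * Im (Xi (\<epsilon> s)) < 1 * Im (Xi (\<epsilon> t))" if "- d \<le> s" "s < t" "t \<le> - c" for s t
        using dec[of "- t" "- s"] that by (simp add: \<epsilon>_def f_def)
    qed (use cd Re nz r in \<open>auto simp: \<epsilon>_def \<delta>_def\<close>)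
    thus ?thesis by (simp add: \<epsilon>_def)
  qed
  show ?thesis using one two by (auto simp: \<delta>_def)
qed

text \<open>Here cos (2 Im z) >= 0, so Re (Xi) increases along the horizontal ray to the
  right.\<close>

lemma reach_horizontal:
  assumes b: "\<bar>Im z\<bar> \<le> pi / 4"
  shows "reach z"
proof -
  define w where "w t = z + of_real t * 1" for t :: real
  have b2: "\<bar>Im z\<bar> < pi / 2" using b pi_gt_zero by linarith
  have cos: "cos (Im z) > 0" "cos (2 * Im z) \<ge> 0" using b2 b by (auto intro!: cos_gt_zero_pi cos_ge_zero)
  have "lifted_path w" unfolding lifted_path_def
  proof (intro conjI allI impI)
    show "continuous_on {0..} w" unfolding w_def by (intro continuous_intros)
    show "R2_chain w" unfolding R2_chain_def w_def
      by (intro exI[of _ 0] exI[of _ "\<lambda>_. 0"]) (auto intro!: R2_arc_on_line[of 1, simplified])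
    show "cosh (w t) \<noteq> 0" for t using cosh_nonzero_off_branch[of "w t"] b2 by (auto simp: w_def)
    show "mono_on {0..} (\<lambda>t. Re (Xi (w t)))"
      using cos by (intro mono_onI) (auto simp: Re_Xi w_def intro!: add_mono divide_right_mono mult_right_mono)
    have "filterlim (\<lambda>t. sinh (Re z + t) * cos (Im z)) at_top at_top"
      using cos(1) by real_asymp
    thus "filterlim (\<lambda>t. Re (sinh (w t))) at_top at_top" by (simp add: Re_Im_sinh_cosh w_def)
  qed (use b2 in \<open>simp add: w_def\<close>)
  moreover have "w 0 = z" by (simp add: w_def)
  ultimately show ?thesis by (auto simp: reach_def)
qed

text \<open>For Re z >= 0, lowering the imaginary part to pi/4 increases cos (2 Im w) and with it Re
  (Xi w); from there the horizontal ray leads on.\<close>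

lemma reach_vertical:
  assumes "Re z \<ge> 0" "0 \<le> Im z" "Im z \<le> pi / 2" "cosh z \<noteq> 0"
  shows "reach z"
proof (cases "Im z \<le> pi / 4")
  case True
  thus ?thesis using assms by (intro reach_horizontal) auto
next
  case False
  define l where "l = Im z - pi / 4"
  define \<delta> where "\<delta> t = z + of_real t * (- \<i>)" for t :: real
  have \<delta>: "Re (\<delta> t) = Re z" "Im (\<delta> t) = Im z - t" for t by (simp_all add: \<delta>_def)
  have "reach (\<delta> 0)"
  proof (rule reach_prepend)
    show "l > 0" using False by (simp add: l_def)
    show "R2_arc_on \<delta> {0..l}" unfolding \<delta>_def by (rule R2_arc_on_line) simp
    show "cosh (\<delta> t) \<noteq> 0" if "t \<in> {0..l}" for t
    proof (cases "t = 0")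
      case False
      hence "\<bar>Im (\<delta> t)\<bar> < pi / 2" using that assms pi_gt_zero by (auto simp: \<delta> l_def abs_less_iff)
      thus ?thesis using cosh_nonzero_off_branch by fastforce
    qed (use assms in \<open>simp add: \<delta>_def\<close>)
    show "mono_on {0..l} (\<lambda>t. Re (Xi (\<delta> t)))"
    proof (rule mono_onI)
      fix r s assume rs: "r \<in> {0..l}" "s \<in> {0..l}" "r \<le> s"
      have "cos (2 * (Im z - r)) \<le> cos (2 * (Im z - s))"
        using rs assms pi_gt_zero by (intro cos_monotone_0_pi_le) (auto simp: l_def)
      hence "sinh (2 * Re z) * cos (2 * (Im z - r)) \<le> sinh (2 * Re z) * cos (2 * (Im z - s))"
        using assms(1) by (intro mult_left_mono) auto
      thus "Re (Xi (\<delta> r)) \<le> Re (Xi (\<delta> s))" by (simp add: Re_Xi \<delta>)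
    qed
    show "reach (\<delta> l)" by (rule reach_horizontal) (simp add: \<delta> l_def)
  qed
  thus ?thesis by (simp add: \<delta>_def)
qed

lemma sinh_double_gt: "(a::real) > 0 \<Longrightarrow> sinh (2 * a) > 2 * a"
  using sinh_gt_self[of "2 * a"] by simp

text \<open>Follow the level curve of Re (Xi) to the right until it meets Im w = pi/4, from where
  the horizontal ray leads to infinity. As Re (Xi z) < 0, this happens while Re w is still
  negative.\<close>

lemma reach_left:
  assumes a: "Re z < 0" and b: "pi / 4 < Im z" "Im z < pi / 2" and \<rho>: "Re (Xi z) < 0"
  shows "reach z"
proof -
  define m where "m = 4 * Re (Xi z)"
  have m: "m < 0" using \<rho> by (simp add: m_def)
  \<comment> \<open>With t = Re w and b = Im w the level equation 2 t + sinh (2 t) cos (2 b) = m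
    reads cos (2 b) = - u t.\<close>
  define u where "u t = (- m + 2 * t) / sinh (2 * t)" for t
  define B where "B t = arccos (- u t) / 2" for t
  \<comment> \<open>The zero of u, where cos (2 b) = 0 and b = pi/4.\<close>
  define d where "d = m / 2"
  have u_z: "- u (Re z) = cos (2 * Im z)"
    using a by (simp add: u_def m_def Re_Xi field_simps)
  have "sinh (2 * Re z) < 0" using a by simp
  moreover have "cos (2 * Im z) < 0"
  proof -
    have "cos (2 * Im z) < cos (pi / 2)" using b by (intro cos_monotone_0_pi) auto
    thus ?thesis by simp
  qed
  ultimately have "sinh (2 * Re z) * cos (2 * Im z) > 0" by (rule mult_neg_neg)
  hence cd: "Re z < d" by (simp add: d_def m_def Re_Xi)
  have t0: "t < 0" if "t \<le> d" for t using that m by (simp add: d_def)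
  have u: "0 \<le> u t" "u t < 1" if "t \<in> {Re z..d}" for t
  proof -
    have t: "t < 0" "- m + 2 * t \<le> 0" using that t0 by (auto simp: d_def)
    have s: "sinh (2 * t) < 0" using t by simp
    show "u t \<ge> 0" unfolding u_def using t s by (intro divide_nonpos_neg) auto
    have "sinh (2 * t) < - m + 2 * t" using sinh_double_gt[of "- t"] t m by simp
    thus "u t < 1" unfolding u_def using s by (simp add: field_simps)
  qed
  have B: "pi / 4 \<le> B t" "B t < pi / 2" "cos (2 * B t) = - u t" if "t \<in> {Re z..d}" for t
  proof -
    have "arccos (- u t) < arccos (- 1)" using u[OF that] by (intro arccos_less_arccos) auto
    moreover have "arccos 0 \<le> arccos (- u t)" using u[OF that] by (intro arccos_le_arccos) auto
    ultimately show "pi / 4 \<le> B t" "B t < pi / 2" by (auto simp: B_def)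
    show "cos (2 * B t) = - u t" using u[OF that] by (simp add: B_def)
  qed
  have Bz: "B (Re z) = Im z"
    unfolding B_def u_z using b by (subst arccos_cos) auto
  have "reach (Complex d (B d)) \<longleftrightarrow> reach (Complex (Re z) (B (Re z)))"
  proof (rule reach_graph_arc[OF cd])
    have "sinh (2 * t) \<noteq> 0" if "t \<in> {Re z..d}" for t using t0[of t] that by auto
    hence "continuous_on {Re z..d} u" unfolding u_def by (intro continuous_intros) auto
    moreover have "- 1 \<le> - u t \<and> - u t \<le> 1" if "t \<in> {Re z..d}" for t using u[OF that] by auto
    ultimately show "continuous_on {Re z..d} B" unfolding B_def by (intro continuous_intros) auto
    show "Re (Xi (Complex t (B t))) = Re (Xi z)" if "t \<in> {Re z..d}" for t
    proof -
      have "sinh (2 * t) \<noteq> 0" using t0[of t] that by auto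
      thus ?thesis unfolding Re_Xi[of "Complex t (B t)"] using B(3)[OF that] by (simp add: u_def m_def field_simps)
    qed
    fix t assume t: "Re z < t" "t < d"
    hence t': "t \<in> {Re z..d}" by auto
    show "B differentiable at t"
    proof -
      have "u t > 0" unfolding u_def using t t0[of t] by (intro divide_neg_neg) (auto simp: d_def)
      have "(arccos has_real_derivative inverse (- sqrt (1 - (- u t)\<^sup>2))) (at (- u t))"
        using u[OF t'] by (intro DERIV_arccos) auto
      moreover have "\<exists>v. ((\<lambda>t. - u t) has_real_derivative v) (at t)"
        unfolding u_def using t0[of t] t by (intro exI) (auto intro!: derivative_eq_intros)
      ultimately have "\<exists>v. ((\<lambda>t. arccos (- u t)) has_real_derivative v) (at t)"
        using DERIV_chain2[where f = arccos and g = "\<lambda>t. - u t" and x = t and s = UNIV] by blast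
      then obtain v where "((\<lambda>t. arccos (- u t)) has_real_derivative v) (at t)" ..
      from DERIV_cdivide[OF this, of 2] show ?thesis by (auto simp: B_def[abs_def] real_differentiable_def)
    qed
    have "sin (2 * B t) > 0" using B(1,2)[OF t'] pi_gt_zero by (intro sin_gt_zero) linarith+
    thus "sinh (2 * t) * sin (2 * B t) < 0" using t0[of t] t by (intro mult_neg_pos) auto
  next
    fix t assume "t \<in> {Re z..d}"
    thus "cosh (Complex t (B t)) \<noteq> 0"
      using cosh_nonzero_off_branch[of "Complex t (B t)"] B[of t] pi_gt_zero by fastforce
  qed
  moreover have "reach (Complex d (B d))"
  proof (rule reach_horizontal)
    have "u d = 0" by (simp add: u_def d_def)
    thus "\<bar>Im (Complex d (B d))\<bar> \<le> pi / 4" by (simp add: B_def)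
  qed
  moreover have "Complex (Re z) (Im z) = z" by simp
  ultimately show ?thesis by (simp only: Bz)
qed

text \<open>Beyond the cut, follow the level curve to the left until it meets Im w = pi/2; from
  there \<open>reach_vertical\<close> takes over. Re (Xi z) < 0 makes the real part c of the meeting
  point positive, so the branch point is avoided.\<close>

lemma reach_beyond:
  assumes a: "Re z > 0" and b: "pi / 2 < Im z" "Im z < pi" and \<rho>: "Re (Xi z) < 0"
  shows "reach z"
proof -
  define k where "k = - 4 * Re (Xi z)"
  have k: "k > 0" using \<rho> by (simp add: k_def)
  define u where "u t = (k + 2 * t) / sinh (2 * t)" for t
  \<comment> \<open>The level equation is cos (2 b) = - u t, and this is its solution between pi/2
    and pi.\<close>
  define B where "B t = pi / 2 + arccos (u t) / 2" for t
  have cos_pi: "cos (2 * (pi / 2 + y / 2)) = - cos y" "sin (2 * (pi / 2 + y / 2)) = - sin y" for y :: real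
    by (simp_all add: distrib_left cos_add sin_add)
  have u_z: "u (Re z) = cos (2 * Im z - pi)"
    using a by (simp add: u_def k_def Re_Xi field_simps)
  have u_z1: "u (Re z) < 1"
  proof -
    have "cos (2 * Im z - pi) < cos 0" using b by (intro cos_monotone_0_pi) auto
    thus ?thesis by (simp add: u_z)
  qed
  \<comment> \<open>Where the level curve meets Im w = pi/2: u c = 1 says sinh (2 c) - 2 c =
    k.\<close>
  obtain c where c: "0 \<le> c" "c \<le> Re z" "sinh (2 * c) - 2 * c = k"
  proof -
    have "continuous_on {0..Re z} (\<lambda>c. sinh (2 * c) - 2 * c)" by (intro continuous_intros)
    moreover have "k \<le> sinh (2 * Re z) - 2 * Re z" using u_z1 a by (simp add: u_def field_simps)
    ultimately show ?thesis using IVT'[of "\<lambda>c. sinh (2 * c) - 2 * c" 0 k "Re z"] k a that by auto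
  qed
  have c0: "c > 0" using c k by (cases "c = 0") auto
  have "sinh (2 * c) \<noteq> 0" "k + 2 * c = sinh (2 * c)" using c c0 by auto
  hence uc: "u c = 1" by (simp add: u_def)
  have cd: "c < Re z" using c(2) uc u_z1 by (cases "c = Re z") auto
  have u: "0 < u t" "u t \<le> 1" "t > c \<Longrightarrow> u t < 1" if "t \<in> {c..Re z}" for t
  proof -
    have t: "t > 0" using that c0 by simp
    hence s: "sinh (2 * t) > 0" by simp
    show "u t > 0" unfolding u_def using t s k by (intro divide_pos_pos) auto
    have inc: "sinh (2 * c) - 2 * c < sinh (2 * t) - 2 * t" if "t > c"
    proof (rule DERIV_pos_imp_increasing_open[OF that])
      fix x assume x: "c < x" "x < t"
      have "cosh (2 * x) > 1" using cosh_real_ge_1[of "2 * x"] cosh_real_one_iff[of "2 * x"] x c0 by linarith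
      thus "\<exists>y. ((\<lambda>x. sinh (2 * x) - 2 * x) has_real_derivative y) (at x) \<and> y > 0"
        by (intro exI[of _ "2 * cosh (2 * x) - 2"]) (auto intro!: derivative_eq_intros)
    qed (intro continuous_intros)
    show lt: "u t < 1" if "t > c" unfolding u_def using inc[OF that] c(3) s by (simp add: field_simps)
    show "u t \<le> 1" using lt uc that by (cases "t = c") auto
  qed
  have B: "cos (2 * B t) = - u t" "pi / 2 \<le> B t" "B t < 3 / 4 * pi" if "t \<in> {c..Re z}" for t
  proof -
    show "cos (2 * B t) = - u t" unfolding B_def cos_pi using u[OF that] by simp
    have "arccos (u t) < arccos 0" using u[OF that] by (intro arccos_less_arccos) auto
    thus "B t < 3 / 4 * pi" by (simp add: B_def)
    show "pi / 2 \<le> B t" using u[OF that] arccos_lbound[of "u t"] by (simp add: B_def)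
  qed
  have Bz: "B (Re z) = Im z"
    unfolding B_def u_z using b by (subst arccos_cos) (auto simp: field_simps)
  have nz: "cosh (Complex t (B t)) \<noteq> 0" if "t \<in> {c..Re z}" for t
  proof
    assume "cosh (Complex t (B t)) = 0"
    hence "cos (B t) = 0" "sin (B t) = 0" using that c0 by (auto simp: complex_eq_iff Re_Im_sinh_cosh)
    thus False using sin_cos_squared_add[of "B t"] by simp
  qed
  have "reach (Complex (Re z) (B (Re z))) \<longleftrightarrow> reach (Complex c (B c))"
  proof (rule reach_graph_arc[OF cd])
    have "sinh (2 * t) \<noteq> 0" if "t \<in> {c..Re z}" for t using c0 that by auto
    hence "continuous_on {c..Re z} u" unfolding u_def by (intro continuous_intros) auto
    moreover have "- 1 \<le> u t \<and> u t \<le> 1" if "t \<in> {c..Re z}" for t using u(1,2)[OF that] by auto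
    ultimately show "continuous_on {c..Re z} B" unfolding B_def by (intro continuous_intros) auto
    show "Re (Xi (Complex t (B t))) = Re (Xi z)" if "t \<in> {c..Re z}" for t
    proof -
      have "sinh (2 * t) \<noteq> 0" using c0 that by auto
      thus ?thesis unfolding Re_Xi[of "Complex t (B t)"] using B(1)[OF that] by (simp add: u_def k_def field_simps)
    qed
    fix t assume t: "c < t" "t < Re z"
    hence t': "t \<in> {c..Re z}" by auto
    show "B differentiable at t"
    proof -
      have "(arccos has_real_derivative inverse (- sqrt (1 - (u t)\<^sup>2))) (at (u t))"
        using u[OF t'] t by (intro DERIV_arccos) auto
      moreover have "\<exists>v. (u has_real_derivative v) (at t)"
        unfolding u_def[abs_def] using c0 t by (intro exI) (auto intro!: derivative_eq_intros)
      ultimately have "\<exists>v. ((\<lambda>t. arccos (u t)) has_real_derivative v) (at t)"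
        using DERIV_chain2[where f = arccos and g = u and x = t and s = UNIV] by blast
      then obtain v where "((\<lambda>t. arccos (u t)) has_real_derivative v) (at t)" ..
      hence "(B has_real_derivative 0 + v / 2) (at t)"
        unfolding B_def[abs_def] by (intro DERIV_add DERIV_const DERIV_cdivide)
      thus ?thesis by (auto simp: real_differentiable_def)
    qed
    have "arccos (u t) > arccos 1" using u[OF t'] t by (intro arccos_less_arccos) auto
    moreover have "arccos (u t) < arccos 0" using u[OF t'] by (intro arccos_less_arccos) auto
    ultimately have "sin (arccos (u t)) > 0" by (intro sin_gt_zero) auto
    thus "sinh (2 * t) * sin (2 * B t) < 0" unfolding B_def cos_pi using c0 t by (intro mult_pos_neg) auto
  qed (rule nz)
  moreover have "reach (Complex c (B c))"
    by (rule reach_vertical) (use uc c0 nz[of c] cd in \<open>auto simp: B_def\<close>)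
  moreover have "Complex (Re z) (Im z) = z" by simp
  ultimately show ?thesis by (simp only: Bz)
qed

lemma reach_sheet:
  assumes "z \<in> sheet"
  shows "reach z"
proof -
  have upper: "reach z" if z: "z \<in> sheet" and i: "Im z \<ge> 0" for z
  proof -
    have nz: "cosh z \<noteq> 0" using cosh_not_nonpos_on_sheet[OF z] by auto
    consider "Im z \<le> pi / 4" | "Re z \<ge> 0" "Im z \<le> pi / 2" | "Re z > 0" "Im z > pi / 2" | "Re z < 0" "Im z > pi / 4"
      | "Re z = 0" "Im z > pi / 2" by linarith
    thus ?thesis
    proof cases
      case 1
      thus ?thesis using i by (intro reach_horizontal) auto
    next
      case 2
      thus ?thesis using i nz by (intro reach_vertical) auto
    next
      case 3
      thus ?thesis using z sheet_pos_iff[of z] by (intro reach_beyond) auto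
    next
      case 4
      thus ?thesis using z sheet_neg_iff[of z] by (intro reach_left) auto
    next
      case 5
      thus ?thesis using z sheet_zero_iff[of z] by auto
    qed
  qed
  have cnj: "cnj z \<in> sheet \<longleftrightarrow> z \<in> sheet" by (simp add: sheet_def Re_Xi)
  show ?thesis
  proof (cases "Im z \<ge> 0")
    case True
    thus ?thesis using upper assms by blast
  next
    case False
    hence "reach (cnj z)" using upper[of "cnj z"] assms cnj by simp
    from reach_cnj[OF this] show ?thesis by simp
  qed
qed

lemma admissible_start_points: "{z. \<exists>\<gamma> q X. admissible_path 2 \<gamma> q X \<and> \<gamma> 0 = z} = - exceptional_set"
  unfolding sinh_image_sheet[symmetric]
proof (intro equalityI subsetI)
  fix z assume "z \<in> {z. \<exists>\<gamma> q X. admissible_path 2 \<gamma> q X \<and> \<gamma> 0 = z}"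
  then obtain \<gamma> q X where *: "admissible_path 2 \<gamma> q X" "\<gamma> 0 = z" by auto
  show "z \<in> sinh ` sheet" using admissible_lift(1,2)[OF *(1), of 0] *(2) by auto
next
  fix z assume "z \<in> sinh ` sheet"
  then obtain v where v: "v \<in> sheet" "z = sinh v" by auto
  obtain w where "lifted_path w" "w 0 = v" using reach_sheet[OF v(1)] by (auto simp: reach_def)
  thus "z \<in> {z. \<exists>\<gamma> q X. admissible_path 2 \<gamma> q X \<and> \<gamma> 0 = z}"
    using admissible_of_lifted_path[of w] v by blast
qed

subsection \<open>A backward Gronwall estimate\<close>

text \<open>The integrating factor argument run from d backwards, with the inhomogeneous part r
  collected in front of the exponential.\<close>

lemma gronwall_backward:
  fixes M k r :: "real \<Rightarrow> real"
  assumes cd: "c \<le> d" and M: "continuous_on {c..d} M" and k: "continuous_on {c..d} k" "\<And>t. t \<in> {c..d} \<Longrightarrow> k t \<ge> 0"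
    and r: "continuous_on {c..d} r" "\<And>t. t \<in> {c..d} \<Longrightarrow> r t \<ge> 0"
    and le: "\<And>t. t \<in> {c..d} \<Longrightarrow> M t \<le> M0 + integral {t..d} (\<lambda>s. k s * M s + r s)"
  shows "M c \<le> (M0 + integral {c..d} r) * exp (integral {c..d} k)"
proof -
  define K where "K t = integral {c..t} k" for t
  define Q where "Q t = integral {c..t} (\<lambda>s. k s * M s + r s)" for t
  define P where "P t = integral {c..t} r" for t
  have h: "continuous_on {c..d} (\<lambda>s. k s * M s + r s)" by (intro continuous_intros M k r)
  have dK: "(K has_real_derivative k t) (at t within {c..d})" and dQ: "(Q has_real_derivative k t * M t + r t) (at t within {c..d})"
    and dP: "(P has_real_derivative r t) (at t within {c..d})" if "t \<in> {c..d}" for t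
    unfolding K_def[abs_def] Q_def[abs_def] P_def[abs_def] has_real_derivative_iff_has_vector_derivative
    by (intro integral_has_vector_derivative k r h that)+
  have split: "integral {t..d} (\<lambda>s. k s * M s + r s) = Q d - Q t" if "t \<in> {c..d}" for t
    using Henstock_Kurzweil_Integration.integral_combine[of c t d "\<lambda>s. k s * M s + r s"] that integrable_continuous_real[OF h] by (simp add: Q_def)
  have Kle: "K t \<le> K d" if "t \<in> {c..d}" for t
  proof -
    have "K t + integral {t..d} k = K d"
      unfolding K_def using that integrable_continuous_real[OF k(1)] by (intro Henstock_Kurzweil_Integration.integral_combine) auto
    moreover have "integral {t..d} k \<ge> 0"
      by (intro integral_nonneg integrable_continuous_real continuous_on_subset[OF k(1)]) (use k(2) that in auto)
    ultimately show ?thesis by simp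
  qed
  \<comment> \<open>At c this is M0 + Q d - Q c, which bounds M c; at d it is the right-hand side.
    So it suffices that H increases.\<close>
  define H where "H t = (M0 + (Q d - Q t)) * exp (K t) + P t * exp (K d)" for t
  have dH: "(H has_real_derivative (0 + (0 - (k t * M t + r t))) * exp (K t) + exp (K t) * k t * (M0 + (Q d - Q t)) + r t * exp (K d)) (at t within {c..d})"
    if "t \<in> {c..d}" for t
    unfolding H_def[abs_def]
    by (intro DERIV_add DERIV_mult DERIV_const DERIV_diff DERIV_cmult_right dQ dP that DERIV_chain2[OF DERIV_exp] dK)
  have "H c \<le> H d"
  proof (rule DERIV_nonneg_imp_increasing_open[OF cd])
    show "continuous_on {c..d} H" by (rule DERIV_continuous_on[OF dH])
    fix t assume t: "c < t" "t < d"
    hence t': "t \<in> {c..d}" by auto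
    have "k t * M t \<le> k t * (M0 + (Q d - Q t))" using le[OF t'] k(2)[OF t'] by (simp add: split[OF t'] mult_left_mono)
    hence "(k t * (M0 + (Q d - Q t)) - k t * M t) * exp (K t) \<ge> 0" by simp
    moreover have "r t * exp (K t) \<le> r t * exp (K d)" using Kle[OF t'] r(2)[OF t'] by (intro mult_left_mono) auto
    ultimately have "(0 + (0 - (k t * M t + r t))) * exp (K t) + exp (K t) * k t * (M0 + (Q d - Q t)) + r t * exp (K d) \<ge> 0"
      by (simp add: algebra_simps)
    thus "\<exists>y. (H has_real_derivative y) (at t) \<and> 0 \<le> y"
      using dH[OF t'] at_within_Icc_at[OF t] by auto
  qed
  moreover have "M c \<le> M0 + (Q d - Q c)" using le[of c] split[of c] cd by simp
  ultimately show ?thesis by (simp add: H_def K_def Q_def P_def algebra_simps)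
qed

text \<open>Both equations have the same source J, bounded by N = 2 |\<gamma>| M + |\<rho>| (1 + M)
  / 2 with M = |\<eta> - \<zeta>| + |\<zeta>|. Adding the two integrated inequalities gives 2 N = (4
  |\<gamma>| + |\<rho>|) M + |\<rho>|, the form needed for \<open>gronwall_backward\<close>.\<close>

lemma arc_error_bound:
  fixes \<eta> \<zeta> \<gamma> \<rho> X X' :: "real \<Rightarrow> complex" and u :: real
  assumes cd: "c \<le> d" and u: "u > 0"
    and dp: "\<And>t. t \<in> {c..d} \<Longrightarrow> ((\<lambda>t. \<eta> t - \<zeta> t) has_vector_derivative (\<rho> t * (1 + \<eta> t) / 2 + 2 * \<gamma> t * \<zeta> t)) (at t within {c..d})"
    and dz: "\<And>t. t \<in> {c..d} \<Longrightarrow> (\<zeta> has_vector_derivative (2 * of_real u * X' t * \<zeta> t - (\<rho> t * (1 + \<eta> t) / 2 + 2 * \<gamma> t * \<zeta> t))) (at t within {c..d})"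
    and dX: "\<And>t. t \<in> {c..d} \<Longrightarrow> (X has_vector_derivative X' t) (at t within {c..d})"
    and cont: "continuous_on {c..d} \<gamma>" "continuous_on {c..d} \<rho>"
    and mono: "\<And>s t. c \<le> s \<Longrightarrow> s \<le> t \<Longrightarrow> t \<le> d \<Longrightarrow> Re (X s) \<le> Re (X t)"
  shows "cmod (\<eta> c - \<zeta> c) + cmod (\<zeta> c) \<le> (cmod (\<eta> d - \<zeta> d) + cmod (\<zeta> d) + integral {c..d} (\<lambda>t. cmod (\<rho> t)))
     * exp (integral {c..d} (\<lambda>t. 4 * cmod (\<gamma> t) + cmod (\<rho> t)))"
proof -
  define p where "p t = \<eta> t - \<zeta> t" for t
  have \<eta>: "\<eta> = (\<lambda>t. p t + \<zeta> t)" by (simp add: p_def)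
  have cp: "continuous_on {c..d} p" and cz: "continuous_on {c..d} \<zeta>"
    unfolding p_def continuous_on_eq_continuous_within
    by (intro ballI has_vector_derivative_continuous[OF dp] has_vector_derivative_continuous[OF dz]; assumption)+
  define M where "M t = cmod (p t) + cmod (\<zeta> t)" for t
  define J where "J t = \<rho> t * (1 + \<eta> t) / 2 + 2 * \<gamma> t * \<zeta> t" for t
  define N where "N t = 2 * cmod (\<gamma> t) * M t + cmod (\<rho> t) * (1 + M t) / 2" for t
  have cM: "continuous_on {c..d} M" unfolding M_def by (intro continuous_intros cp cz)
  have cN: "continuous_on {c..d} N" unfolding N_def by (intro continuous_intros cont cM) auto
  have JN: "cmod (J t) \<le> N t" for t
  proof -
    have "cmod (1 + \<eta> t) \<le> 1 + M t"
      using norm_triangle_ineq[of 1 "\<eta> t"] norm_triangle_ineq[of "p t" "\<zeta> t"] by (simp add: \<eta> M_def)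
    hence "cmod (\<rho> t) * cmod (1 + \<eta> t) \<le> cmod (\<rho> t) * (1 + M t)" by (rule mult_left_mono) simp
    moreover have "2 * cmod (\<gamma> t) * cmod (\<zeta> t) \<le> 2 * cmod (\<gamma> t) * M t" by (rule mult_left_mono) (auto simp: M_def)
    moreover have "cmod (J t) \<le> cmod (\<rho> t) * cmod (1 + \<eta> t) / 2 + 2 * cmod (\<gamma> t) * cmod (\<zeta> t)"
      unfolding J_def by (rule order_trans[OF norm_triangle_ineq]) (simp add: norm_mult norm_divide)
    ultimately show ?thesis unfolding N_def by linarith
  qed
  have main: "M t \<le> M d + integral {t..d} (\<lambda>s. (4 * cmod (\<gamma> s) + cmod (\<rho> s)) * M s + cmod (\<rho> s))" if t: "t \<in> {c..d}" for t
  proof -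
    have sub: "{t..d} \<subseteq> {c..d}" using t by auto
    have intN: "N integrable_on {t..d}" by (intro integrable_continuous_real continuous_on_subset[OF cN sub])
    have "(J has_integral (p d - p t)) {t..d}"
      by (rule fundamental_theorem_of_calculus)
         (use t dp in \<open>auto simp: J_def p_def intro: has_vector_derivative_within_subset[OF _ sub]\<close>)
    hence "cmod (p d - p t) \<le> integral {t..d} N"
      using integral_norm_bound_integral[of J "{t..d}" N] intN JN by (auto simp: has_integral_iff)
    hence 1: "cmod (p t) \<le> cmod (p d) + integral {t..d} N" using norm_triangle_ineq2[of "p t" "p d"] by (simp add: norm_minus_commute)
    \<comment> \<open>Integrating factor normalised to 1 at t; as Re X does not decrease, |W| <= 1
      on the rest of the arc.\<close>
    define W where "W s = exp (2 * of_real u * (X t - X s))" for s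
    have W1: "cmod (W s) \<le> 1" if "s \<in> {t..d}" for s
      using mono[of t s] that t u by (simp add: W_def mult_le_0_iff)
    have dW: "(W has_vector_derivative - (2 * of_real u * X' s) * W s) (at s within {t..d})" if s: "s \<in> {t..d}" for s
    proof -
      have dXs: "(X has_vector_derivative X' s) (at s within {t..d})"
        using dX[of s] s sub by (auto intro: has_vector_derivative_within_subset)
      have "((\<lambda>x. exp (2 * of_real u * (X t - x))) has_field_derivative - (2 * of_real u) * W s) (at (X s) within X ` {t..d})"
        by (auto intro!: derivative_eq_intros simp: W_def)
      from field_vector_diff_chain_within[OF dXs this] show ?thesis by (simp add: W_def[abs_def] o_def mult_ac)
    qed
    have "((\<lambda>s. - (W s * J s)) has_integral (W d * \<zeta> d - W t * \<zeta> t)) {t..d}"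
    proof (rule fundamental_theorem_of_calculus)
      show "t \<le> d" using t by simp
      fix s assume s: "s \<in> {t..d}"
      have dzs: "(\<zeta> has_vector_derivative (2 * of_real u * X' s * \<zeta> s - J s)) (at s within {t..d})"
        using dz[of s] s sub unfolding J_def by (auto intro: has_vector_derivative_within_subset)
      show "((\<lambda>s. W s * \<zeta> s) has_vector_derivative - (W s * J s)) (at s within {t..d})"
        using has_vector_derivative_mult[OF dW[OF s] dzs] by (simp add: algebra_simps)
    qed
    moreover have "cmod (- (W s * J s)) \<le> N s" if "s \<in> {t..d}" for s
      using W1[OF that] JN[of s] mult_mono[of "cmod (W s)" 1 "cmod (J s)" "N s"] by (simp add: norm_mult)
    ultimately have "cmod (W d * \<zeta> d - W t * \<zeta> t) \<le> integral {t..d} N"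
      using integral_norm_bound_integral[of "\<lambda>s. - (W s * J s)" "{t..d}" N] intN by (auto simp: has_integral_iff)
    moreover have "W t = 1" by (simp add: W_def)
    moreover have "cmod (W d * \<zeta> d) \<le> cmod (\<zeta> d)"
      using W1[of d] t mult_right_mono[of "cmod (W d)" 1 "cmod (\<zeta> d)"] by (simp add: norm_mult)
    ultimately have 2: "cmod (\<zeta> t) \<le> cmod (\<zeta> d) + integral {t..d} N"
      using norm_triangle_ineq2[of "\<zeta> t" "W d * \<zeta> d"] by (simp add: norm_minus_commute)
    have "integral {t..d} (\<lambda>s. (4 * cmod (\<gamma> s) + cmod (\<rho> s)) * M s + cmod (\<rho> s)) = integral {t..d} (\<lambda>s. 2 * N s)"
      by (rule integral_cong) (simp add: N_def algebra_simps)
    also have "\<dots> = 2 * integral {t..d} N" by simp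
    finally show ?thesis using 1 2 by (simp add: M_def)
  qed
  have "M c \<le> (M d + integral {c..d} (\<lambda>t. cmod (\<rho> t))) * exp (integral {c..d} (\<lambda>t. 4 * cmod (\<gamma> t) + cmod (\<rho> t)))"
    by (rule gronwall_backward[OF cd cM _ _ _ _ main]) (intro continuous_intros cont | simp)+
  thus ?thesis by (simp add: M_def p_def)
qed

subsection \<open>The Liouville-Green form of the derivative\<close>

lemma one_minus_tanh_square:
  assumes "cosh w \<noteq> 0"
  shows "1 - (tanh w)\<^sup>2 = 1 / (cosh (w::complex))\<^sup>2"
proof -
  have "1 - (tanh w)\<^sup>2 = ((cosh w)\<^sup>2 - (sinh w)\<^sup>2) / (cosh w)\<^sup>2"
    using assms by (simp add: tanh_def power_divide diff_divide_distrib)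
  thus ?thesis by (simp add: hyperbolic_pythagoras)
qed

lemma has_field_derivative_tanh_complex:
  assumes "cosh w \<noteq> 0"
  shows "(tanh has_field_derivative 1 / (cosh w)\<^sup>2) (at (w::complex))"
proof -
  have "((\<lambda>w. sinh w / cosh w) has_field_derivative (cosh w * cosh w - sinh w * sinh w) / (cosh w * cosh w)) (at w)"
    using assms by (auto intro!: derivative_eq_intros)
  moreover have "cosh w * cosh w - sinh w * sinh w = 1"
    using hyperbolic_pythagoras[of w] by (simp add: power2_eq_square)
  ultimately show ?thesis by (simp add: tanh_def[abs_def] power2_eq_square)
qed

lemma F_tilde_tanh: "cosh w \<noteq> 0 \<Longrightarrow> F_tilde s (tanh w) = deriv (E_tilde s) (tanh w) / (cosh w) ^ 4"
  by (simp add: F_tilde_def one_minus_tanh_square power_divide flip: power_mult)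

context
  fixes u :: real and n :: nat
  assumes u: "u > 0" and n: "n \<ge> 1"
begin

definition pcU where "pcU = parabolic_cylinder_U (of_real (u / 2))"

definition lg_exponent where
  "lg_exponent w = - of_real u * Xi w + (\<Sum>s = 1..n - 1. (- 1) ^ s * (E_tilde s (tanh w) - E_tilde s 1) / of_real u ^ s)"

text \<open>The constant prefactor of the theorem: {2u(1 + z^2)}^(1/4) is (2u)^(1/4) q, and V is
  already divided by q.\<close>

definition lg_const :: complex where
  "lg_const = - 1 / 2 * of_real ((2 * exp 1 / u) powr (u / 4)) * of_real ((2 * u) powr (1 / 4))"

text \<open>\<open>lg_DV\<close>, \<open>lg_Dg\<close> and \<open>lg_theta\<close> are the derivatives of \<open>lg_V\<close>, \<open>lg_g\<close> and \<open>lg_eta\<close> with respect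
  to \<open>Xi w\<close>, that is, \<open>d/dw\<close> divided by \<open>(cosh w)\<^sup>2\<close>.\<close>

definition lg_V where "lg_V w = deriv pcU (of_real (sqrt (2 * u)) * sinh w) / csqrt (cosh w)"

definition lg_DV where "lg_DV w = of_real (sqrt (2 * u)) * of_real (u / 2) * csqrt (cosh w) * pcU (of_real (sqrt (2 * u)) * sinh w)
    - 1 / 2 * sinh w / (cosh w ^ 3 * csqrt (cosh w)) * deriv pcU (of_real (sqrt (2 * u)) * sinh w)"

text \<open>The derivative in xi of the finite sum in the exponent.\<close>

definition lg_g where "lg_g w = (\<Sum>s = 1..n - 1. F_tilde s (tanh w) * (- 1 / of_real u) ^ s)"

definition lg_Dg where "lg_Dg w = (\<Sum>s = 1..n - 1. (1 - (tanh w)\<^sup>2)\<^sup>2 * deriv (F_tilde s) (tanh w) * (- 1 / of_real u) ^ s)"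

text \<open>The Riccati residual: the amount by which g - u fails to solve y' + y^2 = u^2 + 2
  F_1.\<close>

definition lg_R where "lg_R w = - 2 * F_tilde n (tanh w) * (- 1 / of_real u) ^ (n - 1)
    + (\<Sum>s = 1..n - 1. (- 1 / of_real u) ^ (s + n - 1) * (\<Sum>k = s..n - 1. F_tilde k (tanh w) * F_tilde (s + n - k - 1) (tanh w)))"

definition lg_eta where "lg_eta w = lg_V w / (lg_const * exp (lg_exponent w)) - 1"

definition lg_theta where "lg_theta w = (lg_DV w - (lg_g w - of_real u) * lg_V w) / (lg_const * exp (lg_exponent w))"

lemma lg_const_nonzero: "lg_const \<noteq> 0"
  using u by (simp add: lg_const_def)

text \<open>\<open>riccati_residual\<close> at x = -1/u, where 2 g / x = -2 u g completes the
  square.\<close>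

lemma lg_riccati: "lg_Dg w + (lg_g w - of_real u)\<^sup>2 = (of_real u)\<^sup>2 + 2 * F_tilde 1 (tanh w) + lg_R w"
proof -
  define x :: complex where "x = - 1 / of_real u"
  have x: "x \<noteq> 0" using u by (simp add: x_def)
  have "lg_Dg w + 2 * lg_g w / x + (lg_g w)\<^sup>2 = 2 * F_tilde 1 (tanh w) + lg_R w"
    using riccati_residual[OF n x, of "\<lambda>s. F_tilde s (tanh w)" "\<lambda>s. (1 - (tanh w)\<^sup>2)\<^sup>2 * deriv (F_tilde s) (tanh w)", OF F_tilde_Suc]
    unfolding lg_Dg_def lg_g_def lg_R_def x_def[symmetric] by simp
  moreover have "2 * lg_g w / x = - 2 * of_real u * lg_g w" using u by (simp add: x_def)
  ultimately show ?thesis by (simp add: power2_diff algebra_simps)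
qed

lemma pcU_derivs:
  "(pcU has_field_derivative deriv pcU z) (at z)"
  "(deriv pcU has_field_derivative (z\<^sup>2 / 4 + of_real (u / 2)) * pcU z) (at z)"
proof -
  have a: "u / 2 > 0" using u by simp
  have eq: "pcU = gauss_pcU (u / 2)" unfolding pcU_def by (rule parabolic_cylinder_U_eq[OF a])
  have d1: "(pcU has_field_derivative deriv pcU z) (at z)" for z
    unfolding eq using gauss_pcU_derivs(1)[OF a, of z] by (metis DERIV_imp_deriv)
  show "(pcU has_field_derivative deriv pcU z) (at z)" by (rule d1)
  have "pcU holomorphic_on UNIV" unfolding holomorphic_on_open[OF open_UNIV] using d1 by blast
  hence "deriv pcU holomorphic_on UNIV" by (rule holomorphic_deriv) auto
  hence "(deriv pcU has_field_derivative deriv (deriv pcU) z) (at z)" by (rule holomorphic_derivI) auto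
  thus "(deriv pcU has_field_derivative (z\<^sup>2 / 4 + of_real (u / 2)) * pcU z) (at z)"
    unfolding eq gauss_pcU_derivs(2)[OF a] .
qed

lemma lg_exponent_deriv:
  assumes "cosh w \<noteq> 0"
  shows "(lg_exponent has_field_derivative (cosh w)\<^sup>2 * (lg_g w - of_real u)) (at w)"
proof -
  have E: "((\<lambda>w. E_tilde s (tanh w)) has_field_derivative (cosh w)\<^sup>2 * F_tilde s (tanh w)) (at w)" for s
  proof -
    have "((\<lambda>w. E_tilde s (tanh w)) has_field_derivative deriv (E_tilde s) (tanh w) * (1 / (cosh w)\<^sup>2)) (at w)"
      by (rule DERIV_chain2[OF E_tilde_has_field_derivative has_field_derivative_tanh_complex[OF assms]])
    also have "deriv (E_tilde s) (tanh w) * (1 / (cosh w)\<^sup>2) = (cosh w)\<^sup>2 * F_tilde s (tanh w)"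
      using assms by (simp add: F_tilde_tanh power2_eq_square power4_eq_xxxx)
    finally show ?thesis .
  qed
  have "((\<lambda>w. \<Sum>s = 1..n - 1. (- 1) ^ s * (E_tilde s (tanh w) - E_tilde s 1) / of_real u ^ s)
     has_field_derivative (\<Sum>s = 1..n - 1. (- 1) ^ s * ((cosh w)\<^sup>2 * F_tilde s (tanh w) - 0) / of_real u ^ s)) (at w)"
    by (intro DERIV_sum DERIV_cdivide DERIV_cmult DERIV_diff DERIV_const E)
  also have "(\<Sum>s = 1..n - 1. (- 1) ^ s * ((cosh w)\<^sup>2 * F_tilde s (tanh w) - 0) / of_real u ^ s) = (cosh w)\<^sup>2 * lg_g w"
    unfolding lg_g_def sum_distrib_left power_divide by (rule sum.cong) (auto simp: mult_ac)
  finally have "(lg_exponent has_field_derivative - of_real u * (cosh w)\<^sup>2 + (cosh w)\<^sup>2 * lg_g w) (at w)"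
    unfolding lg_exponent_def[abs_def] by (intro DERIV_add DERIV_cmult has_field_derivative_Xi)
  thus ?thesis by (simp add: algebra_simps)
qed

lemma lg_g_deriv:
  assumes "cosh w \<noteq> 0"
  shows "(lg_g has_field_derivative (cosh w)\<^sup>2 * lg_Dg w) (at w)"
proof -
  have F: "((\<lambda>w. F_tilde s (tanh w)) has_field_derivative deriv (F_tilde s) (tanh w) * (1 / (cosh w)\<^sup>2)) (at w)" for s
    by (rule DERIV_chain2[OF holomorphic_derivI[OF F_tilde_holomorphic open_UNIV] has_field_derivative_tanh_complex[OF assms]]) simp
  have "((\<lambda>w. \<Sum>s = 1..n - 1. F_tilde s (tanh w) * (- 1 / of_real u) ^ s) has_field_derivative
     (\<Sum>s = 1..n - 1. deriv (F_tilde s) (tanh w) * (1 / (cosh w)\<^sup>2) * (- 1 / of_real u) ^ s)) (at w)"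
    by (intro DERIV_sum DERIV_cmult_right F)
  also have "(\<Sum>s = 1..n - 1. deriv (F_tilde s) (tanh w) * (1 / (cosh w)\<^sup>2) * (- 1 / of_real u) ^ s) = (cosh w)\<^sup>2 * lg_Dg w"
    unfolding lg_Dg_def sum_distrib_left one_minus_tanh_square[OF assms]
    by (rule sum.cong) (use assms in \<open>auto simp: power_divide power2_eq_square\<close>)
  finally show ?thesis unfolding lg_g_def[abs_def] .
qed

text \<open>Liouville's transformation for U': in w the pair U, U' satisfies a first-order system,
  and dividing U' by the root of cosh w removes the first-derivative term in xi. The squared scale 2
  u times u / 2 gives u^2, and the rest is 2 F_1. The slit condition makes csqrt
  differentiable.\<close>

lemma lg_V_derivs:
  assumes "cosh w \<notin> \<real>\<^sub>\<le>\<^sub>0"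
  shows "(lg_V has_field_derivative (cosh w)\<^sup>2 * lg_DV w) (at w)"
    and "(lg_DV has_field_derivative (cosh w)\<^sup>2 * (((of_real u)\<^sup>2 + 2 * F_tilde 1 (tanh w)) * lg_V w)) (at w)"
proof -
  have c0: "cosh w \<noteq> 0" using assms by auto
  define q where "q = csqrt (cosh w)"
  have q: "q \<noteq> 0" "cosh w = q\<^sup>2" using c0 by (auto simp: q_def)
  define \<kappa> :: complex where "\<kappa> = of_real (sqrt (2 * u))"
  have \<kappa>: "\<kappa>\<^sup>2 = 2 * of_real u" using u by (simp add: \<kappa>_def flip: of_real_power)
  define U :: complex where "U = of_real u"
  define y0 y1 where "y0 w = pcU (\<kappa> * sinh w)" and "y1 w = deriv pcU (\<kappa> * sinh w)" for w
  have ds: "((\<lambda>w. \<kappa> * sinh w) has_field_derivative \<kappa> * cosh w) (at w)"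
    by (auto intro!: derivative_eq_intros)
  have dy0: "(y0 has_field_derivative y1 w * (\<kappa> * cosh w)) (at w)"
    unfolding y0_def[abs_def] y1_def by (rule DERIV_chain2[OF pcU_derivs(1) ds])
  have dy1: "(y1 has_field_derivative \<kappa> * (U / 2) * cosh w ^ 3 * y0 w) (at w)"
  proof -
    have "(y1 has_field_derivative ((\<kappa> * sinh w)\<^sup>2 / 4 + of_real (u / 2)) * pcU (\<kappa> * sinh w) * (\<kappa> * cosh w)) (at w)"
      unfolding y1_def[abs_def] by (rule DERIV_chain2[OF pcU_derivs(2) ds])
    also have "(\<kappa> * sinh w)\<^sup>2 / 4 + of_real (u / 2) = U / 2 * (cosh w)\<^sup>2"
      by (simp add: power_mult_distrib \<kappa> cosh_square_eq U_def field_simps)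
    finally show ?thesis by (simp add: y0_def power2_eq_square power3_eq_cube mult_ac)
  qed
  have dq: "((\<lambda>w. csqrt (cosh w)) has_field_derivative sinh w / (2 * q)) (at w)"
    unfolding q_def using assms by (auto intro!: derivative_eq_intros)
  have dc: "((\<lambda>w. cosh w ^ 3) has_field_derivative 3 * (cosh w)\<^sup>2 * sinh w) (at w)"
    by (auto intro!: derivative_eq_intros)
  have dsh: "(sinh has_field_derivative cosh w) (at w)"
    using has_field_derivative_sinh[OF DERIV_ident, of w] by simp
  have V: "lg_V = (\<lambda>w. y1 w / csqrt (cosh w))" by (simp add: lg_V_def[abs_def] y1_def \<kappa>_def)
  have DV: "lg_DV = (\<lambda>w. \<kappa> * (U / 2) * csqrt (cosh w) * y0 w - 1 / 2 * (sinh w / (cosh w ^ 3 * csqrt (cosh w))) * y1 w)"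
    by (rule ext) (simp add: lg_DV_def y0_def y1_def \<kappa>_def U_def)
  have "(lg_V has_field_derivative (\<kappa> * (U / 2) * cosh w ^ 3 * y0 w * q - y1 w * (sinh w / (2 * q))) / (q * q)) (at w)"
    unfolding V using DERIV_divide[OF dy1 dq] q(1) by (simp add: q_def)
  moreover have "(\<kappa> * (U / 2) * cosh w ^ 3 * y0 w * q - y1 w * (sinh w / (2 * q))) / (q * q) = (cosh w)\<^sup>2 * lg_DV w"
    unfolding DV unfolding q_def[symmetric] unfolding q(2) using q(1)
    by (simp add: field_simps power2_eq_square power3_eq_cube)
  ultimately show "(lg_V has_field_derivative (cosh w)\<^sup>2 * lg_DV w) (at w)" by simp
  have c3q: "cosh w ^ 3 * q \<noteq> 0" using c0 q by simp
  have "(lg_DV has_field_derivative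
     (\<kappa> * (U / 2) * (sinh w / (2 * q)) * y0 w + y1 w * (\<kappa> * cosh w) * (\<kappa> * (U / 2) * q))
     - (1 / 2 * ((cosh w * (cosh w ^ 3 * q) - sinh w * (3 * (cosh w)\<^sup>2 * sinh w * q + sinh w / (2 * q) * cosh w ^ 3)) / ((cosh w ^ 3 * q) * (cosh w ^ 3 * q))) * y1 w
        + \<kappa> * (U / 2) * cosh w ^ 3 * y0 w * (1 / 2 * (sinh w / (cosh w ^ 3 * q))))) (at w)"
    unfolding DV q_def
    by (intro DERIV_diff DERIV_mult DERIV_cmult DERIV_divide dq[unfolded q_def] dy0 dy1 dc dsh c3q[unfolded q_def])
  moreover have "(\<kappa> * (U / 2) * (sinh w / (2 * q)) * y0 w + y1 w * (\<kappa> * cosh w) * (\<kappa> * (U / 2) * q))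
     - (1 / 2 * ((cosh w * (cosh w ^ 3 * q) - sinh w * (3 * (cosh w)\<^sup>2 * sinh w * q + sinh w / (2 * q) * cosh w ^ 3)) / ((cosh w ^ 3 * q) * (cosh w ^ 3 * q))) * y1 w
        + \<kappa> * (U / 2) * cosh w ^ 3 * y0 w * (1 / 2 * (sinh w / (cosh w ^ 3 * q))))
     = (cosh w)\<^sup>2 * ((U\<^sup>2 + (7 * (sinh w / cosh w)\<^sup>2 - 2) / (4 * cosh w ^ 4)) * (y1 w / q))"
  proof -
    have "y1 w * (\<kappa> * cosh w) * (\<kappa> * (U / 2) * q) = U\<^sup>2 * cosh w * q * y1 w"
      using \<kappa> by (simp add: power2_eq_square U_def)
    thus ?thesis unfolding q(2) using q(1)
      by (simp add: field_simps power2_eq_square power3_eq_cube power4_eq_xxxx)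
  qed
  moreover have "2 * F_tilde 1 (tanh w) = (7 * (sinh w / cosh w)\<^sup>2 - 2) / (4 * cosh w ^ 4)"
  proof -
    have "2 * F_tilde 1 (tanh w) = (7 * (sinh w / cosh w)\<^sup>2 - 2) * (1 / (cosh w)\<^sup>2)\<^sup>2 / 4"
      unfolding F_tilde_1 one_minus_tanh_square[OF c0] by (simp add: tanh_def)
    also have "(1 / (cosh w)\<^sup>2)\<^sup>2 = 1 / cosh w ^ 4" by (simp add: power_divide flip: power_mult)
    finally show ?thesis by simp
  qed
  ultimately show "(lg_DV has_field_derivative (cosh w)\<^sup>2 * (((of_real u)\<^sup>2 + 2 * F_tilde 1 (tanh w)) * lg_V w)) (at w)"
    by (simp add: V q_def U_def)
qed

text \<open>Dividing V by the approximation turns V'' = (u^2 + 2 F_1) V into an equation for the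
  ratio; by \<open>lg_riccati\<close> only R survives as a source.\<close>

lemma lg_error_derivs:
  assumes "cosh w \<notin> \<real>\<^sub>\<le>\<^sub>0"
  shows "(lg_eta has_field_derivative (cosh w)\<^sup>2 * lg_theta w) (at w)"
    and "(lg_theta has_field_derivative (cosh w)\<^sup>2 * (- lg_R w * (1 + lg_eta w) + 2 * (of_real u - lg_g w) * lg_theta w)) (at w)"
proof -
  have c0: "cosh w \<noteq> 0" using assms by auto
  define A where "A w = lg_const * exp (lg_exponent w)" for w
  have A0: "A w \<noteq> 0" for w using lg_const_nonzero by (simp add: A_def)
  define G where "G = lg_g w - of_real u"
  have dA: "(A has_field_derivative A w * ((cosh w)\<^sup>2 * G)) (at w)"
    unfolding A_def[abs_def] G_def
    using DERIV_cmult[OF DERIV_chain2[OF DERIV_exp lg_exponent_deriv[OF c0]], of lg_const] by (simp add: mult.assoc)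
  have "(lg_eta has_field_derivative ((cosh w)\<^sup>2 * lg_DV w * A w - lg_V w * (A w * ((cosh w)\<^sup>2 * G))) / (A w * A w) - 0) (at w)"
    unfolding lg_eta_def[abs_def] A_def[symmetric]
    by (intro DERIV_diff DERIV_const DERIV_divide lg_V_derivs assms dA A0)
  moreover have "((cosh w)\<^sup>2 * lg_DV w * A w - lg_V w * (A w * ((cosh w)\<^sup>2 * G))) / (A w * A w) - 0 = (cosh w)\<^sup>2 * lg_theta w"
    unfolding lg_theta_def A_def[symmetric] G_def[symmetric] using A0 by (simp add: field_simps)
  ultimately show "(lg_eta has_field_derivative (cosh w)\<^sup>2 * lg_theta w) (at w)" by simp
  have ric: "(of_real u)\<^sup>2 + 2 * F_tilde 1 (tanh w) = lg_Dg w + G\<^sup>2 - lg_R w"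
    using lg_riccati[of w] by (simp add: G_def)
  define C where "C = (cosh w)\<^sup>2"
  have "(lg_theta has_field_derivative
     ((C * ((lg_Dg w + G\<^sup>2 - lg_R w) * lg_V w) - ((C * lg_Dg w - 0) * lg_V w + C * lg_DV w * (lg_g w - of_real u))) * A w
        - (lg_DV w - (lg_g w - of_real u) * lg_V w) * (A w * (C * G))) / (A w * A w)) (at w)"
    unfolding lg_theta_def[abs_def] A_def[symmetric] C_def ric[symmetric]
    by (intro DERIV_diff DERIV_const DERIV_divide DERIV_mult lg_V_derivs lg_g_deriv assms dA[unfolded C_def] A0 c0)
  moreover have "((C * ((lg_Dg w + G\<^sup>2 - lg_R w) * lg_V w) - ((C * lg_Dg w - 0) * lg_V w + C * lg_DV w * (lg_g w - of_real u))) * A w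
        - (lg_DV w - (lg_g w - of_real u) * lg_V w) * (A w * (C * G))) / (A w * A w)
     = C * (- lg_R w * (lg_V w / A w) - 2 * G * ((lg_DV w - G * lg_V w) / A w))"
    unfolding G_def[symmetric] using A0 by (simp add: field_simps power2_eq_square)
  moreover have "1 + lg_eta w = lg_V w / A w" "lg_theta w = (lg_DV w - G * lg_V w) / A w"
    by (simp_all add: lg_eta_def lg_theta_def A_def G_def)
  moreover have "2 * (of_real u - lg_g w) = - 2 * G" by (simp add: G_def)
  ultimately show "(lg_theta has_field_derivative (cosh w)\<^sup>2 * (- lg_R w * (1 + lg_eta w) + 2 * (of_real u - lg_g w) * lg_theta w)) (at w)"
    by (simp add: C_def)
qed

text \<open>Fixes the constant of the theorem. Far out z and r = cosh w differ by 1 / (z + r), so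
  the leading form of U' and the approximation can be compared through logarithms; all growing terms
  cancel and the limit of the rest matches \<open>lg_const\<close>.\<close>

lemma lg_error_limits:
  fixes w :: "real \<Rightarrow> complex"
  assumes im: "\<forall>\<^sub>F t in F. \<bar>Im (w t)\<bar> < pi / 2" and re: "filterlim (\<lambda>t. Re (sinh (w t))) at_top F"
  shows "((\<lambda>t. lg_eta (w t)) \<longlongrightarrow> 0) F" "((\<lambda>t. lg_theta (w t)) \<longlongrightarrow> 0) F"
proof -
  define z r where "z t = sinh (w t)" and "r t = cosh (w t)" for t
  define \<kappa> where "\<kappa> = sqrt (2 * u)"
  have \<kappa>: "\<kappa> > 0" using u by (simp add: \<kappa>_def)
  have re_z: "filterlim (\<lambda>t. Re (z t)) at_top F" using re by (simp add: z_def)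
  have zpos: "\<forall>\<^sub>F t in F. Re (z t) > 0" using re_z by (simp add: filterlim_at_top_dense)
  have rpos: "\<forall>\<^sub>F t in F. Re (r t) > 0" using im by eventually_elim (simp add: r_def cosh_nonzero_off_branch)
  have znz: "\<forall>\<^sub>F t in F. z t \<noteq> 0" using zpos by eventually_elim auto
  have inf: "filterlim z at_infinity F"
    unfolding filterlim_at_infinity_conv_norm_at_top
    by (rule filterlim_at_top_mono[OF re_z]) (auto intro!: always_eventually complex_Re_le_cmod)
  have diff: "(z t + r t) * (r t - z t) = 1" for t
    using hyperbolic_pythagoras[of "w t"] by (simp add: z_def r_def algebra_simps power2_eq_square)
  have "filterlim (\<lambda>t. z t + r t) at_infinity F"
    unfolding filterlim_at_infinity_conv_norm_at_top
  proof (rule filterlim_at_top_mono[OF re_z])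
    show "\<forall>\<^sub>F t in F. Re (z t) \<le> norm (z t + r t)"
      using rpos
    proof eventually_elim
      case (elim t)
      thus ?case using complex_Re_le_cmod[of "z t + r t"] by simp
    qed
  qed
  hence "((\<lambda>t. inverse (z t + r t)) \<longlongrightarrow> 0) F" by (rule filterlim_compose[OF tendsto_inverse_0])
  moreover have "inverse (z t + r t) = r t - z t" for t by (rule inverse_unique[OF diff])
  ultimately have rz: "((\<lambda>t. r t - z t) \<longlongrightarrow> 0) F" by simp
  have iz: "((\<lambda>t. inverse (z t)) \<longlongrightarrow> 0) F" by (rule filterlim_compose[OF tendsto_inverse_0 inf])
  define y where "y t = r t / z t" for t
  have y: "(y \<longlongrightarrow> 1) F"
  proof (rule Lim_transform_eventually)
    show "((\<lambda>t. 1 + (r t - z t) * inverse (z t)) \<longlongrightarrow> 1) F"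
      using tendsto_add[OF tendsto_const[of 1] tendsto_mult[OF rz iz]] by simp
    show "\<forall>\<^sub>F t in F. 1 + (r t - z t) * inverse (z t) = y t"
      using znz by eventually_elim (simp add: y_def field_simps)
  qed
  have ypos: "\<forall>\<^sub>F t in F. Re (y t) > 0"
    using tendsto_Re[OF y] by (rule order_tendstoD(1)) simp
  have rnz: "\<forall>\<^sub>F t in F. r t \<noteq> 0" using rpos by eventually_elim auto
  have tanh_y: "tanh (w t) = inverse (y t)" for t by (simp add: tanh_def y_def z_def r_def)
  have \<beta>: "((\<lambda>t. tanh (w t)) \<longlongrightarrow> 1) F"
    unfolding tanh_y using tendsto_inverse[OF y] by simp
  have S: "((\<lambda>t. \<Sum>s = 1..n - 1. (- 1) ^ s * (E_tilde s (tanh (w t)) - E_tilde s 1) / of_real u ^ s) \<longlongrightarrow> 0) F"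
  proof (rule tendsto_null_sum)
    fix s
    have "isCont (E_tilde s) 1" by (rule DERIV_isCont[OF E_tilde_has_field_derivative])
    from isCont_tendsto_compose[OF this \<beta>]
    have "((\<lambda>t. (- 1) ^ s * (E_tilde s (tanh (w t)) - E_tilde s 1) / of_real u ^ s) \<longlongrightarrow> (- 1) ^ s * (E_tilde s 1 - E_tilde s 1) / of_real u ^ s) F"
      using u by (intro tendsto_intros) auto
    thus "((\<lambda>t. (- 1) ^ s * (E_tilde s (tanh (w t)) - E_tilde s 1) / of_real u ^ s) \<longlongrightarrow> 0) F" by simp
  qed
  \<comment> \<open>F_s vanishes at beta = 1 because of its factor (1 - beta^2)^2.\<close>
  have g: "((\<lambda>t. lg_g (w t)) \<longlongrightarrow> 0) F"
    unfolding lg_g_def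
  proof (rule tendsto_null_sum)
    fix s
    have "isCont (F_tilde s) 1"
      using holomorphic_on_imp_continuous_on[OF F_tilde_holomorphic] by (simp add: continuous_on_eq_continuous_at)
    from isCont_tendsto_compose[OF this \<beta>]
    have "((\<lambda>t. F_tilde s (tanh (w t)) * (- 1 / of_real u) ^ s) \<longlongrightarrow> F_tilde s 1 * (- 1 / of_real u) ^ s) F"
      by (intro tendsto_intros)
    thus "((\<lambda>t. F_tilde s (tanh (w t)) * (- 1 / of_real u) ^ s) \<longlongrightarrow> 0) F" by (simp add: F_tilde_def)
  qed
  define x where "x t = of_real \<kappa> * z t" for t
  define lead where "lead t = pcU_leading (u / 2) (x t)" for t
  have pcU: "pcU = gauss_pcU (u / 2)" unfolding pcU_def using u by (intro parabolic_cylinder_U_eq) simp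
  \<comment> \<open>Re z > 0 keeps the argument within pi/2, so the sector with margin pi/4 serves
    for every approach to infinity.\<close>
  have sector: "filterlim x (inf at_infinity (principal {z. \<bar>Arg z\<bar> \<le> 3 / 4 * pi - pi / 4})) F"
    unfolding filterlim_inf filterlim_principal
  proof
    show "filterlim x at_infinity F"
      unfolding x_def[abs_def] using inf \<kappa> by (intro tendsto_mult_filterlim_at_infinity[OF tendsto_const]) auto
    show "\<forall>\<^sub>F t in F. x t \<in> {z. \<bar>Arg z\<bar> \<le> 3 / 4 * pi - pi / 4}"
      using zpos
    proof eventually_elim
      case (elim t)
      have "Re (x t) > 0" using elim \<kappa> by (simp add: x_def)
      hence "\<bar>Arg (x t)\<bar> < pi / 2" using Arg_Re_pos by blast
      thus ?case by simp
    qed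
  qed
  have f0: "((\<lambda>t. pcU (x t) / lead t) \<longlongrightarrow> 1) F" and f1: "((\<lambda>t. deriv pcU (x t) / (x t * lead t)) \<longlongrightarrow> - 1 / 2) F"
    unfolding lead_def pcU
    by (rule filterlim_compose[OF gauss_pcU_asymptotic(1) sector], use u in auto)
       (rule filterlim_compose[OF gauss_pcU_asymptotic(2) sector, simplified], use u in auto)
  have lead_nz: "\<forall>\<^sub>F t in F. x t * lead t \<noteq> 0"
    using znz by eventually_elim (use \<kappa> in \<open>auto simp: lead_def x_def pcU_leading_nonzero\<close>)
  define \<Phi> where "\<Phi> t = lg_const * exp (lg_exponent (w t))" for t
  have \<Phi>_nz: "\<Phi> t \<noteq> 0" for t using lg_const_nonzero by (simp add: \<Phi>_def)
  \<comment> \<open>U' behaves like -x/2 times the leading form, so V divided by the approximation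
    tends to 1 once this ratio tends to -2.\<close>
  have ratio: "((\<lambda>t. x t * lead t / (csqrt (r t) * \<Phi> t)) \<longlongrightarrow> - 2) F"
  proof (rule Lim_transform_eventually)
    define U :: complex where "U = of_real u"
    \<comment> \<open>The logarithm of the ratio up to a constant, after inserting w = Ln z + Ln (1
      + y) and z r = z^2 + 1 / (1 + y): the terms in Ln z and z^2 have cancelled.\<close>
    define L where "L t = - Ln (y t) / 2 + U / 2 * (1 / (1 + y t)) + U / 2 * Ln (1 + y t)
       - (\<Sum>s = 1..n - 1. (- 1) ^ s * (E_tilde s (tanh (w t)) - E_tilde s 1) / of_real u ^ s)" for t
    define C where "C = of_real \<kappa> * exp (- (U / 2 + 1 / 2) * of_real (ln \<kappa>)) / lg_const"
    have "(L \<longlongrightarrow> - Ln 1 / 2 + U / 2 * (1 / (1 + 1)) + U / 2 * Ln (1 + 1) - 0) F"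
      unfolding L_def[abs_def] by (intro tendsto_intros y S) auto
    hence "((\<lambda>t. C * exp (L t)) \<longlongrightarrow> C * exp (- Ln 1 / 2 + U / 2 * (1 / (1 + 1)) + U / 2 * Ln (1 + 1) - 0)) F"
      by (intro tendsto_intros)
    also have "C * exp (- Ln 1 / 2 + U / 2 * (1 / (1 + 1)) + U / 2 * Ln (1 + 1) - 0) = - 2"
    proof -
      have "complex_of_real (\<kappa> * exp (- (u / 2 + 1 / 2) * ln \<kappa>) * exp (u / 4 + u / 2 * ln 2))
        = of_real \<kappa> * exp (- (U / 2 + 1 / 2) * of_real (ln \<kappa>)) * exp (U / 4 + U / 2 * Ln 2)"
        by (simp add: U_def exp_of_real[symmetric] Ln_of_real[symmetric])
      \<comment> \<open>At y = 1 the value is kappa^((1 - u)/2) exp (u/4) 2^(u/2), and kappa^2 = 2 u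
        turns it into (2 e / u)^(u/4) (2 u)^(1/4).\<close>
      moreover have "\<kappa> * exp (- (u / 2 + 1 / 2) * ln \<kappa>) * exp (u / 4 + u / 2 * ln 2)
        = (2 * exp 1 / u) powr (u / 4) * (2 * u) powr (1 / 4)"
      proof -
        have "\<kappa> = exp (ln \<kappa>)" using \<kappa> by simp
        hence "\<kappa> * exp (- (u / 2 + 1 / 2) * ln \<kappa>) * exp (u / 4 + u / 2 * ln 2)
          = exp (ln \<kappa> + - (u / 2 + 1 / 2) * ln \<kappa> + (u / 4 + u / 2 * ln 2))"
          by (metis exp_add)
        also have "ln \<kappa> + - (u / 2 + 1 / 2) * ln \<kappa> + (u / 4 + u / 2 * ln 2)
          = u / 4 * (ln 2 + 1 - ln u) + 1 / 4 * (ln 2 + ln u)"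
        proof -
          have "ln \<kappa> = (ln 2 + ln u) / 2" using u by (simp add: \<kappa>_def ln_sqrt ln_mult)
          show ?thesis unfolding \<open>ln \<kappa> = (ln 2 + ln u) / 2\<close> by (simp add: field_simps)
        qed
        also have "exp \<dots> = (2 * exp 1 / u) powr (u / 4) * (2 * u) powr (1 / 4)"
          using u by (simp add: powr_def exp_add ln_mult ln_div)
        finally show ?thesis .
      qed
      ultimately have "of_real \<kappa> * exp (- (U / 2 + 1 / 2) * of_real (ln \<kappa>)) * exp (U / 4 + U / 2 * Ln 2)
        = complex_of_real ((2 * exp 1 / u) powr (u / 4) * (2 * u) powr (1 / 4))" by metis
      also have "\<dots> = - 2 * lg_const" by (simp add: lg_const_def)
      finally have "of_real \<kappa> * exp (- (U / 2 + 1 / 2) * of_real (ln \<kappa>)) * exp (U / 4 + U / 2 * Ln 2) = - 2 * lg_const" .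
      thus ?thesis using lg_const_nonzero by (simp add: C_def field_simps)
    qed
    finally show "((\<lambda>t. C * exp (L t)) \<longlongrightarrow> - 2) F" .
    show "\<forall>\<^sub>F t in F. C * exp (L t) = x t * lead t / (csqrt (r t) * \<Phi> t)"
      using zpos ypos im znz rnz
    proof eventually_elim
      case (elim t)
      have y0: "y t \<noteq> 0" "1 + y t \<noteq> 0" "Re (1 + y t) > 0" using elim by (auto simp: complex_eq_iff)
      have arg: "\<bar>Im (Ln (z t))\<bar> < pi / 2" "\<bar>Im (Ln (y t))\<bar> < pi / 2" "\<bar>Im (Ln (1 + y t))\<bar> < pi / 2"
        using Re_Ln_pos_lt[of "z t"] Re_Ln_pos_lt[of "y t"] Re_Ln_pos_lt[of "1 + y t"] elim y0 by blast+
      have rzy: "r t = z t * y t" using elim by (simp add: y_def)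
      have Lr: "Ln (r t) = Ln (z t) + Ln (y t)"
        unfolding rzy by (rule Ln_times_simple) (use elim y0 arg in auto)
      have zr: "z t + r t = z t * (1 + y t)" by (simp add: rzy ring_distribs)
      have "Ln (z t + r t) = Ln (z t) + Ln (1 + y t)"
        unfolding zr by (rule Ln_times_simple) (use elim y0 arg in auto)
      moreover have "Ln (z t + r t) = w t"
        using principal_sinh(1,3)[OF elim(3)] by (simp add: z_def r_def)
      ultimately have w: "w t = Ln (z t) + Ln (1 + y t)" by simp
      have Lx: "Ln (x t) = of_real (ln \<kappa>) + Ln (z t)"
        unfolding x_def using \<kappa> elim by (simp add: Ln_times_of_real Ln_of_real)
      have x0: "x t \<noteq> 0" using elim \<kappa> by (simp add: x_def)
      have prod: "z t * r t = (z t)\<^sup>2 + 1 / (1 + y t)"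
      proof -
        have "z t * (1 + y t) * (r t - z t) = 1" using diff[of t] zr by simp
        thus ?thesis using y0 by (simp add: field_simps power2_eq_square)
      qed
      have x2: "(x t)\<^sup>2 / 4 = U / 2 * (z t)\<^sup>2"
      proof -
        have "of_real \<kappa> ^ 2 = 2 * U" using u by (simp add: \<kappa>_def U_def flip: of_real_power)
        thus ?thesis by (simp add: x_def power_mult_distrib)
      qed
      define T where "T = (\<Sum>s = 1..n - 1. (- 1) ^ s * (E_tilde s (tanh (w t)) - E_tilde s 1) / of_real u ^ s)"
      have lexp: "lg_exponent (w t) = - U * (w t + z t * r t) / 2 + T"
        by (simp add: lg_exponent_def Xi_eq U_def T_def z_def r_def)
      have xl: "x t * lead t = exp (Ln (x t) + ((- (U / 2) - 1 / 2) * Ln (x t) - (x t)\<^sup>2 / 4))"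
      proof -
        have "lead t = exp ((- (U / 2) - 1 / 2) * Ln (x t)) * exp (- ((x t)\<^sup>2 / 4))"
          using x0 by (simp add: lead_def pcU_leading_def powr_def U_def)
        moreover have "x t = exp (Ln (x t))" using x0 by simp
        ultimately have "x t * lead t = exp (Ln (x t)) * (exp ((- (U / 2) - 1 / 2) * Ln (x t)) * exp (- ((x t)\<^sup>2 / 4)))" by metis
        thus ?thesis by (simp only: exp_add[symmetric] diff_conv_add_uminus)
      qed
      have quot: "exp P / (exp Q * (c * exp R)) = exp (P - (Q + R)) / c" for P Q R c :: complex
        by (simp only: exp_diff exp_add) (simp add: mult_ac)
      have cr: "csqrt (r t) = exp (Ln (r t) / 2)" using elim by (simp add: csqrt_exp_Ln)
      have "x t * lead t / (csqrt (r t) * \<Phi> t)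
        = exp (Ln (x t) + ((- (U / 2) - 1 / 2) * Ln (x t) - (x t)\<^sup>2 / 4) - (Ln (r t) / 2 + lg_exponent (w t))) / lg_const"
        unfolding xl cr \<Phi>_def by (rule quot)
      also have "Ln (x t) + ((- (U / 2) - 1 / 2) * Ln (x t) - (x t)\<^sup>2 / 4) - (Ln (r t) / 2 + lg_exponent (w t))
        = (of_real (ln \<kappa>) + (- (U / 2 + 1 / 2) * of_real (ln \<kappa>))) + L t"
        unfolding L_def T_def[symmetric] lexp unfolding x2 Lr Lx prod unfolding w
        by (simp add: ring_distribs add_divide_distrib diff_divide_distrib)
      also have "exp \<dots> = of_real \<kappa> * exp (- (U / 2 + 1 / 2) * of_real (ln \<kappa>)) * exp (L t)"
        using \<kappa> by (simp only: exp_add exp_of_real exp_ln)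
      finally show ?case by (simp add: C_def)
    qed
  qed
  have V: "((\<lambda>t. lg_V (w t) / \<Phi> t) \<longlongrightarrow> 1) F"
  proof (rule Lim_transform_eventually)
    show "((\<lambda>t. (deriv pcU (x t) / (x t * lead t)) * (x t * lead t / (csqrt (r t) * \<Phi> t))) \<longlongrightarrow> 1) F"
      using tendsto_mult[OF f1 ratio] by simp
    show "\<forall>\<^sub>F t in F. (deriv pcU (x t) / (x t * lead t)) * (x t * lead t / (csqrt (r t) * \<Phi> t)) = lg_V (w t) / \<Phi> t"
      using lead_nz by eventually_elim (simp add: lg_V_def x_def \<kappa>_def z_def r_def)
  qed
  \<comment> \<open>DV / V tends to -u because U / U' behaves like -2 / x; so the derivative also
    matches that of the approximation to leading order.\<close>
  have DV: "((\<lambda>t. lg_DV (w t) / \<Phi> t) \<longlongrightarrow> - of_real u) F"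
  proof (rule Lim_transform_eventually)
    have "((\<lambda>t. lg_V (w t) / \<Phi> t * (of_real (u / 2) * y t * ((pcU (x t) / lead t) / (deriv pcU (x t) / (x t * lead t)))
         - 1 / 2 * (inverse (z t))\<^sup>2 * inverse (y t) ^ 3)) \<longlongrightarrow> 1 * (of_real (u / 2) * 1 * (1 / (- 1 / 2)) - 1 / 2 * 0\<^sup>2 * inverse 1 ^ 3)) F"
      by (intro tendsto_intros V y f0 f1 iz) auto
    thus "((\<lambda>t. lg_V (w t) / \<Phi> t * (of_real (u / 2) * y t * ((pcU (x t) / lead t) / (deriv pcU (x t) / (x t * lead t)))
         - 1 / 2 * (inverse (z t))\<^sup>2 * inverse (y t) ^ 3)) \<longlongrightarrow> - of_real u) F" by simp
    have "\<forall>\<^sub>F t in F. deriv pcU (x t) / (x t * lead t) \<noteq> 0"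
      by (rule tendsto_imp_eventually_ne[OF f1]) simp
    thus "\<forall>\<^sub>F t in F. lg_V (w t) / \<Phi> t * (of_real (u / 2) * y t * ((pcU (x t) / lead t) / (deriv pcU (x t) / (x t * lead t)))
         - 1 / 2 * (inverse (z t))\<^sup>2 * inverse (y t) ^ 3) = lg_DV (w t) / \<Phi> t"
      using lead_nz znz rnz
    proof eventually_elim
      case (elim t)
      define q where "q = csqrt (r t)"
      have q: "r t = q\<^sup>2" "q \<noteq> 0" using elim by (auto simp: q_def)
      define d where "d = deriv pcU (x t)"
      have d: "d \<noteq> 0" "lead t \<noteq> 0" "x t \<noteq> 0" using elim by (auto simp: d_def)
      have V': "lg_V (w t) = d / q" by (simp add: lg_V_def d_def q_def x_def \<kappa>_def z_def r_def)
      have DV': "lg_DV (w t) = of_real \<kappa> * of_real (u / 2) * q * pcU (x t) - 1 / 2 * z t / (r t ^ 3 * q) * d"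
        by (simp add: lg_DV_def d_def q_def x_def \<kappa>_def z_def r_def)
      have e1: "of_real (u / 2) * y t * ((pcU (x t) / lead t) / (d / (x t * lead t))) = of_real (u / 2) * of_real \<kappa> * r t * pcU (x t) / d"
        using d elim by (simp add: y_def x_def field_simps)
      have e2: "1 / 2 * (inverse (z t))\<^sup>2 * inverse (y t) ^ 3 = 1 / 2 * z t / r t ^ 3"
        using elim by (simp add: y_def field_simps power2_eq_square power3_eq_cube)
      show ?case
        unfolding V' DV' d_def[symmetric] e1 e2 unfolding q(1) using d q(2) \<Phi>_nz[of t]
        by (simp add: field_simps power2_eq_square)
    qed
  qed
  show "((\<lambda>t. lg_eta (w t)) \<longlongrightarrow> 0) F"
    unfolding lg_eta_def \<Phi>_def[symmetric] using tendsto_diff[OF V tendsto_const[of 1]] by simp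
  have "((\<lambda>t. lg_DV (w t) / \<Phi> t - (lg_g (w t) - of_real u) * (lg_V (w t) / \<Phi> t)) \<longlongrightarrow> - of_real u - (0 - of_real u) * 1) F"
    by (intro tendsto_intros V DV g)
  thus "((\<lambda>t. lg_theta (w t)) \<longlongrightarrow> 0) F"
    unfolding lg_theta_def \<Phi>_def[symmetric] by (simp add: diff_divide_distrib)
qed

end

subsection \<open>The error bound along a path\<close>

lemma has_vector_derivative_within_Icc_at:
  fixes f :: "real \<Rightarrow> complex"
  assumes "c < t" "t < d" "(f has_vector_derivative f') (at t within {c..d})"
  shows "(f has_vector_derivative f') (at t)"
  using assms at_within_Icc_at[of c t d] by simp

lemma R2_arc_on_subset: "R2_arc_on \<gamma> I \<Longrightarrow> J \<subseteq> I \<Longrightarrow> R2_arc_on \<gamma> J"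
  unfolding R2_arc_on_def
  by (elim exE conjE, rule exI, rule exI)
     (auto intro: has_vector_derivative_within_subset continuous_on_subset)

text \<open>The last arc of a path is unbounded, while the Gronwall step needs compact arcs; it is
  cut at a time not before T.\<close>

lemma R2_chain_truncate:
  assumes "R2_chain \<gamma>"
  obtains \<sigma> N where "\<sigma> 0 = 0" "\<sigma> N \<ge> T" "\<And>i. i < N \<Longrightarrow> \<sigma> i < \<sigma> (Suc i)" "\<And>i. i < N \<Longrightarrow> R2_arc_on \<gamma> {\<sigma> i..\<sigma> (Suc i)}"
proof -
  obtain m \<tau> where \<tau>: "\<tau> 0 = 0" "\<And>i. i < m \<Longrightarrow> \<tau> i < \<tau> (Suc i)"
    "\<And>i. i < m \<Longrightarrow> R2_arc_on \<gamma> {\<tau> i..\<tau> (Suc i)}" "R2_arc_on \<gamma> {\<tau> m..}"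
    using assms by (auto simp: R2_chain_def)
  \<comment> \<open>The summand 1 keeps the last arc nondegenerate.\<close>
  define \<sigma> where "\<sigma> i = (if i \<le> m then \<tau> i else max T (\<tau> m + 1))" for i
  have "R2_arc_on \<gamma> {\<tau> m..max T (\<tau> m + 1)}" by (rule R2_arc_on_subset[OF \<tau>(4)]) auto
  hence arcs: "R2_arc_on \<gamma> {\<sigma> i..\<sigma> (Suc i)} \<and> \<sigma> i < \<sigma> (Suc i)" if "i < Suc m" for i
    using that \<tau>(2,3)[of i] by (cases "i = m") (auto simp: \<sigma>_def)
  show ?thesis by (rule that[of \<sigma> "Suc m"]) (use arcs \<tau>(1) in \<open>auto simp: \<sigma>_def\<close>)
qed

text \<open>The \<open>vector_derivative\<close> in \<open>abs_path_integral\<close> is known only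
  inside the arcs. Comparing on the disjoint open intervals avoids the corners, which form a null
  set.\<close>

lemma sum_integral_le_nn_integral:
  fixes a :: "nat \<Rightarrow> real \<Rightarrow> real" and \<sigma> :: "nat \<Rightarrow> real"
  assumes \<sigma>: "\<sigma> 0 = 0" "\<And>i. i < N \<Longrightarrow> \<sigma> i < \<sigma> (Suc i)"
    and a: "\<And>i. i < N \<Longrightarrow> continuous_on {\<sigma> i..\<sigma> (Suc i)} (a i)" "\<And>i t. i < N \<Longrightarrow> \<sigma> i \<le> t \<Longrightarrow> t \<le> \<sigma> (Suc i) \<Longrightarrow> a i t \<ge> 0"
    and \<phi>: "\<And>i t. i < N \<Longrightarrow> \<sigma> i < t \<Longrightarrow> t < \<sigma> (Suc i) \<Longrightarrow> \<phi> t = a i t"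
  shows "(\<Sum>i<N. ennreal (integral {\<sigma> i..\<sigma> (Suc i)} (a i))) \<le> (\<integral>\<^sup>+ t\<in>{0..}. ennreal (\<phi> t) \<partial>lborel)"
proof -
  define I where "I i = {\<sigma> i<..<\<sigma> (Suc i)}" for i
  have one: "ennreal (integral {\<sigma> i..\<sigma> (Suc i)} (a i)) = (\<integral>\<^sup>+ t. ennreal (a i t) * indicator (I i) t \<partial>lborel)"
    and meas: "(\<lambda>t. ennreal (a i t) * indicator (I i) t) \<in> borel_measurable lborel" if i: "i < N" for i
  proof -
    have ai: "a i integrable_on {\<sigma> i..\<sigma> (Suc i)}" by (rule integrable_continuous_real[OF a(1)[OF i]])
    have aI: "(a i has_integral integral {\<sigma> i..\<sigma> (Suc i)} (a i)) (I i)"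
    proof (rule has_integral_spike_set_eq[THEN iffD1, OF _ _ integrable_integral[OF ai]])
      show "negligible {x \<in> {\<sigma> i..\<sigma> (Suc i)} - I i. a i x \<noteq> 0}"
        by (rule negligible_subset[of "{\<sigma> i, \<sigma> (Suc i)}"]) (auto simp: I_def)
      show "negligible {x \<in> I i - {\<sigma> i..\<sigma> (Suc i)}. a i x \<noteq> 0}"
        by (rule negligible_subset[of "{}"]) (auto simp: I_def)
    qed
    have cI: "continuous_on (I i) (a i)" by (rule continuous_on_subset[OF a(1)[OF i]]) (auto simp: I_def)
    have b: "(\<lambda>t. indicator (I i) t *\<^sub>R a i t) \<in> borel_measurable borel"
      by (rule borel_measurable_continuous_on_indicator[OF _ cI]) (auto simp: I_def)
    have e: "ennreal (indicator (I i) t *\<^sub>R a i t) = ennreal (a i t) * indicator (I i) t" for t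
      by (auto simp: indicator_def)
    show "(\<lambda>t. ennreal (a i t) * indicator (I i) t) \<in> borel_measurable lborel"
      unfolding e[symmetric] using b by measurable
    have "((\<lambda>t. indicator (I i) t *\<^sub>R a i t) has_integral integral {\<sigma> i..\<sigma> (Suc i)} (a i)) UNIV"
    proof -
      have "(\<lambda>t. indicator (I i) t *\<^sub>R a i t) = (\<lambda>t. if t \<in> I i then a i t else 0)" by (auto simp: indicator_def)
      thus ?thesis using aI by (simp add: has_integral_restrict_UNIV)
    qed
    hence "(\<integral>\<^sup>+ t. ennreal (indicator (I i) t *\<^sub>R a i t) \<partial>lborel) = ennreal (integral {\<sigma> i..\<sigma> (Suc i)} (a i))"
      using b a(2)[OF i] by (intro nn_integral_has_integral_lborel) (auto simp: indicator_def I_def)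
    thus "ennreal (integral {\<sigma> i..\<sigma> (Suc i)} (a i)) = (\<integral>\<^sup>+ t. ennreal (a i t) * indicator (I i) t \<partial>lborel)"
      unfolding e by simp
  qed
  have "(\<Sum>i<N. ennreal (integral {\<sigma> i..\<sigma> (Suc i)} (a i))) = (\<Sum>i<N. \<integral>\<^sup>+ t. ennreal (a i t) * indicator (I i) t \<partial>lborel)"
    by (intro sum.cong one) auto
  also have "\<dots> = (\<integral>\<^sup>+ t. (\<Sum>i<N. ennreal (a i t) * indicator (I i) t) \<partial>lborel)"
    by (rule nn_integral_sum[symmetric]) (use meas in auto)
  also have "\<dots> \<le> (\<integral>\<^sup>+ t\<in>{0..}. ennreal (\<phi> t) \<partial>lborel)"
  proof (rule nn_integral_mono)
    fix t
    show "(\<Sum>i<N. ennreal (a i t) * indicator (I i) t) \<le> ennreal (\<phi> t) * indicator {0..} t"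
    proof (cases "\<exists>j<N. t \<in> I j")
      case True
      then obtain j where j: "j < N" "t \<in> I j" by auto
      have other: "t \<notin> I i" if "i < N" "i \<noteq> j" for i
      proof (cases "i < j")
        case True
        have "\<sigma> (Suc i) \<le> \<sigma> j" by (rule breakpoints_mono[of N]) (use \<sigma> True j in auto)
        thus ?thesis using j by (auto simp: I_def)
      next
        case False
        have "\<sigma> (Suc j) \<le> \<sigma> i" by (rule breakpoints_mono[of N]) (use \<sigma> False that in auto)
        thus ?thesis using j by (auto simp: I_def)
      qed
      have "(\<Sum>i<N. ennreal (a i t) * indicator (I i) t) = (\<Sum>i\<in>{j}. ennreal (a i t) * indicator (I i) t)"
        by (rule sum.mono_neutral_right) (use j other in auto)
      also have "\<dots> = ennreal (a j t)" using j by simp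
      finally have "(\<Sum>i<N. ennreal (a i t) * indicator (I i) t) = ennreal (a j t)" .
      moreover have "\<sigma> 0 \<le> \<sigma> j" by (rule breakpoints_mono[of N]) (use \<sigma> j in auto)
      ultimately show ?thesis using j \<phi>[of j t] \<sigma>(1) by (auto simp: I_def)
    next
      case False
      hence "(\<Sum>i<N. ennreal (a i t) * indicator (I i) t) = 0" by (intro sum.neutral) auto
      thus ?thesis by simp
    qed
  qed
  finally show ?thesis .
qed

text \<open>The exponential factors are at least 1, so the residual of an arc may be multiplied by
  the factors of all later arcs; then all arcs share one exponential.\<close>

lemma gronwall_chain:
  fixes M r k :: "nat \<Rightarrow> real"
  assumes "\<And>i. i < N \<Longrightarrow> M i \<le> (M (Suc i) + r i) * exp (k i)" "\<And>i. i < N \<Longrightarrow> r i \<ge> 0" "\<And>i. i < N \<Longrightarrow> k i \<ge> 0"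
  shows "M 0 \<le> (M N + (\<Sum>i<N. r i)) * exp (\<Sum>i<N. k i)"
  using assms
proof (induction N)
  case (Suc N)
  have "M 0 \<le> (M N + (\<Sum>i<N. r i)) * exp (\<Sum>i<N. k i)" by (rule Suc.IH) (use Suc.prems in auto)
  also have "\<dots> \<le> ((M (Suc N) + r N) * exp (k N) + (\<Sum>i<N. r i) * exp (k N)) * exp (\<Sum>i<N. k i)"
  proof (intro mult_right_mono add_mono)
    show "M N \<le> (M (Suc N) + r N) * exp (k N)" using Suc.prems by auto
    have "(\<Sum>i<N. r i) \<ge> 0" using Suc.prems by (intro sum_nonneg) auto
    moreover have "1 \<le> exp (k N)" using Suc.prems by auto
    ultimately show "(\<Sum>i<N. r i) \<le> (\<Sum>i<N. r i) * exp (k N)" using mult_left_mono by fastforce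
  qed auto
  also have "\<dots> = (M (Suc N) + (\<Sum>i<Suc N. r i)) * exp (\<Sum>i<Suc N. k i)"
    by (simp add: exp_add algebra_simps)
  finally show ?case .
qed auto

context
  fixes u :: real and n :: nat
  assumes u: "u > 0" and n: "n \<ge> 1"
begin

abbreviation "\<eta> \<equiv> lg_eta u n"
abbreviation "\<theta> \<equiv> lg_theta u n"

text \<open>The integrand of the second sum in \<open>omega_tilde\<close>: as d beta = (1 -
  beta^2)^2 d xi, one factor of each product F_k F_(s+n-k-1) d xi turns into E' d beta.\<close>

definition F_bil :: "nat \<Rightarrow> complex \<Rightarrow> complex" where
  "F_bil s p = (\<Sum>k = s..n - 1. (1 - p\<^sup>2)\<^sup>2 * deriv (E_tilde k) p * deriv (E_tilde (s + n - k - 1)) p)"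

definition int_along :: "(real \<Rightarrow> complex) \<Rightarrow> (real \<Rightarrow> complex) \<Rightarrow> real \<Rightarrow> real \<Rightarrow> (complex \<Rightarrow> complex) \<Rightarrow> real" where
  "int_along \<beta> \<beta>' c d f = integral {c..d} (\<lambda>t. cmod (f (\<beta> t) * \<beta>' t))"

text \<open>\<open>arc_error_bound\<close> with the integrals rewritten by F_s d xi = E_s' d beta.
  The derivative of beta is supplied along with the bound, since integrals over closed arcs use its
  continuous extension to the end points.\<close>

lemma arc_lg_error_bound:
  fixes \<gamma> w :: "real \<Rightarrow> complex"
  assumes cd: "c < d" and arc: "R2_arc_on \<gamma> {c..d}" and w: "continuous_on {c..d} w"
    and sinh: "\<And>t. t \<in> {c..d} \<Longrightarrow> sinh (w t) = \<gamma> t" and slit: "\<And>t. t \<in> {c..d} \<Longrightarrow> cosh (w t) \<notin> \<real>\<^sub>\<le>\<^sub>0"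
    and mono: "mono_on {c..d} (\<lambda>t. Re (Xi (w t)))"
  obtains \<beta>' where "continuous_on {c..d} \<beta>'" "\<And>t. c < t \<Longrightarrow> t < d \<Longrightarrow> ((\<lambda>t. tanh (w t)) has_vector_derivative \<beta>' t) (at t)"
    "cmod (\<eta> (w c) - \<theta> (w c) / (2 * of_real u)) + cmod (\<theta> (w c) / (2 * of_real u))
      \<le> (cmod (\<eta> (w d) - \<theta> (w d) / (2 * of_real u)) + cmod (\<theta> (w d) / (2 * of_real u))
         + 1 / u ^ n * (2 * int_along (\<lambda>t. tanh (w t)) \<beta>' c d (deriv (E_tilde n)) + (\<Sum>s = 1..n - 1. 1 / u ^ s * int_along (\<lambda>t. tanh (w t)) \<beta>' c d (F_bil s))))
       * exp (1 / u * (4 * (\<Sum>s<n - 1. 1 / u ^ s * int_along (\<lambda>t. tanh (w t)) \<beta>' c d (deriv (E_tilde (s + 1)))))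
            + 1 / u ^ n * (2 * int_along (\<lambda>t. tanh (w t)) \<beta>' c d (deriv (E_tilde n)) + (\<Sum>s = 1..n - 1. 1 / u ^ s * int_along (\<lambda>t. tanh (w t)) \<beta>' c d (F_bil s))))"
proof -
  from arc obtain \<gamma>' \<gamma>'' where g: "\<forall>t\<in>{c..d}. (\<gamma> has_vector_derivative \<gamma>' t) (at t within {c..d})"
    "\<forall>t\<in>{c..d}. (\<gamma>' has_vector_derivative \<gamma>'' t) (at t within {c..d})"
    unfolding R2_arc_on_def by blast
  have c\<gamma>': "continuous_on {c..d} \<gamma>'"
    unfolding continuous_on_eq_continuous_within using g(2) by (blast intro: has_vector_derivative_continuous)
  have nz: "cosh (w t) \<noteq> 0" if "t \<in> {c..d}" for t using slit[OF that] by auto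
  define w' where "w' t = \<gamma>' t / cosh (w t)" for t
  \<comment> \<open>The lift w is so far only continuous; it inherits smoothness from \<gamma> by
    inverting sinh locally, where cosh does not vanish.\<close>
  have dw: "(w has_vector_derivative w' t) (at t within {c..d})" if t: "t \<in> {c..d}" for t
    unfolding w'_def
  proof (rule has_vector_derivative_local_inverse[where f = sinh and h = \<gamma>])
    show "(sinh has_field_derivative cosh (w t)) (at (w t))"
      using has_field_derivative_sinh[OF DERIV_ident, of "w t"] by simp
  qed (use g t nz sinh w in \<open>auto simp: continuous_on_eq_continuous_within\<close>)
  have cw': "continuous_on {c..d} w'" unfolding w'_def using nz by (intro continuous_intros c\<gamma>' w) auto
  have chain: "((\<lambda>t. f (w t)) has_vector_derivative w' t * f') (at t within {c..d})"
    if "t \<in> {c..d}" "(f has_field_derivative f') (at (w t))" for f f' t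
    using field_vector_diff_chain_within[OF dw[OF that(1)] has_field_derivative_at_within[OF that(2)]] by (simp add: o_def)
  define \<beta> where "\<beta> t = tanh (w t)" for t
  define \<beta>' where "\<beta>' t = w' t * (1 / (cosh (w t))\<^sup>2)" for t
  have d\<beta>: "(\<beta> has_vector_derivative \<beta>' t) (at t within {c..d})" if "t \<in> {c..d}" for t
    unfolding \<beta>_def[abs_def] \<beta>'_def by (rule chain[OF that has_field_derivative_tanh_complex[OF nz[OF that]]])
  have c\<beta>': "continuous_on {c..d} \<beta>'" unfolding \<beta>'_def using nz by (intro continuous_intros cw' w) auto
  have c\<beta>: "continuous_on {c..d} \<beta>"
    unfolding continuous_on_eq_continuous_within using d\<beta> by (blast intro: has_vector_derivative_continuous)
  define X' where "X' t = w' t * (cosh (w t))\<^sup>2" for t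
  have cF: "continuous_on {c..d} (\<lambda>t. f (\<beta> t))" if "f holomorphic_on UNIV" for f
    by (rule continuous_on_compose2[OF holomorphic_on_imp_continuous_on[OF that] c\<beta>]) auto
  have hE: "deriv (E_tilde s) holomorphic_on UNIV" for s by (intro holomorphic_deriv E_tilde_derivs(1) open_UNIV)
  have hB: "F_bil s holomorphic_on UNIV" for s unfolding F_bil_def[abs_def] by (intro holomorphic_intros hE) (auto simp: E_tilde_derivs(1))
  have FX: "F_tilde s (\<beta> t) * X' t = deriv (E_tilde s) (\<beta> t) * \<beta>' t" if "t \<in> {c..d}" for s t
    using nz[OF that] unfolding \<beta>_def F_tilde_tanh[OF nz[OF that]] X'_def \<beta>'_def
    by (simp add: field_simps power2_eq_square power4_eq_xxxx)
  define x :: complex where "x = - 1 / of_real u"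
  have nx: "cmod (x ^ k) = 1 / u ^ k" for k using u by (simp add: x_def norm_power norm_divide power_divide)
  define \<gamma>\<^sub>g where "\<gamma>\<^sub>g t = lg_g u n (w t) * X' t" for t
  define \<rho> where "\<rho> t = lg_R u n (w t) * X' t / of_real u" for t
  define A where "A f t = cmod (f (\<beta> t) * \<beta>' t)" for f t
  have cA: "continuous_on {c..d} (A f)" if "f holomorphic_on UNIV" for f
    unfolding A_def by (intro continuous_intros cF that c\<beta>')
  have iA: "integral {c..d} (A f) = int_along \<beta> \<beta>' c d f" for f by (simp add: A_def[abs_def] int_along_def)
  \<comment> \<open>Shifting the index from s to s + 1 takes out one factor 1/u.\<close>
  have \<gamma>g_le: "4 * cmod (\<gamma>\<^sub>g t) \<le> 1 / u * (4 * (\<Sum>s<n - 1. 1 / u ^ s * A (deriv (E_tilde (s + 1))) t))" if t: "t \<in> {c..d}" for t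
  proof -
    have "\<gamma>\<^sub>g t = (\<Sum>s = 1..n - 1. x ^ s * (deriv (E_tilde s) (\<beta> t) * \<beta>' t))"
      unfolding \<gamma>\<^sub>g_def lg_g_def[OF u n] sum_distrib_right x_def[symmetric] FX[OF t, symmetric] by (simp add: \<beta>_def mult_ac)
    also have "cmod \<dots> \<le> (\<Sum>s = 1..n - 1. 1 / u ^ s * A (deriv (E_tilde s)) t)"
      by (rule order_trans[OF norm_sum]) (simp add: norm_mult[of "x ^ _"] nx A_def)
    also have "\<dots> = (\<Sum>s<n - 1. 1 / u ^ Suc s * A (deriv (E_tilde (Suc s))) t)"
      by (rule sum.reindex_bij_witness[of _ Suc "\<lambda>s. s - 1"]) auto
    also have "\<dots> = 1 / u * (\<Sum>s<n - 1. 1 / u ^ s * A (deriv (E_tilde (s + 1))) t)"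
      by (simp add: sum_distrib_left)
    finally show ?thesis by simp
  qed
  have bil: "(\<Sum>k = s..n - 1. F_tilde k (\<beta> t) * F_tilde (s + n - k - 1) (\<beta> t)) * X' t = F_bil s (\<beta> t) * \<beta>' t" if "t \<in> {c..d}" for s t
  proof -
    have "(\<Sum>k = s..n - 1. F_tilde k (\<beta> t) * F_tilde (s + n - k - 1) (\<beta> t)) * X' t
      = (\<Sum>k = s..n - 1. F_tilde k (\<beta> t) * (deriv (E_tilde (s + n - k - 1)) (\<beta> t) * \<beta>' t))"
      unfolding sum_distrib_right FX[OF that, symmetric] by (simp add: mult_ac)
    thus ?thesis unfolding F_bil_def sum_distrib_right F_tilde_def by (simp add: mult_ac)
  qed
  \<comment> \<open>R carries at least n - 1 powers of 1/u and the division by u adds one: this is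
    the u^(-n) of the theorem.\<close>
  have \<rho>_le: "cmod (\<rho> t) \<le> 1 / u ^ n * (2 * A (deriv (E_tilde n)) t + (\<Sum>s = 1..n - 1. 1 / u ^ s * A (F_bil s) t))" if t: "t \<in> {c..d}" for t
  proof -
    have "\<rho> t = (- 2 * (F_tilde n (\<beta> t) * X' t) * x ^ (n - 1) + (\<Sum>s = 1..n - 1. x ^ (s + n - 1) * ((\<Sum>k = s..n - 1. F_tilde k (\<beta> t) * F_tilde (s + n - k - 1) (\<beta> t)) * X' t))) / of_real u"
      unfolding \<rho>_def lg_R_def[OF u n] x_def[symmetric] \<beta>_def[symmetric] by (simp only: distrib_right sum_distrib_right mult.assoc mult.commute[of "x ^ (n - 1)" "X' t"])
    also have "\<dots> = (- 2 * (deriv (E_tilde n) (\<beta> t) * \<beta>' t) * x ^ (n - 1) + (\<Sum>s = 1..n - 1. x ^ (s + n - 1) * (F_bil s (\<beta> t) * \<beta>' t))) / of_real u"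
      unfolding FX[OF t] bil[OF t] ..
    finally have "cmod (\<rho> t) = cmod (- 2 * (deriv (E_tilde n) (\<beta> t) * \<beta>' t) * x ^ (n - 1) + (\<Sum>s = 1..n - 1. x ^ (s + n - 1) * (F_bil s (\<beta> t) * \<beta>' t))) / u"
      using u by (simp add: norm_divide)
    also have "\<dots> \<le> (2 * A (deriv (E_tilde n)) t * (1 / u ^ (n - 1)) + (\<Sum>s = 1..n - 1. 1 / u ^ (s + n - 1) * A (F_bil s) t)) / u"
    proof (intro divide_right_mono order_trans[OF norm_triangle_ineq] add_mono)
      show "cmod (- 2 * (deriv (E_tilde n) (\<beta> t) * \<beta>' t) * x ^ (n - 1)) \<le> 2 * A (deriv (E_tilde n)) t * (1 / u ^ (n - 1))"
        by (simp only: norm_mult[of _ "x ^ _"] nx) (simp add: A_def norm_mult)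
      show "cmod (\<Sum>s = 1..n - 1. x ^ (s + n - 1) * (F_bil s (\<beta> t) * \<beta>' t)) \<le> (\<Sum>s = 1..n - 1. 1 / u ^ (s + n - 1) * A (F_bil s) t)"
        by (rule order_trans[OF norm_sum]) (simp only: norm_mult[of "x ^ _"] nx A_def order_refl)
    qed (use u in auto)
    also have "\<dots> = 1 / u ^ n * (2 * A (deriv (E_tilde n)) t + (\<Sum>s = 1..n - 1. 1 / u ^ s * A (F_bil s) t))"
    proof -
      have un: "u ^ n = u * u ^ (n - 1)" using n by (metis power_eq_if not_one_le_zero)
      have "1 / u ^ (s + n - 1) = 1 / u ^ (n - 1) * (1 / u ^ s)" for s
      proof -
        have "s + n - 1 = (n - 1) + s" using n by simp
        thus ?thesis by (simp only: power_add) simp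
      qed
      hence "(\<Sum>s = 1..n - 1. 1 / u ^ (s + n - 1) * A (F_bil s) t) = 1 / u ^ (n - 1) * (\<Sum>s = 1..n - 1. 1 / u ^ s * A (F_bil s) t)"
        by (simp only: sum_distrib_left mult.assoc)
      thus ?thesis unfolding un using u by (simp add: field_simps)
    qed
    finally show ?thesis .
  qed
  have cG: "continuous_on {c..d} \<gamma>\<^sub>g" and cR: "continuous_on {c..d} \<rho>"
  proof -
    have cX: "continuous_on {c..d} X'" unfolding X'_def by (intro continuous_intros cw' w)
    show "continuous_on {c..d} \<gamma>\<^sub>g" unfolding \<gamma>\<^sub>g_def lg_g_def[OF u n] \<beta>_def[symmetric]
      by (intro continuous_intros cX cF F_tilde_holomorphic)
    show "continuous_on {c..d} \<rho>" unfolding \<rho>_def lg_R_def[OF u n] \<beta>_def[symmetric]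
      using u by (intro continuous_intros cX cF F_tilde_holomorphic) auto
  qed
  define \<zeta> where "\<zeta> t = \<theta> (w t) / (2 * of_real u)" for t
  define M where "M t = cmod (\<eta> (w t) - \<zeta> t) + cmod (\<zeta> t)" for t
  have d\<eta>: "((\<lambda>t. \<eta> (w t)) has_vector_derivative 2 * of_real u * X' t * \<zeta> t) (at t within {c..d})" if "t \<in> {c..d}" for t
    using chain[OF that lg_error_derivs(1)[OF u n slit[OF that]]] u by (simp add: X'_def \<zeta>_def mult_ac)
  have d\<zeta>: "(\<zeta> has_vector_derivative (2 * of_real u * X' t * \<zeta> t - (\<rho> t * (1 + \<eta> (w t)) / 2 + 2 * \<gamma>\<^sub>g t * \<zeta> t))) (at t within {c..d})" if "t \<in> {c..d}" for t
  proof -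
    have "(\<zeta> has_vector_derivative (w' t * ((cosh (w t))\<^sup>2 * (- lg_R u n (w t) * (1 + \<eta> (w t)) + 2 * (of_real u - lg_g u n (w t)) * \<theta> (w t)))) / (2 * of_real u)) (at t within {c..d})"
      unfolding \<zeta>_def[abs_def] by (intro has_vector_derivative_divide chain[OF that lg_error_derivs(2)[OF u n slit[OF that]]])
    also have "(w' t * ((cosh (w t))\<^sup>2 * (- lg_R u n (w t) * (1 + \<eta> (w t)) + 2 * (of_real u - lg_g u n (w t)) * \<theta> (w t)))) / (2 * of_real u)
      = 2 * of_real u * X' t * \<zeta> t - (\<rho> t * (1 + \<eta> (w t)) / 2 + 2 * \<gamma>\<^sub>g t * \<zeta> t)"
      using u by (simp add: X'_def \<zeta>_def \<rho>_def \<gamma>\<^sub>g_def field_simps)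
    finally show ?thesis .
  qed
  have bound: "M c \<le> (M d + integral {c..d} (\<lambda>t. cmod (\<rho> t))) * exp (integral {c..d} (\<lambda>t. 4 * cmod (\<gamma>\<^sub>g t) + cmod (\<rho> t)))"
    unfolding M_def
  proof (rule arc_error_bound[where \<eta> = "\<lambda>t. \<eta> (w t)" and \<zeta> = \<zeta> and X = "\<lambda>t. Xi (w t)" and X' = X', OF less_imp_le[OF cd] u _ d\<zeta> _ cG cR])
    fix t assume t: "t \<in> {c..d}"
    show "((\<lambda>t. \<eta> (w t) - \<zeta> t) has_vector_derivative \<rho> t * (1 + \<eta> (w t)) / 2 + 2 * \<gamma>\<^sub>g t * \<zeta> t) (at t within {c..d})"
      using has_vector_derivative_diff[OF d\<eta>[OF t] d\<zeta>[OF t]] by simp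
    show "((\<lambda>t. Xi (w t)) has_vector_derivative X' t) (at t within {c..d})"
      unfolding X'_def by (rule chain[OF t has_field_derivative_Xi])
  next
    show "Re (Xi (w s)) \<le> Re (Xi (w t))" if "c \<le> s" "s \<le> t" "t \<le> d" for s t
      using mono_onD[OF mono, of s t] that by auto
  qed
  define \<Omega> where "\<Omega> = 2 * int_along \<beta> \<beta>' c d (deriv (E_tilde n)) + (\<Sum>s = 1..n - 1. 1 / u ^ s * int_along \<beta> \<beta>' c d (F_bil s))"
  define \<Psi> where "\<Psi> = 4 * (\<Sum>s<n - 1. 1 / u ^ s * int_along \<beta> \<beta>' c d (deriv (E_tilde (s + 1))))"
  have hAi: "(A f has_integral int_along \<beta> \<beta>' c d f) {c..d}" if "f holomorphic_on UNIV" for f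
    unfolding iA[symmetric] by (intro integrable_integral integrable_continuous_real cA that)
  have h\<Omega>: "((\<lambda>t. 1 / u ^ n * (2 * A (deriv (E_tilde n)) t + (\<Sum>s = 1..n - 1. 1 / u ^ s * A (F_bil s) t))) has_integral 1 / u ^ n * \<Omega>) {c..d}"
    unfolding \<Omega>_def by (intro has_integral_mult_right has_integral_add has_integral_sum hAi hE hB) auto
  have h\<Psi>: "((\<lambda>t. 1 / u * (4 * (\<Sum>s<n - 1. 1 / u ^ s * A (deriv (E_tilde (s + 1))) t))) has_integral 1 / u * \<Psi>) {c..d}"
    unfolding \<Psi>_def by (intro has_integral_mult_right has_integral_add has_integral_sum hAi hE hB) auto
  have i1: "((\<lambda>t. cmod (\<rho> t)) has_integral integral {c..d} (\<lambda>t. cmod (\<rho> t))) {c..d}"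
    by (intro integrable_integral integrable_continuous_real continuous_intros cR)
  have i2: "((\<lambda>t. 4 * cmod (\<gamma>\<^sub>g t) + cmod (\<rho> t)) has_integral integral {c..d} (\<lambda>t. 4 * cmod (\<gamma>\<^sub>g t) + cmod (\<rho> t))) {c..d}"
    by (intro integrable_integral integrable_continuous_real continuous_intros cR cG)
  have le1: "integral {c..d} (\<lambda>t. cmod (\<rho> t)) \<le> 1 / u ^ n * \<Omega>"
    by (rule has_integral_le[OF i1 h\<Omega>]) (use \<rho>_le in auto)
  have le2: "integral {c..d} (\<lambda>t. 4 * cmod (\<gamma>\<^sub>g t) + cmod (\<rho> t)) \<le> 1 / u * \<Psi> + 1 / u ^ n * \<Omega>"
    by (rule has_integral_le[OF i2 has_integral_add[OF h\<Psi> h\<Omega>]]) (use \<rho>_le \<gamma>g_le in \<open>fastforce intro: add_mono\<close>)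
  have "0 \<le> integral {c..d} (\<lambda>t. cmod (\<rho> t))" by (rule integral_nonneg) (use i1 in auto)
  hence "M c \<le> (M d + 1 / u ^ n * \<Omega>) * exp (1 / u * \<Psi> + 1 / u ^ n * \<Omega>)"
    using le1 le2 by (intro order_trans[OF bound] mult_mono add_mono) (auto simp: M_def)
  thus ?thesis
    using that[OF c\<beta>'] has_vector_derivative_within_Icc_at[OF _ _ d\<beta>] unfolding M_def \<zeta>_def \<Omega>_def \<Psi>_def \<beta>_def[abs_def] by auto
qed

text \<open>On a finite part of the path the Gronwall bound contains the value of M at the far end,
  which tends to 0 by \<open>lg_error_limits\<close>. The arc integrals add up to at most the
  integrals over the whole path, so letting the end go to infinity gives the claim.\<close>

lemma lg_path_error_bound:
  assumes adm: "admissible_path 2 \<gamma> q X"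
  defines "w \<equiv> \<lambda>t. 2 * X t - \<gamma> t * (q t)\<^sup>2"
  shows "within_error_bound n u (beta_path \<gamma> q) (\<eta> (w 0))"
  unfolding within_error_bound_def
proof (intro impI, elim conjE)
  assume fin: "omega_tilde n u (beta_path \<gamma> q) < \<infinity>" "varpi_tilde n u (beta_path \<gamma> q) < \<infinity>"
  have lift: "w t \<in> sheet" "\<gamma> t = sinh (w t)" "q t = csqrt (cosh (w t))" "X t = Xi (w t)" if "t \<ge> 0" for t
    using admissible_lift[OF adm that] by (simp_all add: w_def)
  have cw: "continuous_on {0..} w" using admissible_lift(5)[OF adm, of 0] by (simp add: w_def)
  have chain: "R2_chain \<gamma>" and mono: "mono_on {0..} (\<lambda>t. Re (Xi (w t)))"
    using adm lift(4) by (auto simp: admissible_path_def mono_on_def)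
  have \<beta>: "beta_path \<gamma> q t = tanh (w t)" if "t \<ge> 0" for t
    using lift[OF that] by (simp add: beta_path_def tanh_def)
  define \<omega> where "\<omega> = enn2real (omega_tilde n u (beta_path \<gamma> q))"
  define \<nu> where "\<nu> = enn2real (varpi_tilde n u (beta_path \<gamma> q))"
  define M where "M t = cmod (\<eta> (w t) - \<theta> (w t) / (2 * of_real u)) + cmod (\<theta> (w t) / (2 * of_real u))" for t
  have Mlim: "(M \<longlongrightarrow> 0) at_top"
  proof -
    have re: "filterlim (\<lambda>t. Re (sinh (w t))) at_top at_top"
    proof -
      have "filterlim (\<lambda>t. Re (\<gamma> t)) at_top at_top" using adm by (simp add: admissible_path_def)
      moreover have "\<forall>\<^sub>F t in at_top. Re (\<gamma> t) = Re (sinh (w t))"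
        using eventually_ge_at_top[of 0] by eventually_elim (simp add: lift)
      ultimately show ?thesis by (simp cong: filterlim_cong)
    qed
    have im: "\<forall>\<^sub>F t in at_top. \<bar>Im (w t)\<bar> < pi / 2"
    proof -
      have "\<forall>\<^sub>F t in at_top. X t = xi_bar (\<gamma> t) \<and> q t = (1 + (\<gamma> t)\<^sup>2) powr (1 / 4)"
        using adm by (auto simp: admissible_path_def continued_along_def elim: eventually_mono)
      moreover have "\<forall>\<^sub>F t in at_top. Re (sinh (w t)) > 0" using re by (simp add: filterlim_at_top_dense)
      ultimately show ?thesis using eventually_ge_at_top[of 0]
      proof eventually_elim
        case (elim t)
        note v = arsinh_pr[of "\<gamma> t"]
        have vv: "Re (arsinh_pr (\<gamma> t)) > 0" "\<bar>Im (arsinh_pr (\<gamma> t))\<bar> < pi / 2" using v(5) elim lift by auto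
        hence "arsinh_pr (\<gamma> t) \<in> sheet" by (auto simp: sheet_def)
        \<comment> \<open>Both are preimages of \<gamma> t in the sheet, where sinh is
          injective.\<close>
        hence "arsinh_pr (\<gamma> t) = w t" using lift elim v(1) inj_onD[OF inj_on_sinh_sheet] by metis
        thus ?case using vv by simp
      qed
    qed
    have "(M \<longlongrightarrow> cmod (0 - 0 / (2 * of_real u)) + cmod (0 / (2 * of_real u))) at_top"
      unfolding M_def[abs_def] using u by (intro tendsto_intros lg_error_limits[OF u n im re]) auto
    thus ?thesis by simp
  qed
  have hE: "deriv (E_tilde s) holomorphic_on UNIV" for s by (intro holomorphic_deriv E_tilde_derivs(1) open_UNIV)
  have hB: "F_bil s holomorphic_on UNIV" for s
    unfolding F_bil_def[abs_def] by (intro holomorphic_intros hE) (auto simp: E_tilde_derivs(1))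
  have main: "M 0 \<le> 1 / u ^ n * \<omega> * exp (1 / u * \<nu> + 1 / u ^ n * \<omega>) + e" if e: "e > 0" for e
  proof -
    \<comment> \<open>The exponential of the final bound; an end value below e / E contributes at
      most e.\<close>
    define E where "E = exp (1 / u * \<nu> + 1 / u ^ n * \<omega>)"
    have E: "E > 0" by (simp add: E_def)
    have "\<forall>\<^sub>F t in at_top. M t < e / E" using Mlim by (rule order_tendstoD(2)) (use e E in auto)
    then obtain T where T: "\<And>t. t \<ge> T \<Longrightarrow> M t < e / E" by (auto simp: eventually_at_top_linorder)
    obtain \<sigma> N where \<sigma>: "\<sigma> 0 = 0" "\<sigma> N \<ge> T" "\<And>i. i < N \<Longrightarrow> \<sigma> i < \<sigma> (Suc i)" "\<And>i. i < N \<Longrightarrow> R2_arc_on \<gamma> {\<sigma> i..\<sigma> (Suc i)}"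
      using R2_chain_truncate[OF chain, of T] by blast
    have \<sigma>0: "\<sigma> i \<ge> 0" if "i \<le> N" for i using breakpoints_mono[of N \<sigma> 0 i] \<sigma> that by auto
    define J where "J = (\<lambda>\<beta>' i f. int_along (\<lambda>t. tanh (w t)) \<beta>' (\<sigma> i) (\<sigma> (Suc i)) f)"
    define \<Omega> where "\<Omega> = (\<lambda>\<beta>' i. 2 * J \<beta>' i (deriv (E_tilde n)) + (\<Sum>s = 1..n - 1. 1 / u ^ s * J \<beta>' i (F_bil s)))"
    define \<Psi> where "\<Psi> = (\<lambda>\<beta>' i. 4 * (\<Sum>s<n - 1. 1 / u ^ s * J \<beta>' i (deriv (E_tilde (s + 1)))))"
    have "\<exists>\<beta>'. continuous_on {\<sigma> i..\<sigma> (Suc i)} \<beta>' \<and> (\<forall>t. \<sigma> i < t \<longrightarrow> t < \<sigma> (Suc i) \<longrightarrow> ((\<lambda>t. tanh (w t)) has_vector_derivative \<beta>' t) (at t))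
       \<and> M (\<sigma> i) \<le> (M (\<sigma> (Suc i)) + 1 / u ^ n * \<Omega> \<beta>' i) * exp (1 / u * \<Psi> \<beta>' i + 1 / u ^ n * \<Omega> \<beta>' i)" if i: "i < N" for i
    proof -
      have sub: "{\<sigma> i..\<sigma> (Suc i)} \<subseteq> {0..}" using \<sigma>0[of i] i by auto
      show ?thesis
      proof (rule arc_lg_error_bound[OF \<sigma>(3)[OF i] \<sigma>(4)[OF i], of w])
        show "continuous_on {\<sigma> i..\<sigma> (Suc i)} w" by (rule continuous_on_subset[OF cw sub])
        show "sinh (w t) = \<gamma> t" "cosh (w t) \<notin> \<real>\<^sub>\<le>\<^sub>0" if "t \<in> {\<sigma> i..\<sigma> (Suc i)}" for t
          using lift(1,2)[of t] cosh_not_nonpos_on_sheet that sub by auto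
        show "mono_on {\<sigma> i..\<sigma> (Suc i)} (\<lambda>t. Re (Xi (w t)))"
          by (rule mono_on_subset[OF mono sub])
      qed (unfold M_def \<Omega>_def \<Psi>_def J_def, blast)
    qed
    then obtain \<beta>' where \<beta>': "\<And>i. i < N \<Longrightarrow> continuous_on {\<sigma> i..\<sigma> (Suc i)} (\<beta>' i)"
      "\<And>i t. i < N \<Longrightarrow> \<sigma> i < t \<Longrightarrow> t < \<sigma> (Suc i) \<Longrightarrow> ((\<lambda>t. tanh (w t)) has_vector_derivative \<beta>' i t) (at t)"
      "\<And>i. i < N \<Longrightarrow> M (\<sigma> i) \<le> (M (\<sigma> (Suc i)) + 1 / u ^ n * \<Omega> (\<beta>' i) i) * exp (1 / u * \<Psi> (\<beta>' i) i + 1 / u ^ n * \<Omega> (\<beta>' i) i)"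
      by metis
    define I where "I i f = J (\<beta>' i) i f" for i f
    have Inn: "I i f \<ge> 0" for i f
      unfolding I_def J_def int_along_def by (cases "(\<lambda>t. cmod (f (tanh (w t)) * \<beta>' i t)) integrable_on {\<sigma> i..\<sigma> (Suc i)}")
        (auto intro: integral_nonneg simp: not_integrable_integral)
    have sumI: "(\<Sum>i<N. ennreal (I i f)) \<le> abs_path_integral f (beta_path \<gamma> q)" if f: "f holomorphic_on UNIV" for f
      unfolding I_def J_def int_along_def abs_path_integral_def
    proof (rule sum_integral_le_nn_integral[OF \<sigma>(1) \<sigma>(3)])
      fix i assume i: "i < N"
      have sub: "{\<sigma> i..\<sigma> (Suc i)} \<subseteq> {0..}" using \<sigma>0[of i] i by auto
      have "continuous_on {\<sigma> i..\<sigma> (Suc i)} (\<lambda>t. tanh (w t))"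
      proof -
        have "cosh (w t) \<noteq> 0" if "t \<in> {\<sigma> i..\<sigma> (Suc i)}" for t
          using cosh_not_nonpos_on_sheet[OF lift(1), of t] sub that by auto
        thus ?thesis unfolding tanh_def by (intro continuous_intros continuous_on_subset[OF cw sub]) auto
      qed
      hence "continuous_on {\<sigma> i..\<sigma> (Suc i)} (\<lambda>t. f (tanh (w t)))"
        by (rule continuous_on_compose2[OF holomorphic_on_imp_continuous_on[OF f]]) auto
      thus "continuous_on {\<sigma> i..\<sigma> (Suc i)} (\<lambda>t. cmod (f (tanh (w t)) * \<beta>' i t))"
        by (intro continuous_intros \<beta>'(1)[OF i])
      fix t assume t: "\<sigma> i < t" "t < \<sigma> (Suc i)"
      have t0: "t > 0" using t \<sigma>0[of i] i by simp
      have "(beta_path \<gamma> q has_vector_derivative \<beta>' i t) (at t)"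
        by (rule has_vector_derivative_transform_within_open[OF \<beta>'(2)[OF i t], of "{0<..}"]) (use t0 \<beta> in auto)
      hence "vector_derivative (beta_path \<gamma> q) (at t) = \<beta>' i t" by (rule vector_derivative_at)
      thus "cmod (f (beta_path \<gamma> q t) * vector_derivative (beta_path \<gamma> q) (at t)) = cmod (f (tanh (w t)) * \<beta>' i t)"
        using \<beta>[of t] t0 by simp
    qed auto
    have \<Omega>nn: "\<Omega> (\<beta>' i) i \<ge> 0" and \<Psi>nn: "\<Psi> (\<beta>' i) i \<ge> 0" for i
      using Inn u unfolding \<Omega>_def \<Psi>_def I_def[symmetric] by (auto intro!: add_nonneg_nonneg sum_nonneg mult_nonneg_nonneg)
    have enn_sum: "(\<Sum>s\<in>S. ennreal (1 / u ^ s) * ennreal (I i (f s))) = ennreal (\<Sum>s\<in>S. 1 / u ^ s * I i (f s))" for S i f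
    proof -
      have "(\<Sum>s\<in>S. ennreal (1 / u ^ s) * ennreal (I i (f s))) = (\<Sum>s\<in>S. ennreal (1 / u ^ s * I i (f s)))"
        by (intro sum.cong refl ennreal_mult[symmetric]) (use Inn u in auto)
      also have "\<dots> = ennreal (\<Sum>s\<in>S. 1 / u ^ s * I i (f s))"
        by (rule sum_ennreal) (use Inn u in auto)
      finally show ?thesis .
    qed
    have "(\<Sum>i<N. ennreal (\<Omega> (\<beta>' i) i)) \<le> omega_tilde n u (beta_path \<gamma> q)"
    proof -
      have "ennreal (\<Omega> (\<beta>' i) i) = 2 * ennreal (I i (deriv (E_tilde n))) + (\<Sum>s = 1..n - 1. ennreal (1 / u ^ s) * ennreal (I i (F_bil s)))" for i
      proof -
        have "\<Omega> (\<beta>' i) i = 2 * I i (deriv (E_tilde n)) + (\<Sum>s = 1..n - 1. 1 / u ^ s * I i (F_bil s))"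
          by (simp add: \<Omega>_def I_def)
        moreover have "(\<Sum>s = 1..n - 1. 1 / u ^ s * I i (F_bil s)) \<ge> 0"
          using Inn u by (intro sum_nonneg mult_nonneg_nonneg) auto
        ultimately show ?thesis unfolding enn_sum using Inn by (simp add: ennreal_plus ennreal_mult)
      qed
      hence "(\<Sum>i<N. ennreal (\<Omega> (\<beta>' i) i)) = 2 * (\<Sum>i<N. ennreal (I i (deriv (E_tilde n)))) + (\<Sum>s = 1..n - 1. ennreal (1 / u ^ s) * (\<Sum>i<N. ennreal (I i (F_bil s))))"
        by (simp only: sum.distrib sum_distrib_left[symmetric] sum.swap[of _ "{1..n - 1}" "{..<N}"])
      also have "\<dots> \<le> omega_tilde n u (beta_path \<gamma> q)"
        unfolding omega_tilde_def using sumI[OF hB]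
        by (intro add_mono mult_left_mono sum_mono sumI hE) (auto simp: F_bil_def[abs_def])
      finally show ?thesis .
    qed
    hence sum\<Omega>: "(\<Sum>i<N. \<Omega> (\<beta>' i) i) \<le> \<omega>"
      using enn2real_mono[of "ennreal (\<Sum>i<N. \<Omega> (\<beta>' i) i)" "omega_tilde n u (beta_path \<gamma> q)"] \<Omega>nn fin(1)
      by (simp add: \<omega>_def sum_ennreal sum_nonneg)
    have "(\<Sum>i<N. ennreal (\<Psi> (\<beta>' i) i)) \<le> varpi_tilde n u (beta_path \<gamma> q)"
    proof -
      have "ennreal (\<Psi> (\<beta>' i) i) = 4 * (\<Sum>s<n - 1. ennreal (1 / u ^ s) * ennreal (I i (deriv (E_tilde (s + 1)))))" for i
      proof -
        have "\<Psi> (\<beta>' i) i = 4 * (\<Sum>s<n - 1. 1 / u ^ s * I i (deriv (E_tilde (s + 1))))"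
          by (simp add: \<Psi>_def I_def)
        moreover have "(\<Sum>s<n - 1. 1 / u ^ s * I i (deriv (E_tilde (s + 1)))) \<ge> 0"
          using Inn u by (intro sum_nonneg mult_nonneg_nonneg) auto
        ultimately show ?thesis unfolding enn_sum by (simp add: ennreal_mult)
      qed
      hence "(\<Sum>i<N. ennreal (\<Psi> (\<beta>' i) i)) = 4 * (\<Sum>s<n - 1. ennreal (1 / u ^ s) * (\<Sum>i<N. ennreal (I i (deriv (E_tilde (s + 1))))))"
        by (simp only: sum.distrib sum_distrib_left[symmetric] sum.swap[of _ "{..<n - 1}" "{..<N}"])
      also have "\<dots> \<le> varpi_tilde n u (beta_path \<gamma> q)"
        unfolding varpi_tilde_def
        by (intro add_mono mult_left_mono sum_mono sumI hE hB) auto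
      finally show ?thesis .
    qed
    hence sum\<Psi>: "(\<Sum>i<N. \<Psi> (\<beta>' i) i) \<le> \<nu>"
      using enn2real_mono[of "ennreal (\<Sum>i<N. \<Psi> (\<beta>' i) i)" "varpi_tilde n u (beta_path \<gamma> q)"] \<Psi>nn fin(2)
      by (simp add: \<nu>_def sum_ennreal sum_nonneg)
    have "M (\<sigma> 0) \<le> (M (\<sigma> N) + (\<Sum>i<N. 1 / u ^ n * \<Omega> (\<beta>' i) i)) * exp (\<Sum>i<N. 1 / u * \<Psi> (\<beta>' i) i + 1 / u ^ n * \<Omega> (\<beta>' i) i)"
      by (rule gronwall_chain[of N "\<lambda>i. M (\<sigma> i)"]) (use \<beta>'(3) \<Omega>nn \<Psi>nn u in \<open>auto intro!: add_nonneg_nonneg\<close>)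
    also have "(\<Sum>i<N. 1 / u ^ n * \<Omega> (\<beta>' i) i) = 1 / u ^ n * (\<Sum>i<N. \<Omega> (\<beta>' i) i)"
      by (simp only: sum_distrib_left)
    also have "(\<Sum>i<N. 1 / u * \<Psi> (\<beta>' i) i + 1 / u ^ n * \<Omega> (\<beta>' i) i) = 1 / u * (\<Sum>i<N. \<Psi> (\<beta>' i) i) + 1 / u ^ n * (\<Sum>i<N. \<Omega> (\<beta>' i) i)"
      by (simp only: sum.distrib sum_distrib_left)
    also have "(M (\<sigma> N) + 1 / u ^ n * (\<Sum>i<N. \<Omega> (\<beta>' i) i)) * exp (1 / u * (\<Sum>i<N. \<Psi> (\<beta>' i) i) + 1 / u ^ n * (\<Sum>i<N. \<Omega> (\<beta>' i) i))
      \<le> (e / E + 1 / u ^ n * \<omega>) * E"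
      unfolding E_def[symmetric]
    proof (intro mult_mono add_mono mult_left_mono)
      show "exp (1 / u * (\<Sum>i<N. \<Psi> (\<beta>' i) i) + 1 / u ^ n * (\<Sum>i<N. \<Omega> (\<beta>' i) i)) \<le> E"
        unfolding E_def using u sum\<Omega> sum\<Psi> by (subst exp_le_cancel_iff, intro add_mono mult_left_mono) auto
      show "M (\<sigma> N) \<le> e / E" using T[OF \<sigma>(2)] by simp
    qed (use u sum\<Omega> E e \<Omega>nn in \<open>auto simp: \<omega>_def intro!: add_nonneg_nonneg divide_nonneg_nonneg sum_nonneg\<close>)
    also have "\<dots> = 1 / u ^ n * \<omega> * E + e" using E by (simp add: field_simps)
    finally show ?thesis by (simp add: \<sigma>(1) E_def)
  qed
  have "cmod (\<eta> (w 0)) \<le> M 0"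
    unfolding M_def using norm_triangle_ineq[of "\<eta> (w 0) - \<theta> (w 0) / (2 * of_real u)" "\<theta> (w 0) / (2 * of_real u)"] by simp
  also have "M 0 \<le> 1 / u ^ n * \<omega> * exp (1 / u * \<nu> + 1 / u ^ n * \<omega>)" by (rule field_le_epsilon) (rule main)
  finally show "cmod (\<eta> (w 0)) \<le> 1 / u ^ n * enn2real (omega_tilde n u (beta_path \<gamma> q)) *
        exp (1 / u * enn2real (varpi_tilde n u (beta_path \<gamma> q)) + 1 / u ^ n * enn2real (omega_tilde n u (beta_path \<gamma> q)))"
    by (simp add: \<omega>_def \<nu>_def)
qed

end

subsection \<open>Reflection and the theorem\<close>

lemma R2_arc_on_minus: "R2_arc_on \<gamma> I \<Longrightarrow> R2_arc_on (\<lambda>t. - \<gamma> t) I"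
proof (rule R2_arc_on_compose_holomorphic[where f = uminus and S = UNIV])
  have d: "(uminus has_field_derivative - 1) (at z)" for z :: complex
    by (rule DERIV_minus[OF DERIV_ident, simplified])
  show "deriv uminus (\<gamma> t) \<noteq> 0" for t using DERIV_imp_deriv[OF d, of "\<gamma> t"] by simp
qed (auto intro: holomorphic_intros)

lemma R2_chain_minus: "R2_chain \<gamma> \<Longrightarrow> R2_chain (\<lambda>t. - \<gamma> t)"
  by (erule R2_chain_map) (rule R2_arc_on_minus)

text \<open>For Re z other than 0 the preimage lies in the open strip, which w -> -w preserves, and
  Xi is odd.\<close>

lemma xi_bar_minus:
  assumes "Re z \<noteq> 0"
  shows "xi_bar (- z) = - xi_bar z"
proof -
  define v where "v = arsinh_pr z"
  have v: "sinh v = z" "xi_bar z = Xi v" "\<bar>Im v\<bar> < pi / 2"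
    using assms arsinh_pr(1,4,5,6)[of z] by (auto simp: v_def linorder_neq_iff)
  have "sinh (- v) = - z" "\<bar>Im (- v)\<bar> < pi / 2" using v by auto
  from principal_sinh(2)[OF this(2)] this(1) show ?thesis by (simp add: v(2) Xi_minus)
qed

text \<open>1 + z^2 is even, so q is kept; negating z and X replaces the exponential equation by its
  reciprocal, as (z + q^2) (q^2 - z) = 1.\<close>

lemma continued_along_minus:
  assumes c: "continued_along \<gamma> q X" and ev: "\<forall>\<^sub>F t in at_top. Re (\<gamma> t) \<noteq> 0"
  shows "continued_along (\<lambda>t. - \<gamma> t) q (\<lambda>t. - X t)"
  unfolding continued_along_def
proof (intro conjI allI impI)
  show "continuous_on {0..} q" "continuous_on {0..} (\<lambda>t. - X t)"
    using c by (auto simp: continued_along_def intro: continuous_intros)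
  fix t :: real assume t: "t \<ge> 0"
  show "q t ^ 4 = 1 + (- \<gamma> t)\<^sup>2" using c t by (simp add: continued_along_def)
  hence q4: "(q t)\<^sup>2 * (q t)\<^sup>2 = 1 + (\<gamma> t)\<^sup>2" by (simp add: power4_eq_xxxx power2_eq_square mult.assoc)
  have e: "exp (2 * X t - \<gamma> t * (q t)\<^sup>2) = \<gamma> t + (q t)\<^sup>2" using c t by (simp add: continued_along_def)
  have "(\<gamma> t + (q t)\<^sup>2) * ((q t)\<^sup>2 - \<gamma> t) = 1" using q4 by (simp add: algebra_simps power2_eq_square)
  hence "inverse (\<gamma> t + (q t)\<^sup>2) = (q t)\<^sup>2 - \<gamma> t" by (rule inverse_unique)
  moreover have "2 * - X t - - \<gamma> t * (q t)\<^sup>2 = - (2 * X t - \<gamma> t * (q t)\<^sup>2)" by simp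
  ultimately show "exp (2 * - X t - - \<gamma> t * (q t)\<^sup>2) = - \<gamma> t + (q t)\<^sup>2"
    by (simp only: exp_minus e) simp
next
  have "\<forall>\<^sub>F t in at_top. q t = (1 + (\<gamma> t)\<^sup>2) powr (1 / 4) \<and> X t = xi_bar (\<gamma> t)"
    using c by (simp add: continued_along_def)
  thus "\<forall>\<^sub>F t in at_top. q t = (1 + (- \<gamma> t)\<^sup>2) powr (1 / 4) \<and> - X t = xi_bar (- \<gamma> t)"
    using ev by eventually_elim (simp add: xi_bar_minus)
qed

lemma admissible_path_minus:
  assumes "j = 1 \<and> j' = 2 \<or> j = 2 \<and> j' = (1::nat)" "admissible_path j \<gamma> q X"
  shows "admissible_path j' (\<lambda>t. - \<gamma> t) q (\<lambda>t. - X t)"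
proof -
  have *: "- ((- 1) ^ j' * r) = (- 1) ^ j * (r :: real)" for r using assms(1) by auto
  have fl: "filterlim (\<lambda>t. (- 1) ^ j * Re (\<gamma> t)) at_top at_top" using assms(2) by (simp add: admissible_path_def)
  hence "\<forall>\<^sub>F t in at_top. (- 1) ^ j * Re (\<gamma> t) > 0" by (simp add: filterlim_at_top_dense)
  hence ev: "\<forall>\<^sub>F t in at_top. Re (\<gamma> t) \<noteq> 0" by eventually_elim auto
  have "- \<gamma> t \<noteq> \<i> \<and> - \<gamma> t \<noteq> - \<i>" if "t \<ge> 0" for t
    using assms(2) that unfolding admissible_path_def by (metis add.inverse_inverse)
  thus ?thesis
    using assms(2) fl continued_along_minus[OF _ ev] R2_chain_minus[of \<gamma>]
    unfolding admissible_path_def by (simp add: *)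
qed

lemma norm_vector_derivative_minus:
  fixes \<beta> :: "real \<Rightarrow> complex"
  shows "cmod (vector_derivative (\<lambda>t. - \<beta> t) (at t)) = cmod (vector_derivative \<beta> (at t))"
proof (cases "\<beta> differentiable (at t)")
  case True
  hence "((\<lambda>t. - \<beta> t) has_vector_derivative - vector_derivative \<beta> (at t)) (at t)"
    by (intro has_vector_derivative_minus) (simp add: vector_derivative_works)
  thus ?thesis by (simp add: vector_derivative_at)
next
  case False
  moreover have "\<not> (\<lambda>t. - \<beta> t) differentiable (at t)"
  proof
    assume "(\<lambda>t. - \<beta> t) differentiable (at t)"
    from differentiable_minus[OF this] show False using False by simp
  qed
  \<comment> \<open>At such points both uses of \<open>vector_derivative\<close> choose from an
    empty predicate and hence yield the same unspecified value.\<close>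
  ultimately have "\<not> (\<beta> has_vector_derivative d) (at t)" "\<not> ((\<lambda>t. - \<beta> t) has_vector_derivative d) (at t)" for d
    by (auto intro: differentiableI_vector)
  thus ?thesis by (simp add: vector_derivative_def)
qed

lemma abs_path_integral_minus:
  assumes "\<And>p. cmod (f (- p)) = cmod (f p)"
  shows "abs_path_integral f (\<lambda>t. - \<beta> t) = abs_path_integral f \<beta>"
  by (simp add: abs_path_integral_def norm_mult assms norm_vector_derivative_minus)

lemma deriv_E_tilde_minus: "deriv (E_tilde s) (- p) = (- 1) ^ Suc s * deriv (E_tilde s) p"
  using deriv_minus_parity[OF E_tilde_derivs(1) E_tilde_minus, of s p] by simp

text \<open>E_s' has parity (-1)^(s+1), and all terms of a bilinear sum share the parity
  (-1)^(s+n+1), so every integrand has the same modulus at p and -p.\<close>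

lemma within_error_bound_minus:
  assumes "n \<ge> 1"
  shows "within_error_bound n u (\<lambda>t. - \<beta> t) e \<longleftrightarrow> within_error_bound n u \<beta> e"
proof -
  have E: "abs_path_integral (deriv (E_tilde s)) (\<lambda>t. - \<beta> t) = abs_path_integral (deriv (E_tilde s)) \<beta>" for s
    by (rule abs_path_integral_minus) (simp add: deriv_E_tilde_minus norm_mult norm_power)
  have B: "abs_path_integral (\<lambda>p. \<Sum>k = s..n - 1. (1 - p\<^sup>2)\<^sup>2 * deriv (E_tilde k) p * deriv (E_tilde (s + n - k - 1)) p) (\<lambda>t. - \<beta> t)
    = abs_path_integral (\<lambda>p. \<Sum>k = s..n - 1. (1 - p\<^sup>2)\<^sup>2 * deriv (E_tilde k) p * deriv (E_tilde (s + n - k - 1)) p) \<beta>" for s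
  proof (rule abs_path_integral_minus)
    fix p :: complex
    have "(\<Sum>k = s..n - 1. (1 - (- p)\<^sup>2)\<^sup>2 * deriv (E_tilde k) (- p) * deriv (E_tilde (s + n - k - 1)) (- p))
      = (\<Sum>k = s..n - 1. (- 1) ^ (s + n + 1) * ((1 - p\<^sup>2)\<^sup>2 * deriv (E_tilde k) p * deriv (E_tilde (s + n - k - 1)) p))"
    proof (rule sum.cong[OF refl])
      fix k assume k: "k \<in> {s..n - 1}"
      have "(- 1 :: complex) ^ Suc k * (- 1) ^ Suc (s + n - k - 1) = (- 1) ^ (Suc k + Suc (s + n - k - 1))"
        by (simp only: power_add)
      also have "Suc k + Suc (s + n - k - 1) = s + n + 1" using k assms by auto
      finally have "(- 1 :: complex) ^ Suc k * (- 1) ^ Suc (s + n - k - 1) = (- 1) ^ (s + n + 1)" .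
      moreover have "(1 - (- p)\<^sup>2)\<^sup>2 * deriv (E_tilde k) (- p) * deriv (E_tilde (s + n - k - 1)) (- p)
        = ((- 1) ^ Suc k * (- 1) ^ Suc (s + n - k - 1)) * ((1 - p\<^sup>2)\<^sup>2 * deriv (E_tilde k) p * deriv (E_tilde (s + n - k - 1)) p)"
        unfolding deriv_E_tilde_minus by (simp add: mult_ac)
      ultimately show "(1 - (- p)\<^sup>2)\<^sup>2 * deriv (E_tilde k) (- p) * deriv (E_tilde (s + n - k - 1)) (- p)
        = (- 1) ^ (s + n + 1) * ((1 - p\<^sup>2)\<^sup>2 * deriv (E_tilde k) p * deriv (E_tilde (s + n - k - 1)) p)"
        by (simp only:)
    qed
    thus "cmod (\<Sum>k = s..n - 1. (1 - (- p)\<^sup>2)\<^sup>2 * deriv (E_tilde k) (- p) * deriv (E_tilde (s + n - k - 1)) (- p))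
      = cmod (\<Sum>k = s..n - 1. (1 - p\<^sup>2)\<^sup>2 * deriv (E_tilde k) p * deriv (E_tilde (s + n - k - 1)) p)"
      by (simp only: sum_distrib_left[symmetric] norm_mult norm_power norm_minus_cancel norm_one power_one mult_1)
  qed
  show ?thesis by (simp only: within_error_bound_def omega_tilde_def varpi_tilde_def E B)
qed

text \<open>The map z -> -z turns the exceptional set into its negative, while the theorem reflects
  it in the imaginary axis; by this symmetry the two agree.\<close>

lemma exceptional_set_cnj: "cnj z \<in> exceptional_set \<longleftrightarrow> z \<in> exceptional_set"
proof -
  have "Re (xi_bar (cnj z)) = Re (xi_bar z)" if "Re z < 0" for z
  proof -
    define v where "v = arsinh_pr z"
    have v: "sinh v = z" "\<bar>Im v\<bar> < pi / 2" "xi_bar z = Xi v" using arsinh_pr(1,4,6)[of z] that by (auto simp: v_def)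
    have "sinh (cnj v) = cnj z" using v(1) by (auto simp: complex_eq_iff Re_Im_sinh_cosh)
    with principal_sinh(2)[of "cnj v"] v show ?thesis by (simp add: Re_Xi)
  qed
  moreover have "cnj z = \<i> \<longleftrightarrow> z = - \<i>" "cnj z = - \<i> \<longleftrightarrow> z = \<i>" by (auto simp: complex_eq_iff)
  ultimately show ?thesis by (auto simp: exceptional_set_eq)
qed

text \<open>Reading the error off at the unique preimage in the sheet makes it a function of z
  alone, so that one function serves all admissible paths.\<close>

definition eta_2 :: "real \<Rightarrow> nat \<Rightarrow> complex \<Rightarrow> complex" where
  "eta_2 u n z = lg_eta u n (the_inv_into sheet sinh z)"

lemma liouville_green_derivative:
  assumes u: "u > 0" and n: "n \<ge> 1" and adm: "admissible_path 2 \<gamma> q X"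
  shows "deriv (parabolic_cylinder_U (of_real (u / 2))) (of_real (sqrt (2 * u)) * \<gamma> 0) =
         - 1 / 2 * of_real ((2 * exp 1 / u) powr (u / 4)) *
         (of_real ((2 * u) powr (1 / 4)) * q 0) *
         exp (- of_real u * X 0 +
              (\<Sum>s = 1..n - 1. (- 1) ^ s * (E_tilde s (beta_path \<gamma> q 0) - E_tilde s 1) / of_real u ^ s)) *
         (1 + eta_2 u n (\<gamma> 0))"
    and "within_error_bound n u (beta_path \<gamma> q) (eta_2 u n (\<gamma> 0))"
proof -
  define w where "w = 2 * X 0 - \<gamma> 0 * (q 0)\<^sup>2"
  have lift: "w \<in> sheet" "\<gamma> 0 = sinh w" "q 0 = csqrt (cosh w)" "X 0 = Xi w"
    using admissible_lift[OF adm, of 0] by (simp_all add: w_def)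
  have "the_inv_into sheet sinh (\<gamma> 0) = w"
    unfolding lift(2) by (rule the_inv_into_f_f[OF inj_on_sinh_sheet lift(1)])
  hence eta: "eta_2 u n (\<gamma> 0) = lg_eta u n w" by (simp add: eta_2_def)
  have "cosh w \<noteq> 0" using cosh_not_nonpos_on_sheet[OF lift(1)] by auto
  hence q0: "q 0 \<noteq> 0" using lift(3) by simp
  have \<beta>: "beta_path \<gamma> q 0 = tanh w" using lift by (simp add: beta_path_def tanh_def)
  have e: "- of_real u * X 0 + (\<Sum>s = 1..n - 1. (- 1) ^ s * (E_tilde s (beta_path \<gamma> q 0) - E_tilde s 1) / of_real u ^ s)
    = lg_exponent u n w"
    by (simp only: lg_exponent_def[OF u n] \<beta> lift(4))
  have "1 + lg_eta u n w = deriv (pcU u) (of_real (sqrt (2 * u)) * \<gamma> 0) / (q 0 * (lg_const u * exp (lg_exponent u n w)))"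
    by (simp add: lg_eta_def[OF u n] lg_V_def[OF u n] lift)
  hence "deriv (pcU u) (of_real (sqrt (2 * u)) * \<gamma> 0) = lg_const u * q 0 * exp (lg_exponent u n w) * (1 + lg_eta u n w)"
    using q0 lg_const_nonzero[OF u n] by (simp add: field_simps)
  thus "deriv (parabolic_cylinder_U (of_real (u / 2))) (of_real (sqrt (2 * u)) * \<gamma> 0) =
         - 1 / 2 * of_real ((2 * exp 1 / u) powr (u / 4)) *
         (of_real ((2 * u) powr (1 / 4)) * q 0) *
         exp (- of_real u * X 0 +
              (\<Sum>s = 1..n - 1. (- 1) ^ s * (E_tilde s (beta_path \<gamma> q 0) - E_tilde s 1) / of_real u ^ s)) *
         (1 + eta_2 u n (\<gamma> 0))"
    unfolding e eta lg_const_def[OF u n] pcU_def[OF u n] by (simp only: mult.assoc)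
  show "within_error_bound n u (beta_path \<gamma> q) (eta_2 u n (\<gamma> 0))"
    unfolding eta w_def by (rule lg_path_error_bound[OF u n adm])
qed

theorem mainTheorem4:
  fixes u :: real and n :: nat
  assumes "u > 0" and "n \<ge> 1"
  shows
    "(\<exists>\<eta>2 :: complex \<Rightarrow> complex. \<forall>\<gamma> q X z \<beta>.
       admissible_path 2 \<gamma> q X \<and> z = \<gamma> 0 \<and> \<beta> = beta_path \<gamma> q 0 \<longrightarrow>
       deriv (parabolic_cylinder_U (of_real (u / 2))) (of_real (sqrt (2 * u)) * z) =
         - 1 / 2 * of_real ((2 * exp 1 / u) powr (u / 4)) *
         (of_real ((2 * u) powr (1 / 4)) * q 0) *
         exp (- of_real u * X 0 +
              (\<Sum>s = 1..n - 1. (- 1) ^ s * (E_tilde s \<beta> - E_tilde s 1) / of_real u ^ s)) *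
         (1 + \<eta>2 z) \<and>
       within_error_bound n u (beta_path \<gamma> q) (\<eta>2 z)) \<and>
     (\<exists>\<eta>1 :: complex \<Rightarrow> complex. \<forall>\<gamma> q X z \<beta>.
       admissible_path 1 \<gamma> q X \<and> z = \<gamma> 0 \<and> \<beta> = beta_path \<gamma> q 0 \<longrightarrow>
       deriv (parabolic_cylinder_U (of_real (u / 2))) (- of_real (sqrt (2 * u)) * z) =
         - 1 / 2 * of_real ((2 * exp 1 / u) powr (u / 4)) *
         (of_real ((2 * u) powr (1 / 4)) * q 0) *
         exp (of_real u * X 0 +
              (\<Sum>s = 1..n - 1. (E_tilde s \<beta> - E_tilde s (- 1)) / of_real u ^ s)) *
         (1 + \<eta>1 z) \<and>
       within_error_bound n u (beta_path \<gamma> q) (\<eta>1 z)) \<and>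
     {z. \<exists>\<gamma> q X. admissible_path 2 \<gamma> q X \<and> \<gamma> 0 = z} = - exceptional_set \<and>
     {z. \<exists>\<gamma> q X. admissible_path 1 \<gamma> q X \<and> \<gamma> 0 = z} = - ((\<lambda>z. - cnj z) ` exceptional_set)"
proof (intro conjI)
  show "\<exists>\<eta>2 :: complex \<Rightarrow> complex. \<forall>\<gamma> q X z \<beta>.
       admissible_path 2 \<gamma> q X \<and> z = \<gamma> 0 \<and> \<beta> = beta_path \<gamma> q 0 \<longrightarrow>
       deriv (parabolic_cylinder_U (of_real (u / 2))) (of_real (sqrt (2 * u)) * z) =
         - 1 / 2 * of_real ((2 * exp 1 / u) powr (u / 4)) *
         (of_real ((2 * u) powr (1 / 4)) * q 0) *
         exp (- of_real u * X 0 +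
              (\<Sum>s = 1..n - 1. (- 1) ^ s * (E_tilde s \<beta> - E_tilde s 1) / of_real u ^ s)) *
         (1 + \<eta>2 z) \<and>
       within_error_bound n u (beta_path \<gamma> q) (\<eta>2 z)"
    using liouville_green_derivative[OF assms] by (intro exI[of _ "eta_2 u n"]) blast
next
  show "\<exists>\<eta>1 :: complex \<Rightarrow> complex. \<forall>\<gamma> q X z \<beta>.
       admissible_path 1 \<gamma> q X \<and> z = \<gamma> 0 \<and> \<beta> = beta_path \<gamma> q 0 \<longrightarrow>
       deriv (parabolic_cylinder_U (of_real (u / 2))) (- of_real (sqrt (2 * u)) * z) =
         - 1 / 2 * of_real ((2 * exp 1 / u) powr (u / 4)) *
         (of_real ((2 * u) powr (1 / 4)) * q 0) *
         exp (of_real u * X 0 +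
              (\<Sum>s = 1..n - 1. (E_tilde s \<beta> - E_tilde s (- 1)) / of_real u ^ s)) *
         (1 + \<eta>1 z) \<and>
       within_error_bound n u (beta_path \<gamma> q) (\<eta>1 z)"
  proof (intro exI[of _ "\<lambda>z. eta_2 u n (- z)"] allI impI, elim conjE)
    fix \<gamma> q X z \<beta>
    assume adm: "admissible_path 1 \<gamma> q X" and z: "z = \<gamma> 0" and \<beta>: "\<beta> = beta_path \<gamma> q 0"
    have adm': "admissible_path 2 (\<lambda>t. - \<gamma> t) q (\<lambda>t. - X t)" by (rule admissible_path_minus[OF _ adm]) simp
    have bp: "beta_path (\<lambda>t. - \<gamma> t) q = (\<lambda>t. - beta_path \<gamma> q t)" by (auto simp: beta_path_def)
    \<comment> \<open>By parity both terms absorb the alternating sign, and the constant changes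
      from E_s(1) to E_s(-1).\<close>
    have "(- 1) ^ s * (E_tilde s (- \<beta>) - E_tilde s 1) = E_tilde s \<beta> - E_tilde s (- 1)" for s
      by (simp add: E_tilde_minus right_diff_distrib mult.assoc[symmetric] flip: power_mult_distrib)
    hence sum: "(\<Sum>s = 1..n - 1. (- 1) ^ s * (E_tilde s (- \<beta>) - E_tilde s 1) / of_real u ^ s)
      = (\<Sum>s = 1..n - 1. (E_tilde s \<beta> - E_tilde s (- 1)) / of_real u ^ s)" by simp
    note lg = liouville_green_derivative[OF assms adm', unfolded bp, folded \<beta> z, unfolded sum within_error_bound_minus[OF assms(2)]]
    show "deriv (parabolic_cylinder_U (of_real (u / 2))) (- of_real (sqrt (2 * u)) * z) =
         - 1 / 2 * of_real ((2 * exp 1 / u) powr (u / 4)) *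
         (of_real ((2 * u) powr (1 / 4)) * q 0) *
         exp (of_real u * X 0 +
              (\<Sum>s = 1..n - 1. (E_tilde s \<beta> - E_tilde s (- 1)) / of_real u ^ s)) *
         (1 + eta_2 u n (- z)) \<and>
       within_error_bound n u (beta_path \<gamma> q) (eta_2 u n (- z))"
      using lg by simp
  qed
next
  show "{z. \<exists>\<gamma> q X. admissible_path 2 \<gamma> q X \<and> \<gamma> 0 = z} = - exceptional_set"
    by (rule admissible_start_points)
  have "{z. \<exists>\<gamma> q X. admissible_path 1 \<gamma> q X \<and> \<gamma> 0 = z} = {z. \<exists>\<gamma> q X. admissible_path 2 \<gamma> q X \<and> \<gamma> 0 = - z}"
  proof (intro Collect_cong iffI; elim exE conjE)
    fix z \<gamma> q X assume "admissible_path 1 \<gamma> q X" "\<gamma> 0 = z"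
    thus "\<exists>\<gamma> q X. admissible_path 2 \<gamma> q X \<and> \<gamma> 0 = - z"
      using admissible_path_minus[of 1 2 \<gamma> q X] by fastforce
  next
    fix z \<gamma> q X assume "admissible_path 2 \<gamma> q X" "\<gamma> 0 = - z"
    thus "\<exists>\<gamma> q X. admissible_path 1 \<gamma> q X \<and> \<gamma> 0 = z"
      using admissible_path_minus[of 2 1 \<gamma> q X] by fastforce
  qed
  also have "\<dots> = {z. - z \<notin> exceptional_set}"
    using admissible_start_points by (auto simp: set_eq_iff)
  also have "\<dots> = - ((\<lambda>z. - cnj z) ` exceptional_set)"
  proof -
    have "z \<in> (\<lambda>z. - cnj z) ` exceptional_set \<longleftrightarrow> - z \<in> exceptional_set" for z
    proof
      assume "- z \<in> exceptional_set"
      hence "cnj (- z) \<in> exceptional_set" by (simp only: exceptional_set_cnj)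
      thus "z \<in> (\<lambda>z. - cnj z) ` exceptional_set" by (intro image_eqI[of _ _ "cnj (- z)"]) auto
    qed (auto simp: exceptional_set_cnj)
    thus ?thesis by blast
  qed
  finally show "{z. \<exists>\<gamma> q X. admissible_path 1 \<gamma> q X \<and> \<gamma> 0 = z} = - ((\<lambda>z. - cnj z) ` exceptional_set)" .
qed

end
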